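(* Let $G$ be a compact Lie group of dimension $n$, let $\triangle_1,\dots,\triangle_n\in\mathrm{diff}^1(\widehat G)$ be a strongly admissible selection of first order difference operators, and let $Q\in\mathrm{diff}^\ell(\widehat G)$ be an arbitrary difference operator of order $\ell$. Then for every $N\in\mathbb N$ $$Q=\sum_{\ell\le|\alpha|\le N-1}c_\alpha\triangle_\xi^\alpha+Q_N$$ for suitable constants $c_\alpha\in\mathbb C$ and a difference operator $Q_N\in\mathrm{diff}^N(\widehat G)$.
   Context: $G$ is a compact Lie group with unit element $e$. $\widehat G$ is the set of equivalence classes $[\xi]$ of continuous irreducible unitary representations of $G$, and $\widehat f(\xi)=\int_Gf(x)\xi(x)^*dx$, extended to distributions. A difference operator of order $k$ is an operator $Q$ of the form $Q\widehat f(\xi)=\widehat{qf}(\xi)$ with a (complex-valued) $q\in C^\infty(G)$ vanishing of order $k$ at $e$, i.e. $(Pq)(e)=0$ for all left-invariant differential operators $P$ of order $k-1$. The set of these is $\mathrm{diff}^k(\widehat G)$. A collection $\triangle_1,\dots,\triangle_n\in\mathrm{diff}^1(\widehat G)$ with functions $q_1,\dots,q_n$ is strongly admissible if $dq_j(e)\ne0$ for all $j$, $\operatorname{rank}(dq_1(e),\dots,dq_n(e))=n$ (over $\mathbb C$) and $\bigcap_j\{x\in G:q_j(x)=0\}=\{e\}$. $\triangle_\xi^\alpha=\triangle_1^{\alpha_1}\cdots\triangle_n^{\alpha_n}$ for $\alpha\in\mathbb N_0^n$. *)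

theory Defs
  imports
    "HOL-Analysis.Analysis"
    "HOL-Library.Function_Algebras"
    "HOL-Algebra.Group"
    "Jordan_Normal_Form.Schur_Decomposition"
    "Jordan_Normal_Form.VS_Connect"
begin

section \<open>Smooth functions on relatively open subsets of a linear space\<close>

text \<open>
  The model space of a manifold is a linear subspace \<open>E\<close> of a Euclidean space type, so that its
  dimension is an arbitrary natural number, zero included. Derivatives are taken at \<open>x\<close> within
  \<open>E\<close>; they are determined in the directions of \<open>E\<close>.
\<close>

definition dir_deriv ::
    "'a::real_normed_vector set \<Rightarrow> 'a \<Rightarrow> ('a \<Rightarrow> 'b::real_normed_vector) \<Rightarrow> 'a \<Rightarrow> 'b" where
  "dir_deriv E v f = (\<lambda>x. frechet_derivative f (at x within E) v)"

primrec Ck_on ::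
    "nat \<Rightarrow> 'a::real_normed_vector set \<Rightarrow> 'a set \<Rightarrow> ('a \<Rightarrow> 'b::real_normed_vector) \<Rightarrow> bool" where
  "Ck_on 0 E W f \<longleftrightarrow> continuous_on W f"
| "Ck_on (Suc k) E W f \<longleftrightarrow>
     (\<forall>x\<in>W. f differentiable (at x within E)) \<and> (\<forall>v\<in>E. Ck_on k E W (dir_deriv E v f))"

definition smooth_on ::
    "'a::real_normed_vector set \<Rightarrow> 'a set \<Rightarrow> ('a \<Rightarrow> 'b::real_normed_vector) \<Rightarrow> bool" where
  "smooth_on E W f \<longleftrightarrow> (\<forall>k. Ck_on k E W f)"

primrec dir_derivs ::
    "'a::real_normed_vector set \<Rightarrow> 'a list \<Rightarrow> ('a \<Rightarrow> 'b::real_normed_vector) \<Rightarrow> 'a \<Rightarrow> 'b" where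
  "dir_derivs E [] f = f"
| "dir_derivs E (v # vs) f = dir_deriv E v (dir_derivs E vs f)"


section \<open>Compact Lie groups\<close>

type_synonym ('g, 'e) chart = "'g set \<times> ('g \<Rightarrow> 'e)"

record ('g, 'e) lie_group_data = "'g monoid" +
  topo :: "'g topology"
  model :: "'e set"
  atlas :: "('g, 'e) chart set"
  haar :: "'g measure"

definition chart_dom :: "('g, 'e) chart \<Rightarrow> 'g set" where
  "chart_dom c = fst c"

definition chart_map :: "('g, 'e) chart \<Rightarrow> 'g \<Rightarrow> 'e" where
  "chart_map c = snd c"

definition chart_img :: "('g, 'e) chart \<Rightarrow> 'e set" where
  "chart_img c = chart_map c ` chart_dom c"

definition chart_inv :: "('g, 'e) chart \<Rightarrow> 'e \<Rightarrow> 'g" where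
  "chart_inv c = inv_into (chart_dom c) (chart_map c)"

locale lie_group = Group.group G
  for G :: "('g, 'e::euclidean_space) lie_group_data" (structure) +
  assumes topspace_topo: "topspace (topo G) = carrier G"
    and Hausdorff: "Hausdorff_space (topo G)"
    and second_countable: "second_countable (topo G)"
    and subspace_model: "Real_Vector_Spaces.subspace (model G)"
    and atlas_cover: "(\<Union>c\<in>atlas G. chart_dom c) = carrier G"
    and chart_dom_open: "c \<in> atlas G \<Longrightarrow> openin (topo G) (chart_dom c)"
    and chart_img_open: "c \<in> atlas G \<Longrightarrow> openin (top_of_set (model G)) (chart_img c)"
    and chart_homeo: "c \<in> atlas G \<Longrightarrow>
      homeomorphic_map (subtopology (topo G) (chart_dom c)) (top_of_set (chart_img c)) (chart_map c)"
    and transition_smooth: "\<lbrakk>c \<in> atlas G; d \<in> atlas G\<rbrakk> \<Longrightarrow>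
      smooth_on (model G) (chart_map c ` (chart_dom c \<inter> chart_dom d)) (chart_map d \<circ> chart_inv c)"
    and mult_continuous:
      "continuous_map (prod_topology (topo G) (topo G)) (topo G) (\<lambda>(x, y). x \<otimes> y)"
    and mult_smooth: "\<lbrakk>a \<in> atlas G; b \<in> atlas G; c \<in> atlas G\<rbrakk> \<Longrightarrow>
      smooth_on (model G \<times> model G)
        {(s, t). s \<in> chart_img a \<and> t \<in> chart_img b \<and> chart_inv a s \<otimes> chart_inv b t \<in> chart_dom c}
        (\<lambda>(s, t). chart_map c (chart_inv a s \<otimes> chart_inv b t))"
    and inv_continuous: "continuous_map (topo G) (topo G) (\<lambda>x. inv x)"
    and inv_smooth: "\<lbrakk>a \<in> atlas G; c \<in> atlas G\<rbrakk> \<Longrightarrow>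
      smooth_on (model G) {s. s \<in> chart_img a \<and> inv (chart_inv a s) \<in> chart_dom c}
        (\<lambda>s. chart_map c (inv (chart_inv a s)))"

locale compact_lie_group = lie_group +
  assumes compact_topo: "compact_space (topo G)"
    and space_haar: "space (haar G) = carrier G"
    and sets_haar: "sets (haar G) = sigma_sets (carrier G) {U. openin (topo G) U}"
    and haar_normalized: "emeasure (haar G) (carrier G) = 1"
    and haar_left_invariant: "\<lbrakk>g \<in> carrier G; B \<in> sets (haar G)\<rbrakk> \<Longrightarrow>
      emeasure (haar G) ((\<lambda>x. g \<otimes> x) ` B) = emeasure (haar G) B"

definition lie_dim :: "('g, 'e::euclidean_space) lie_group_data \<Rightarrow> nat" where
  "lie_dim G = Real_Vector_Spaces.dim (model G)"


section \<open>Smooth functions, differential operators and distributions on the group\<close>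

text \<open>
  Functions on the group are total on the type; their values outside the carrier are irrelevant
  everywhere below.
\<close>

definition smooth_funs :: "('g, 'e::euclidean_space) lie_group_data \<Rightarrow> ('g \<Rightarrow> complex) set" where
  "smooth_funs G = {f. \<forall>c\<in>atlas G. smooth_on (model G) (chart_img c) (f \<circ> chart_inv c)}"

text \<open>
  Differential operators of order at most \<open>m\<close>: in each chart a finite linear combination, with
  smooth complex coefficients, of iterated directional derivatives \<open>\<partial>\<^sub>v\<^sub>1 \<dots> \<partial>\<^sub>v\<^sub>r\<close> with \<open>r \<le> m\<close>.
\<close>

definition diff_operator ::
    "('g, 'e::euclidean_space) lie_group_data \<Rightarrow> nat \<Rightarrow> (('g \<Rightarrow> complex) \<Rightarrow> 'g \<Rightarrow> complex) \<Rightarrow> bool" where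
  "diff_operator G m P \<longleftrightarrow> (\<forall>c\<in>atlas G. \<exists>L a. finite L \<and>
     (\<forall>vs\<in>L. set vs \<subseteq> model G \<and> length vs \<le> m \<and> smooth_on (model G) (chart_img c) (a vs)) \<and>
     (\<forall>f\<in>smooth_funs G. \<forall>x\<in>chart_dom c.
        P f x = (\<Sum>vs\<in>L. a vs (chart_map c x) *
                   dir_derivs (model G) vs (f \<circ> chart_inv c) (chart_map c x))))"

definition left_invariant ::
    "('g, 'e::euclidean_space) lie_group_data \<Rightarrow> (('g \<Rightarrow> complex) \<Rightarrow> 'g \<Rightarrow> complex) \<Rightarrow> bool" where
  "left_invariant G P \<longleftrightarrow> (\<forall>g\<in>carrier G. \<forall>f\<in>smooth_funs G. \<forall>x\<in>carrier G.
     P (\<lambda>y. f (g \<otimes>\<^bsub>G\<^esub> y)) x = P f (g \<otimes>\<^bsub>G\<^esub> x))"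

definition vanishes_of_order ::
    "('g, 'e::euclidean_space) lie_group_data \<Rightarrow> nat \<Rightarrow> ('g \<Rightarrow> complex) \<Rightarrow> bool" where
  "vanishes_of_order G k q \<longleftrightarrow>
     (\<forall>m P. m < k \<longrightarrow> diff_operator G m P \<longrightarrow> left_invariant G P \<longrightarrow> P q \<one>\<^bsub>G\<^esub> = 0)"

text \<open>
  Distributions are the continuous linear functionals on the smooth functions, whose
  topology on a compact group is given by the seminorms \<open>f \<mapsto> sup \<bar>P f\<bar>\<close>, \<open>P\<close> ranging over the
  differential operators. A function \<open>f\<close> is identified with \<open>\<phi> \<mapsto> \<integral> f(x) \<phi>(x) dx\<close>.
\<close>

definition distributions ::
    "('g, 'e::euclidean_space) lie_group_data \<Rightarrow> (('g \<Rightarrow> complex) \<Rightarrow> complex) set" where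
  "distributions G = {u.
     (\<forall>f\<in>smooth_funs G. \<forall>g\<in>smooth_funs G. u (\<lambda>x. f x + g x) = u f + u g) \<and>
     (\<forall>a. \<forall>f\<in>smooth_funs G. u (\<lambda>x. a * f x) = a * u f) \<and>
     (\<exists>\<P> C. finite \<P> \<and> (\<forall>P\<in>\<P>. \<exists>m. diff_operator G m P) \<and>
        (\<forall>f\<in>smooth_funs G. cmod (u f) \<le> C * (\<Sum>P\<in>\<P>. SUP x\<in>carrier G. cmod (P f x))))}"

definition dist_mult ::
    "('g \<Rightarrow> complex) \<Rightarrow> (('g \<Rightarrow> complex) \<Rightarrow> complex) \<Rightarrow> ('g \<Rightarrow> complex) \<Rightarrow> complex" where
  "dist_mult q u = (\<lambda>f. u (\<lambda>x. q x * f x))"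

definition regular_dist ::
    "('g, 'e::euclidean_space) lie_group_data \<Rightarrow> ('g \<Rightarrow> complex) \<Rightarrow> ('g \<Rightarrow> complex) \<Rightarrow> complex" where
  "regular_dist G f = (\<lambda>\<phi>. LINT x|haar G. f x * \<phi> x)"


section \<open>Representations and the Fourier transform\<close>

definition unitary_rep ::
    "('g, 'e::euclidean_space) lie_group_data \<Rightarrow> nat \<Rightarrow> ('g \<Rightarrow> complex mat) \<Rightarrow> bool" where
  "unitary_rep G d \<xi> \<longleftrightarrow>
     \<xi> \<in> extensional (carrier G) \<and>
     (\<forall>x\<in>carrier G. \<xi> x \<in> carrier_mat d d \<and>
        \<xi> x * mat_adjoint (\<xi> x) = 1\<^sub>m d \<and> mat_adjoint (\<xi> x) * \<xi> x = 1\<^sub>m d) \<and>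
     (\<forall>x\<in>carrier G. \<forall>y\<in>carrier G. \<xi> (x \<otimes>\<^bsub>G\<^esub> y) = \<xi> x * \<xi> y) \<and>
     (\<forall>i<d. \<forall>j<d. continuous_map (topo G) euclidean (\<lambda>x. \<xi> x $$ (i, j)))"

definition irreducible_rep ::
    "('g, 'e::euclidean_space) lie_group_data \<Rightarrow> nat \<Rightarrow> ('g \<Rightarrow> complex mat) \<Rightarrow> bool" where
  "irreducible_rep G d \<xi> \<longleftrightarrow> d > 0 \<and>
     (\<forall>W. VectorSpace.subspace class_ring W (module_vec TYPE(complex) d) \<longrightarrow>
        (\<forall>x\<in>carrier G. \<forall>w\<in>W. \<xi> x *\<^sub>v w \<in> W) \<longrightarrow> W = {0\<^sub>v d} \<or> W = carrier_vec d)"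

text \<open>
  Irreducible unitary representations of a compact group are finite-dimensional, hence given by
  unitary matrices up to equivalence. A field on the dual assigns a matrix \<open>\<sigma>(\<xi>)\<close> to
  each representative \<open>\<xi>\<close> of each class \<open>[\<xi>]\<close>. No representatives are singled out; replacing \<open>\<xi>\<close> by
  \<open>U \<xi> U*\<close> replaces a Fourier coefficient by its conjugate with \<open>U\<close>.
\<close>

definition irreps :: "('g, 'e::euclidean_space) lie_group_data \<Rightarrow> ('g \<Rightarrow> complex mat) set" where
  "irreps G = {\<xi>. \<exists>d. unitary_rep G d \<xi> \<and> irreducible_rep G d \<xi>}"

definition rep_dim ::
    "('g, 'e::euclidean_space) lie_group_data \<Rightarrow> ('g \<Rightarrow> complex mat) \<Rightarrow> nat" where
  "rep_dim G \<xi> = dim_row (\<xi> \<one>\<^bsub>G\<^esub>)"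

type_synonym 'g dual_field = "('g \<Rightarrow> complex mat) \<Rightarrow> complex mat"

definition fourier_fun ::
    "('g, 'e::euclidean_space) lie_group_data \<Rightarrow> ('g \<Rightarrow> complex) \<Rightarrow> 'g dual_field" where
  "fourier_fun G f = (\<lambda>\<xi>\<in>irreps G. Matrix.mat (rep_dim G \<xi>) (rep_dim G \<xi>)
     (\<lambda>(i, j). LINT x|haar G. f x * mat_adjoint (\<xi> x) $$ (i, j)))"

definition fourier ::
    "('g, 'e::euclidean_space) lie_group_data \<Rightarrow> (('g \<Rightarrow> complex) \<Rightarrow> complex) \<Rightarrow> 'g dual_field" where
  "fourier G u = (\<lambda>\<xi>\<in>irreps G. Matrix.mat (rep_dim G \<xi>) (rep_dim G \<xi>)
     (\<lambda>(i, j). u (\<lambda>x. mat_adjoint (\<xi> x) $$ (i, j))))"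

lemma fourier_regular_dist: "fourier G (regular_dist G f) = fourier_fun G f"
  by (simp add: fourier_def fourier_fun_def regular_dist_def)

lemma dist_mult_regular_dist:
  "dist_mult q (regular_dist G f) = regular_dist G (\<lambda>x. q x * f x)"
  by (simp add: dist_mult_def regular_dist_def mult_ac)


section \<open>Difference operators\<close>

text \<open>Difference operators act on the fields that are Fourier transforms of distributions.\<close>

definition fourier_fields :: "('g, 'e::euclidean_space) lie_group_data \<Rightarrow> 'g dual_field set" where
  "fourier_fields G = fourier G ` distributions G"

definition represents ::
    "('g, 'e::euclidean_space) lie_group_data \<Rightarrow> ('g \<Rightarrow> complex) \<Rightarrow>
     ('g dual_field \<Rightarrow> 'g dual_field) \<Rightarrow> bool" where
  "represents G q Q \<longleftrightarrow> (\<forall>u\<in>distributions G. Q (fourier G u) = fourier G (dist_mult q u))"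

definition diff_ops ::
    "('g, 'e::euclidean_space) lie_group_data \<Rightarrow> nat \<Rightarrow> ('g dual_field \<Rightarrow> 'g dual_field) set" where
  "diff_ops G k = {Q. \<exists>q\<in>smooth_funs G. vanishes_of_order G k q \<and> represents G q Q}"

text \<open>
  The differential at the unit, a real-linear map from the tangent space to the complex numbers.
  The tangent space is identified with the model space through a chart at the unit; the function
  is extended by zero outside the model space.
\<close>

definition unit_chart :: "('g, 'e::euclidean_space) lie_group_data \<Rightarrow> ('g, 'e) chart" where
  "unit_chart G = (SOME c. c \<in> atlas G \<and> \<one>\<^bsub>G\<^esub> \<in> chart_dom c)"

definition differential_unit ::
    "('g, 'e::euclidean_space) lie_group_data \<Rightarrow> ('g \<Rightarrow> complex) \<Rightarrow> 'e \<Rightarrow> complex" where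
  "differential_unit G q = (\<lambda>v. if v \<in> model G
     then dir_deriv (model G) v (q \<circ> chart_inv (unit_chart G)) (chart_map (unit_chart G) \<one>\<^bsub>G\<^esub>)
     else 0)"

text \<open>The library constant takes the dimension of the span of the set.\<close>

definition complex_rank :: "('e \<Rightarrow> complex) set \<Rightarrow> nat" where
  "complex_rank F = vector_space.dim (\<lambda>(a::complex) f v. a * f v) F"

definition strongly_admissible ::
    "('g, 'e::euclidean_space) lie_group_data \<Rightarrow> nat \<Rightarrow>
     (nat \<Rightarrow> 'g dual_field \<Rightarrow> 'g dual_field) \<Rightarrow> bool" where
  "strongly_admissible G n \<Delta> \<longleftrightarrow> (\<exists>q.
     (\<forall>j<n. q j \<in> smooth_funs G \<and> vanishes_of_order G 1 (q j) \<and> represents G (q j) (\<Delta> j)) \<and>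
     (\<forall>j<n. differential_unit G (q j) \<noteq> (\<lambda>v. 0)) \<and>
     complex_rank ((\<lambda>j. differential_unit G (q j)) ` {..<n}) = n \<and>
     {x \<in> carrier G. \<forall>j<n. q j x = 0} = {\<one>\<^bsub>G\<^esub>})"

definition multi_indices :: "nat \<Rightarrow> (nat \<Rightarrow> nat) set" where
  "multi_indices n = {\<alpha>. \<forall>j\<ge>n. \<alpha> j = 0}"

definition diff_power ::
    "nat \<Rightarrow> (nat \<Rightarrow> 'g dual_field \<Rightarrow> 'g dual_field) \<Rightarrow> (nat \<Rightarrow> nat) \<Rightarrow> 'g dual_field \<Rightarrow> 'g dual_field" where
  "diff_power n \<Delta> \<alpha> = foldr (\<lambda>j S. (\<Delta> j ^^ \<alpha> j) \<circ> S) [0..<n] id"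

text \<open>Entrywise, because matrices of unspecified size form no additive monoid type.\<close>

definition field_add ::
    "('g, 'e::euclidean_space) lie_group_data \<Rightarrow> 'g dual_field \<Rightarrow> 'g dual_field \<Rightarrow> 'g dual_field" where
  "field_add G \<sigma> \<tau> = (\<lambda>\<xi>\<in>irreps G. \<sigma> \<xi> + \<tau> \<xi>)"

definition field_lincomb ::
    "('g, 'e::euclidean_space) lie_group_data \<Rightarrow> 'i set \<Rightarrow> ('i \<Rightarrow> complex) \<Rightarrow>
     ('i \<Rightarrow> 'g dual_field) \<Rightarrow> 'g dual_field" where
  "field_lincomb G I c \<sigma> = (\<lambda>\<xi>\<in>irreps G. Matrix.mat (rep_dim G \<xi>) (rep_dim G \<xi>)
     (\<lambda>ij. \<Sum>i\<in>I. c i * \<sigma> i \<xi> $$ ij))"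

end

theory Submission
  imports Defs
begin

text \<open>
  If \<open>q\<close> represents \<open>Q\<close>, it suffices to find constants such that \<open>q - \<Sum> c\<^sub>\<alpha> q\<^sup>\<alpha>\<close> vanishes to order \<open>N\<close>
  at the unit. In a chart \<open>\<kappa>\<close> at the unit, \<open>f \<mapsto> \<partial>\<^sub>v\<^sub>1 \<dots> \<partial>\<^sub>v\<^sub>m (f (x \<kappa>\<^sup>-\<^sup>1(t)))\<close> at the coordinate of the unit
  is a left-invariant differential operator of order \<open>m\<close>, so vanishing to order \<open>k\<close> means that all
  derivatives of order below \<open>k\<close> in the chart vanish. If \<open>f\<close> vanishes to order \<open>k\<close>, Euler's identity
  \<open>k f = \<Sum> x\<^sub>b \<partial>\<^sub>b f\<close> holds modulo functions vanishing to order \<open>k + 1\<close>; as the differentials of the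
  \<open>q\<^sub>j\<close> span, every \<open>x\<^sub>b\<close> is a linear combination of the \<open>q\<^sub>j\<close> modulo order 2, and induction on \<open>k\<close>
  yields the Taylor coefficients \<open>c\<^sub>\<alpha>\<close>.

  Passing from functions to operators on Fourier coefficients uses that a distribution is additive on
  the products \<open>q \<xi>\<^sub>i\<^sub>j\<close>, hence that matrix coefficients are smooth: \<open>\<xi>(x) A = \<integral> \<phi>(y\<^sup>-\<^sup>1 x) \<xi>(y) dy\<close> with
  \<open>A = \<integral> \<phi>(y\<^sup>-\<^sup>1) \<xi>(y) dy\<close>, and \<open>A\<close> is invertible for \<open>\<phi> = (1 - \<Sum> \<bar>q\<^sub>j\<bar>\<^sup>2 / M)\<^sup>k\<close> with \<open>k\<close> large, because the
  \<open>q\<^sub>j\<close> vanish simultaneously only at the unit.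
\<close>

section \<open>Calculus relative to a linear subspace\<close>

text \<open>A distribution is linear only on smooth functions, while representations are given as
  continuous. An identity between multipliers therefore yields one between Fourier coefficients only
  after the matrix entries are known to be smooth. The convolution argument gets this from the data
  at hand: the common zero set of the \<open>q j\<close> provides the peak function. The weighted
  average of \<xi> is invertible because the normalised weight concentrates at the unit, where \<xi>
  is the identity matrix. The model space E is a subspace, possibly {0}, and derivatives within E
  are determined only in directions of E. So the chain rule and the symmetry of mixed derivatives
  are established relative to E, in orthonormal coordinates. Euler's identity replaces a Taylor
  formula with remainder: it concerns jets at one point only, and the factorials arise one factor
  per degree. The remainder operator is defined as \<open>Q\<close> minus the finite sum. The
  decomposition is then immediate, and the content lies in showing that a smooth function vanishing
  to order N represents this difference.\<close>

lemma openin_subspace_ball: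
  fixes E W :: "'a::real_normed_vector set"
  assumes "openin (top_of_set E) W" "x \<in> W"
  obtains r where "r > 0" "\<And>y. y \<in> E \<Longrightarrow> dist y x < r \<Longrightarrow> y \<in> W"
  using assms unfolding openin_euclidean_subtopology_iff by blast

lemma has_derivative_dir_deriv:
  assumes "f differentiable (at x within E)"
  shows "(f has_derivative (\<lambda>v. dir_deriv E v f x)) (at x within E)"
  using assms unfolding dir_deriv_def frechet_derivative_works by simp

lemma line_has_vector_derivative:
  assumes E: "Real_Vector_Spaces.subspace E" and x: "x \<in> E" and v: "v \<in> E"
    and f: "(f has_derivative f') (at (x + a *\<^sub>R v) within E)"
  shows "((\<lambda>a. f (x + a *\<^sub>R v)) has_vector_derivative f' v) (at a within S)"
proof -
  have "((\<lambda>a. x + a *\<^sub>R v) has_derivative (\<lambda>a. a *\<^sub>R v)) (at a within S)"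
    by (auto intro!: derivative_eq_intros)
  moreover have "(\<lambda>a. x + a *\<^sub>R v) ` S \<subseteq> E"
    using E x v by (auto intro!: Real_Vector_Spaces.subspace_add Real_Vector_Spaces.subspace_scale)
  ultimately have "((\<lambda>a. f (x + a *\<^sub>R v)) has_derivative (\<lambda>a. f' (a *\<^sub>R v))) (at a within S)"
    using f has_derivative_in_compose[of "\<lambda>a. x + a *\<^sub>R v" _ a S f f'] has_derivative_subset
    by blast
  then show ?thesis
    unfolding has_vector_derivative_def
    using linear_scale[OF has_derivative_linear[OF f]] by simp
qed

text \<open>\<open>frechet_derivative\<close> picks some derivative within E, and such derivatives
  are unique only along E. On the line through x in a direction of E the question concerns a
  function of one real variable, whose derivative is unique; so in such a direction the chosen
  derivative agrees with any other.\<close>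

lemma dir_deriv_eq:
  assumes E: "Real_Vector_Spaces.subspace E" and x: "x \<in> E" and v: "v \<in> E"
    and f: "(f has_derivative f') (at x within E)"
  shows "dir_deriv E v f x = f' v"
proof -
  have "(f has_derivative (\<lambda>v. dir_deriv E v f x)) (at x within E)"
    using f by (intro has_derivative_dir_deriv) (auto simp: differentiable_def)
  from line_has_vector_derivative[OF E x v, of f _ 0 UNIV] this f
  have "((\<lambda>a. f (x + a *\<^sub>R v)) has_vector_derivative dir_deriv E v f x) (at 0)"
    "((\<lambda>a. f (x + a *\<^sub>R v)) has_vector_derivative f' v) (at 0)" by auto
  then show ?thesis by (rule vector_derivative_unique_at)
qed

lemma has_derivative_local_cong:
  assumes W: "openin (top_of_set E) W" "x \<in> W" and eq: "\<And>y. y \<in> W \<Longrightarrow> f y = g y"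
    and f: "(f has_derivative f') (at x within E)"
  shows "(g has_derivative f') (at x within E)"
proof -
  obtain r where r: "r > 0" "\<And>y. y \<in> E \<Longrightarrow> dist y x < r \<Longrightarrow> y \<in> W"
    using openin_subspace_ball[OF W] by metis
  show ?thesis
    using has_derivative_transform_within[OF f r(1)] r(2) eq W openin_subset[OF W(1)] by auto
qed

text \<open>Functions that agree near x have the same set of derivatives at x, so the choice
  operator picks the same one for both.\<close>

lemma dir_deriv_local_cong:
  assumes W: "openin (top_of_set E) W" "x \<in> W" and eq: "\<And>y. y \<in> W \<Longrightarrow> f y = g y"
  shows "dir_deriv E v f x = dir_deriv E v g x"
proof -
  have "(f has_derivative f') (at x within E) \<longleftrightarrow> (g has_derivative f') (at x within E)" for f'
    using has_derivative_local_cong[OF W] eq by metis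
  then show ?thesis unfolding dir_deriv_def frechet_derivative_def by simp
qed

lemma dir_derivs_local_cong:
  assumes W: "openin (top_of_set E) W" and eq: "\<And>y. y \<in> W \<Longrightarrow> f y = g y" and "x \<in> W"
  shows "dir_derivs E vs f x = dir_derivs E vs g x"
  using \<open>x \<in> W\<close>
proof (induction vs arbitrary: x)
  case Nil
  then show ?case using eq by simp
next
  case (Cons v vs)
  then show ?case using dir_deriv_local_cong[OF W, of x "dir_derivs E vs f" "dir_derivs E vs g"] by simp
qed

lemma dir_derivs_append: "dir_derivs E (vs @ ws) f = dir_derivs E vs (dir_derivs E ws f)"
  by (induction vs) auto

lemma Ck_on_cong:
  assumes W: "openin (top_of_set E) W" and eq: "\<And>y. y \<in> W \<Longrightarrow> f y = g y" and f: "Ck_on k E W f"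
  shows "Ck_on k E W g"
  using eq f
proof (induction k arbitrary: f g)
  case 0
  then show ?case using continuous_on_cong[of W W f g] by simp
next
  case (Suc k)
  have "g differentiable (at x within E)" if x: "x \<in> W" for x
  proof -
    have "f differentiable (at x within E)" using Suc.prems(2) x by simp
    then show ?thesis
      using has_derivative_local_cong[where f=f and g=g, OF W x Suc.prems(1)] unfolding differentiable_def by metis
  qed
  moreover have "Ck_on k E W (dir_deriv E v g)" if "v \<in> E" for v
    by (rule Suc.IH[OF dir_deriv_local_cong[where f=f and g=g, OF W _ Suc.prems(1)]]) (use Suc.prems(2) that in auto)
  ultimately show ?case by simp
qed

lemma differentiable_imp_continuous_on_subset:
  assumes "W \<subseteq> E" "\<And>x. x \<in> W \<Longrightarrow> f differentiable (at x within E)"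
  shows "continuous_on W f"
  unfolding continuous_on_eq_continuous_within
  using assms differentiable_imp_continuous_within continuous_within_subset by metis

lemma Ck_on_Suc_imp:
  assumes "W \<subseteq> E" "Ck_on (Suc k) E W f"
  shows "Ck_on k E W f"
  using assms(2)
proof (induction k arbitrary: f)
  case 0
  then show ?case using differentiable_imp_continuous_on_subset[OF assms(1), of f] by simp
next
  case (Suc k)
  have d: "\<forall>x\<in>W. f differentiable at x within E"
    "\<And>v. v \<in> E \<Longrightarrow> Ck_on (Suc k) E W (dir_deriv E v f)"
    using Suc.prems by (auto simp only: Ck_on.simps)
  show ?case using d(1) Suc.IH[OF d(2)] by simp
qed

lemma smooth_on_cong:
  assumes "openin (top_of_set E) W" "\<And>y. y \<in> W \<Longrightarrow> f y = g y" "smooth_on E W f"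
  shows "smooth_on E W g"
  using Ck_on_cong[OF assms(1), of f g] assms(2,3) unfolding smooth_on_def by blast

lemma smooth_on_differentiable: "smooth_on E W f \<Longrightarrow> x \<in> W \<Longrightarrow> f differentiable (at x within E)"
  unfolding smooth_on_def by (drule spec[of _ "Suc 0"]) simp

lemma smooth_on_has_derivative:
  "smooth_on E W f \<Longrightarrow> x \<in> W \<Longrightarrow> (f has_derivative (\<lambda>v. dir_deriv E v f x)) (at x within E)"
  by (intro has_derivative_dir_deriv smooth_on_differentiable)

lemma smooth_on_dir_deriv: "smooth_on E W f \<Longrightarrow> v \<in> E \<Longrightarrow> smooth_on E W (dir_deriv E v f)"
  unfolding smooth_on_def
proof
  fix k assume "\<forall>k. Ck_on k E W f" "v \<in> E"
  then have "Ck_on (Suc k) E W f" by blast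
  then show "Ck_on k E W (dir_deriv E v f)" using \<open>v \<in> E\<close> by simp
qed

lemma smooth_on_dir_derivs:
  "smooth_on E W f \<Longrightarrow> set vs \<subseteq> E \<Longrightarrow> smooth_on E W (dir_derivs E vs f)"
  by (induction vs) (auto intro: smooth_on_dir_deriv)

lemma smooth_on_continuous_on: "smooth_on E W f \<Longrightarrow> continuous_on W f"
  unfolding smooth_on_def by (drule spec[of _ 0]) simp

text \<open>Smoothness as a greatest fixed point: a class of differentiable functions that is
  closed, up to equality on W, under directional derivatives consists of smooth functions. This fits
  functions whose derivatives are again of the same kind, such as parameter integrals.\<close>

lemma smooth_on_coinduct:
  assumes W: "openin (top_of_set E) W" and "S f"
    and diff: "\<And>f x. S f \<Longrightarrow> x \<in> W \<Longrightarrow> f differentiable (at x within E)"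
    and step: "\<And>f v. S f \<Longrightarrow> v \<in> E \<Longrightarrow> \<exists>g. S g \<and> (\<forall>x\<in>W. dir_deriv E v f x = g x)"
  shows "smooth_on E W f"
proof -
  have WE: "W \<subseteq> E" using openin_subset[OF W] by simp
  have "Ck_on k E W f" if "S f" for k f
    using that
  proof (induction k arbitrary: f)
    case 0
    then show ?case using differentiable_imp_continuous_on_subset[OF WE, of f] diff by simp
  next
    case (Suc k)
    have "Ck_on k E W (dir_deriv E v f)" if v: "v \<in> E" for v
    proof -
      obtain g where g: "S g" "\<forall>x\<in>W. dir_deriv E v f x = g x" using step[OF Suc.prems v] by blast
      show ?thesis by (rule Ck_on_cong[OF W _ Suc.IH[OF g(1)]]) (use g in auto)
    qed
    then show ?case using diff Suc.prems by simp
  qed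
  then show ?thesis using \<open>S f\<close> unfolding smooth_on_def by blast
qed

section \<open>Algebra of smooth functions on a relatively open set, and symmetry of mixed
  derivatives\<close>

context
  fixes E W :: "'a::real_normed_vector set"
  assumes E: "Real_Vector_Spaces.subspace E" and W: "openin (top_of_set E) W"
begin

lemma openin_model_subset: "W \<subseteq> E"
  using openin_subset[OF W] by simp

lemma Ck_on_const: "Ck_on k E W (\<lambda>_. c)"
proof (induction k arbitrary: c)
  case (Suc k)
  have "Ck_on k E W (dir_deriv E v (\<lambda>_. c))" if "v \<in> E" for v
    by (rule Ck_on_cong[OF W _ Suc[of 0]])
      (rule dir_deriv_eq[OF E subsetD[OF openin_model_subset] that has_derivative_const, symmetric])
  then show ?case by simp
qed simp

lemma Ck_on_add:
  "Ck_on k E W f \<Longrightarrow> Ck_on k E W g \<Longrightarrow> Ck_on k E W (\<lambda>x. f x + g x)"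
proof (induction k arbitrary: f g)
  case 0
  then show ?case by (simp add: continuous_on_add)
next
  case (Suc k)
  have "Ck_on k E W (dir_deriv E v (\<lambda>x. f x + g x))" if "v \<in> E" for v
  proof (rule Ck_on_cong[OF W])
    show "Ck_on k E W (\<lambda>x. dir_deriv E v f x + dir_deriv E v g x)"
      using Suc that by simp
    show "dir_deriv E v f x + dir_deriv E v g x = dir_deriv E v (\<lambda>x. f x + g x) x" if x: "x \<in> W" for x
      using Suc.prems x openin_model_subset \<open>v \<in> E\<close>
        dir_deriv_eq[OF E _ _ has_derivative_add[OF has_derivative_dir_deriv[of f x E]
            has_derivative_dir_deriv[of g x E]]] by auto
  qed
  then show ?case using Suc.prems by (simp add: differentiable_add)
qed

lemma Ck_on_sum:
  "(\<And>i. i \<in> I \<Longrightarrow> Ck_on k E W (f i)) \<Longrightarrow> Ck_on k E W (\<lambda>x. \<Sum>i\<in>I. f i x)"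
  by (induction I rule: infinite_finite_induct) (auto intro: Ck_on_const Ck_on_add)

lemma Ck_on_bilinear:
  assumes P: "bounded_bilinear P"
  shows "Ck_on k E W f \<Longrightarrow> Ck_on k E W g \<Longrightarrow> Ck_on k E W (\<lambda>x. P (f x) (g x))"
proof (induction k arbitrary: f g)
  case 0
  then show ?case by (simp add: bounded_bilinear.continuous_on[OF P])
next
  case (Suc k)
  have D: "((\<lambda>x. P (f x) (g x)) has_derivative
      (\<lambda>v. P (f x) (dir_deriv E v g x) + P (dir_deriv E v f x) (g x))) (at x within E)"
    if "x \<in> W" for x
    using that Suc.prems by (intro bounded_bilinear.FDERIV[OF P] has_derivative_dir_deriv) auto
  have "Ck_on k E W (dir_deriv E v (\<lambda>x. P (f x) (g x)))" if "v \<in> E" for v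
  proof (rule Ck_on_cong[OF W])
    \<comment> \<open>Each term of the Leibniz rule pairs a derivative of class k with an
      undifferentiated factor of class k + 1, which is first lowered to class k.\<close>
    show "Ck_on k E W (\<lambda>x. P (f x) (dir_deriv E v g x) + P (dir_deriv E v f x) (g x))"
      using Suc.prems that Ck_on_Suc_imp[OF openin_model_subset Suc.prems(1)]
        Ck_on_Suc_imp[OF openin_model_subset Suc.prems(2)]
      by (intro Ck_on_add Suc.IH) auto
    show "P (f x) (dir_deriv E v g x) + P (dir_deriv E v f x) (g x) =
        dir_deriv E v (\<lambda>x. P (f x) (g x)) x" if x: "x \<in> W" for x
      using dir_deriv_eq[OF E _ \<open>v \<in> E\<close> D[OF x]] x openin_model_subset by auto
  qed
  then show ?case using D by (auto simp: differentiable_def)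
qed

lemma Ck_on_linear:
  assumes L: "bounded_linear L" and f: "Ck_on k E W f"
  shows "Ck_on k E W (\<lambda>x. L (f x))"
  using f
proof (induction k arbitrary: f)
  case 0
  then show ?case using linear_continuous_on_compose L by (simp add: bounded_linear.continuous_on)
next
  case (Suc k)
  have D: "((\<lambda>x. L (f x)) has_derivative (\<lambda>v. L (dir_deriv E v f x))) (at x within E)"
    if "x \<in> W" for x
    using that Suc.prems by (intro bounded_linear.has_derivative[OF L] has_derivative_dir_deriv) auto
  have "Ck_on k E W (dir_deriv E v (\<lambda>x. L (f x)))" if "v \<in> E" for v
  proof (rule Ck_on_cong[OF W])
    show "Ck_on k E W (\<lambda>x. L (dir_deriv E v f x))" using Suc that by simp
    show "L (dir_deriv E v f x) = dir_deriv E v (\<lambda>x. L (f x)) x" if "x \<in> W" for x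
      using dir_deriv_eq[OF E _ \<open>v \<in> E\<close> D[OF that]] openin_model_subset that by auto
  qed
  then show ?case using D by (auto simp: differentiable_def)
qed

lemma Ck_on_ident: "Ck_on k E W (\<lambda>x. x)"
proof (cases k)
  case (Suc m)
  have "Ck_on m E W (dir_deriv E v (\<lambda>x. x))" if "v \<in> E" for v
    by (rule Ck_on_cong[OF W _ Ck_on_const[of _ v]])
      (rule dir_deriv_eq[OF E subsetD[OF openin_model_subset] that has_derivative_ident, symmetric])
  then show ?thesis using Suc by simp
qed (simp add: continuous_on_id)

lemma smooth_on_const: "smooth_on E W (\<lambda>_. c)"
  by (simp add: smooth_on_def Ck_on_const)

lemma smooth_on_ident: "smooth_on E W (\<lambda>x. x)"
  by (simp add: smooth_on_def Ck_on_ident)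

lemma smooth_on_add:
  "smooth_on E W f \<Longrightarrow> smooth_on E W g \<Longrightarrow> smooth_on E W (\<lambda>x. f x + g x)"
  by (simp add: smooth_on_def Ck_on_add)

lemma smooth_on_sum:
  "(\<And>i. i \<in> I \<Longrightarrow> smooth_on E W (f i)) \<Longrightarrow> smooth_on E W (\<lambda>x. \<Sum>i\<in>I. f i x)"
  by (simp add: smooth_on_def Ck_on_sum[of I _ f])

lemma smooth_on_linear:
  "bounded_linear L \<Longrightarrow> smooth_on E W f \<Longrightarrow> smooth_on E W (\<lambda>x. L (f x))"
  by (simp add: smooth_on_def Ck_on_linear[of L _ f])

lemma smooth_on_mult:
  fixes f g :: "'a \<Rightarrow> 'b::real_normed_algebra"
  shows "smooth_on E W f \<Longrightarrow> smooth_on E W g \<Longrightarrow> smooth_on E W (\<lambda>x. f x * g x)"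
  by (simp add: smooth_on_def Ck_on_bilinear[OF bounded_bilinear_mult, of _ f g])

lemma smooth_on_cmult: "smooth_on E W f \<Longrightarrow> smooth_on E W (\<lambda>x. c * f x)"
  for f :: "'a \<Rightarrow> 'b::real_normed_algebra"
  by (rule smooth_on_mult[OF smooth_on_const])

lemma smooth_on_diff:
  "smooth_on E W f \<Longrightarrow> smooth_on E W g \<Longrightarrow> smooth_on E W (\<lambda>x. f x - g x)"
  for f g :: "'a \<Rightarrow> 'b::real_normed_algebra_1"
  using smooth_on_add[OF _ smooth_on_cmult[of g "-1"], of f] by simp

lemma smooth_on_power: "smooth_on E W f \<Longrightarrow> smooth_on E W (\<lambda>x. f x ^ k)"
  for f :: "'a \<Rightarrow> 'b::real_normed_algebra_1"
  by (induction k) (auto intro: smooth_on_const smooth_on_mult)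

lemma dir_deriv_const: "x \<in> W \<Longrightarrow> v \<in> E \<Longrightarrow> dir_deriv E v (\<lambda>_. c) x = 0"
  by (rule dir_deriv_eq[OF E subsetD[OF openin_model_subset] _ has_derivative_const])

lemma dir_deriv_add:
  assumes "smooth_on E W f" "smooth_on E W g" "x \<in> W" "v \<in> E"
  shows "dir_deriv E v (\<lambda>x. f x + g x) x = dir_deriv E v f x + dir_deriv E v g x"
  by (rule dir_deriv_eq[OF E subsetD[OF openin_model_subset assms(3)] assms(4)
        has_derivative_add[OF smooth_on_has_derivative[OF assms(1,3)] smooth_on_has_derivative[OF assms(2,3)]]])

lemma dir_deriv_sum:
  assumes "\<And>i. i \<in> I \<Longrightarrow> smooth_on E W (f i)" "x \<in> W" "v \<in> E"
  shows "dir_deriv E v (\<lambda>x. \<Sum>i\<in>I. f i x) x = (\<Sum>i\<in>I. dir_deriv E v (f i) x)"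
  by (rule dir_deriv_eq[OF E subsetD[OF openin_model_subset assms(2)] assms(3)
        has_derivative_sum[OF smooth_on_has_derivative[OF assms(1,2)]]])

lemma dir_deriv_mult:
  fixes f g :: "'a \<Rightarrow> 'b::real_normed_algebra"
  assumes "smooth_on E W f" "smooth_on E W g" "x \<in> W" "v \<in> E"
  shows "dir_deriv E v (\<lambda>x. f x * g x) x = f x * dir_deriv E v g x + dir_deriv E v f x * g x"
  by (rule dir_deriv_eq[OF E subsetD[OF openin_model_subset assms(3)] assms(4)
        has_derivative_mult[OF smooth_on_has_derivative[OF assms(1,3)] smooth_on_has_derivative[OF assms(2,3)]]])

lemma dir_deriv_linear:
  assumes "bounded_linear L" "smooth_on E W f" "x \<in> W" "v \<in> E"
  shows "dir_deriv E v (\<lambda>x. L (f x)) x = L (dir_deriv E v f x)"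
  by (rule dir_deriv_eq[OF E subsetD[OF openin_model_subset assms(3)] assms(4)
        bounded_linear.has_derivative[OF assms(1) smooth_on_has_derivative[OF assms(2,3)]]])

lemma at_within_openin_eq: "x \<in> W \<Longrightarrow> at x within W = at x within E"
proof -
  assume x: "x \<in> W"
  obtain T where "open T" "W = E \<inter> T" using W by (auto simp: openin_open)
  then show ?thesis using x by (intro at_within_nhd[of x T]) auto
qed

text \<open>As g is differentiated within F, f has to be differentiated along a set that it maps
  into F. W is such a set, and derivatives within W and within E coincide because W is relatively
  open.\<close>

lemma has_derivative_compose_on:
  assumes f: "smooth_on E W f" and fW: "f ` W \<subseteq> F" and x: "x \<in> W"
    and g: "(g has_derivative g') (at (f x) within F)"
  shows "((\<lambda>x. g (f x)) has_derivative (\<lambda>v. g' (dir_deriv E v f x))) (at x within E)"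
proof -
  have "(f has_derivative (\<lambda>v. dir_deriv E v f x)) (at x within W)"
    using smooth_on_has_derivative[OF f x] by (simp add: at_within_openin_eq[OF x])
  from has_derivative_in_compose[OF this has_derivative_subset[OF g fW]]
  show ?thesis by (simp add: at_within_openin_eq[OF x])
qed

text \<open>The mean value inequality for the first difference controls the second difference.\<close>

lemma second_difference_bound:
  assumes f: "\<And>y. y \<in> W \<Longrightarrow> f differentiable (at y within E)"
    and f2: "dir_deriv E v f differentiable (at x within E)"
    and x: "x \<in> W" and v: "v \<in> E" and w: "w \<in> E" and \<epsilon>: "\<epsilon> > 0"
  shows "\<forall>\<^sub>F t in at_right 0. norm (f (x + t *\<^sub>R v + t *\<^sub>R w) - f (x + t *\<^sub>R v) - f (x + t *\<^sub>R w) + f x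
            - t\<^sup>2 *\<^sub>R dir_deriv E w (dir_deriv E v f) x) \<le> \<epsilon> * t\<^sup>2"
proof -
  define \<phi> where "\<phi> = dir_deriv E v f"
  define D where "D = (\<lambda>u. dir_deriv E u \<phi> x)"
  have xE: "x \<in> E" using x openin_model_subset by blast
  have hd: "(\<phi> has_derivative D) (at x within E)"
    unfolding D_def \<phi>_def using f2 by (rule has_derivative_dir_deriv)
  then interpret D: bounded_linear D by (rule has_derivative_bounded_linear)
  define M where "M = norm v + norm w + 1"
  have M: "M > 0" unfolding M_def by (simp add: add_nonneg_pos)
  \<comment> \<open>Two linearization errors of size e * (t * M) are added below and must give
    \<epsilon> * t.\<close>
  define e where "e = \<epsilon> / (2 * M)"
  have e: "e > 0" unfolding e_def using \<epsilon> M by simp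
  obtain d where d: "d > 0" "\<And>y. y \<in> E \<Longrightarrow> norm (y - x) < d \<Longrightarrow>
      norm (\<phi> y - \<phi> x - D (y - x)) \<le> e * norm (y - x)"
    using hd e unfolding has_derivative_within_alt by blast
  obtain r where r: "r > 0" "\<And>y. y \<in> E \<Longrightarrow> dist y x < r \<Longrightarrow> y \<in> W"
    using openin_subspace_ball[OF W x] by metis
  define T where "T = min d r / M"
  have T: "T > 0" unfolding T_def using d(1) r(1) M by simp
  have main: "norm (f (x + t *\<^sub>R v + t *\<^sub>R w) - f (x + t *\<^sub>R v) - f (x + t *\<^sub>R w) + f x
            - t\<^sup>2 *\<^sub>R D w) \<le> \<epsilon> * t\<^sup>2" if t: "0 < t" "t < T" for t
  proof -
    have tM: "t * M < d" "t * M < r" using t M unfolding T_def by (auto simp: field_simps)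
    have near: "norm (a *\<^sub>R v + b *\<^sub>R w) \<le> t * M" if "0 \<le> a" "a \<le> t" "0 \<le> b" "b \<le> t" for a b
    proof -
      have "norm (a *\<^sub>R v + b *\<^sub>R w) \<le> a * norm v + b * norm w"
        using norm_triangle_ineq[of "a *\<^sub>R v" "b *\<^sub>R w"] that by simp
      also have "\<dots> \<le> t * norm v + t * norm w" using that by (intro add_mono mult_right_mono) auto
      also have "\<dots> \<le> t * M" using t unfolding M_def by (simp add: algebra_simps)
      finally show ?thesis .
    qed
    have inE: "x + a *\<^sub>R v + b *\<^sub>R w \<in> E" for a b
      using E xE v w by (intro Real_Vector_Spaces.subspace_add Real_Vector_Spaces.subspace_scale) auto
    have inW: "x + a *\<^sub>R v + b *\<^sub>R w \<in> W" if "0 \<le> a" "a \<le> t" "0 \<le> b" "b \<le> t" for a b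
      using near[OF that] tM inE[of a b] by (intro r(2)) (auto simp: dist_norm add.assoc)
    have appr: "norm (\<phi> (x + a *\<^sub>R v + b *\<^sub>R w) - \<phi> x - D (a *\<^sub>R v + b *\<^sub>R w)) \<le> e * (t * M)"
      if "0 \<le> a" "a \<le> t" "0 \<le> b" "b \<le> t" for a b
    proof -
      have "norm (\<phi> (x + a *\<^sub>R v + b *\<^sub>R w) - \<phi> x - D (a *\<^sub>R v + b *\<^sub>R w)) \<le> e * norm (a *\<^sub>R v + b *\<^sub>R w)"
        using d(2)[OF inE[of a b]] near[OF that] tM by (simp add: add.assoc)
      also have "\<dots> \<le> e * (t * M)" using near[OF that] e by (intro mult_left_mono) auto
      finally show ?thesis .
    qed
    \<comment> \<open>The first difference in direction w, moved along v, minus its expected linear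
      growth. Its increment from 0 to t is the second difference minus t^2 D w.\<close>
    define g where "g a = f (x + a *\<^sub>R v + t *\<^sub>R w) - f (x + a *\<^sub>R v) - a *\<^sub>R (t *\<^sub>R D w)" for a
    have gd: "(g has_vector_derivative \<phi> (x + a *\<^sub>R v + t *\<^sub>R w) - \<phi> (x + a *\<^sub>R v) - t *\<^sub>R D w)
        (at a within {0..t})" if a: "a \<in> {0..t}" for a
    proof -
      have "((\<lambda>a. f ((x + t *\<^sub>R w) + a *\<^sub>R v)) has_vector_derivative \<phi> ((x + t *\<^sub>R w) + a *\<^sub>R v))
          (at a within {0..t})"
        using inE[of 0 t] inW[of a t] a t v f[of "x + a *\<^sub>R v + t *\<^sub>R w"] unfolding \<phi>_def
        by (intro line_has_vector_derivative[OF E, where f'="\<lambda>u. dir_deriv E u f ((x + t *\<^sub>R w) + a *\<^sub>R v)"]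
            has_derivative_dir_deriv) (auto simp: add.commute add.left_commute)
      moreover have "((\<lambda>a. f (x + a *\<^sub>R v)) has_vector_derivative \<phi> (x + a *\<^sub>R v))
          (at a within {0..t})"
        using inW[of a 0] a t v f[of "x + a *\<^sub>R v"] xE unfolding \<phi>_def
        by (intro line_has_vector_derivative[OF E, where f'="\<lambda>u. dir_deriv E u f (x + a *\<^sub>R v)"]
            has_derivative_dir_deriv) auto
      moreover have "((\<lambda>a. a *\<^sub>R (t *\<^sub>R D w)) has_vector_derivative t *\<^sub>R D w) (at a within {0..t})"
        by (auto intro!: derivative_eq_intros simp: has_vector_derivative_def)
      ultimately have "((\<lambda>a. f ((x + t *\<^sub>R w) + a *\<^sub>R v) - f (x + a *\<^sub>R v) - a *\<^sub>R (t *\<^sub>R D w))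
          has_vector_derivative \<phi> ((x + t *\<^sub>R w) + a *\<^sub>R v) - \<phi> (x + a *\<^sub>R v) - t *\<^sub>R D w)
          (at a within {0..t})"
        by (intro has_vector_derivative_diff)
      moreover have "x + t *\<^sub>R w + a *\<^sub>R v = x + a *\<^sub>R v + t *\<^sub>R w" for a by simp
      ultimately show ?thesis unfolding g_def by simp
    qed
    have "norm (g t - g 0) \<le> \<epsilon> * t * norm (t - 0)"
    proof (rule differentiable_bound[where S="{0..t}"
          and f'="\<lambda>a h. h *\<^sub>R (\<phi> (x + a *\<^sub>R v + t *\<^sub>R w) - \<phi> (x + a *\<^sub>R v) - t *\<^sub>R D w)"])
      fix a assume a: "a \<in> {0..t}"
      show "(g has_derivative (\<lambda>h. h *\<^sub>R (\<phi> (x + a *\<^sub>R v + t *\<^sub>R w) - \<phi> (x + a *\<^sub>R v) - t *\<^sub>R D w)))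
        (at a within {0..t})" using gd[OF a] unfolding has_vector_derivative_def .
      \<comment> \<open>Both values of \<phi> are compared with the linearization at x; the
        contributions of v cancel by linearity of D and t D w remains.\<close>
      have "norm (\<phi> (x + a *\<^sub>R v + t *\<^sub>R w) - \<phi> (x + a *\<^sub>R v) - t *\<^sub>R D w)
        = norm ((\<phi> (x + a *\<^sub>R v + t *\<^sub>R w) - \<phi> x - D (a *\<^sub>R v + t *\<^sub>R w))
            - (\<phi> (x + a *\<^sub>R v + 0 *\<^sub>R w) - \<phi> x - D (a *\<^sub>R v + 0 *\<^sub>R w)))"
        by (simp add: D.add D.scaleR) (simp add: algebra_simps)
      also have "\<dots> \<le> e * (t * M) + e * (t * M)"
        using a t by (intro norm_triangle_le_diff add_mono appr) auto
      also have "\<dots> = \<epsilon> * t" unfolding e_def using M by (simp add: field_simps)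
      finally show "onorm (\<lambda>h. h *\<^sub>R (\<phi> (x + a *\<^sub>R v + t *\<^sub>R w) - \<phi> (x + a *\<^sub>R v) - t *\<^sub>R D w)) \<le> \<epsilon> * t"
        by (intro onorm_le) (simp add: mult.commute mult_left_mono)
    qed (use t in auto)
    moreover have "g t - g 0 = f (x + t *\<^sub>R v + t *\<^sub>R w) - f (x + t *\<^sub>R v) - f (x + t *\<^sub>R w) + f x
            - t\<^sup>2 *\<^sub>R D w"
      unfolding g_def by (simp add: power2_eq_square)
    ultimately show ?thesis using t by (simp add: power2_eq_square mult.assoc)
  qed
  show ?thesis
    unfolding eventually_at_right_field using main T unfolding D_def \<phi>_def by blast
qed

text \<open>The second difference is symmetric in v and w, and each of the two mixed derivatives is
  its limit after division by t^2.\<close>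

lemma dir_deriv_commute:
  assumes f: "smooth_on E W f" and x: "x \<in> W" and v: "v \<in> E" and w: "w \<in> E"
  shows "dir_deriv E v (dir_deriv E w f) x = dir_deriv E w (dir_deriv E v f) x"
proof -
  define c where "c = dir_deriv E v (dir_deriv E w f) x"
  define d where "d = dir_deriv E w (dir_deriv E v f) x"
  have "norm (c - d) \<le> 2 * \<epsilon>" if \<epsilon>: "\<epsilon> > 0" for \<epsilon>
  proof -
    note bound = second_difference_bound[OF smooth_on_differentiable[OF f]
        smooth_on_differentiable[OF smooth_on_dir_deriv[OF f _] x] x _ _ \<epsilon>]
    \<comment> \<open>The bound is used twice, with v and w exchanged, for one and the same
      t.\<close>
    have "\<forall>\<^sub>F t::real in at_right 0. norm (c - d) \<le> 2 * \<epsilon>"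
      using bound[OF _ v v w, simplified] bound[OF _ w w v, simplified] eventually_at_right_less[of 0]
    proof eventually_elim
      case (elim t)
      define S where "S = f (x + t *\<^sub>R v + t *\<^sub>R w) - f (x + t *\<^sub>R v) - f (x + t *\<^sub>R w) + f x"
      have 1: "norm (S - t\<^sup>2 *\<^sub>R d) \<le> \<epsilon> * t\<^sup>2" using elim(1) unfolding S_def d_def .
      have 2: "norm (S - t\<^sup>2 *\<^sub>R c) \<le> \<epsilon> * t\<^sup>2"
        using elim(2) unfolding S_def c_def by (simp add: algebra_simps)
      have "t\<^sup>2 * norm (c - d) = norm ((S - t\<^sup>2 *\<^sub>R d) - (S - t\<^sup>2 *\<^sub>R c))"
        by (simp add: algebra_simps flip: scaleR_diff_right)
      also have "\<dots> \<le> \<epsilon> * t\<^sup>2 + \<epsilon> * t\<^sup>2" by (rule norm_triangle_le_diff[OF add_mono[OF 1 2]])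
      finally show ?case using elim(3) by (simp add: field_simps)
    qed
    then show ?thesis by (simp add: trivial_limit_at_right_real)
  qed
  from this[of "e / 2" for e] have "norm (c - d) \<le> 0 + e" if "e > 0" for e
    using that by simp
  then have "norm (c - d) \<le> 0" by (rule field_le_epsilon)
  then show ?thesis unfolding c_def d_def by simp
qed

end

text \<open>E may be a proper subspace, so coordinates on it come from a chosen orthonormal basis of
  E instead of \<open>Basis\<close>; it is empty when E is {0}.\<close>

definition orthobasis :: "'a::euclidean_space set \<Rightarrow> 'a set" where
  "orthobasis E = (SOME B. B \<subseteq> E \<and> pairwise Linear_Algebra.orthogonal B \<and> (\<forall>b\<in>B. norm b = 1) \<and>
     finite B \<and> card B = Real_Vector_Spaces.dim E \<and> Real_Vector_Spaces.span B = E)"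

lemma orthobasis:
  fixes E :: "'a::euclidean_space set"
  assumes "Real_Vector_Spaces.subspace E"
  shows "orthobasis E \<subseteq> E" "finite (orthobasis E)" "card (orthobasis E) = Real_Vector_Spaces.dim E"
    "\<And>x. x \<in> E \<Longrightarrow> (\<Sum>b\<in>orthobasis E. (x \<bullet> b) *\<^sub>R b) = x"
proof -
  obtain B where B: "B \<subseteq> E" "pairwise Linear_Algebra.orthogonal B" "\<And>x. x \<in> B \<Longrightarrow> norm x = 1"
    "Real_Vector_Spaces.independent B" "card B = Real_Vector_Spaces.dim E" "Real_Vector_Spaces.span B = E"
    using orthonormal_basis_subspace[OF assms] by metis
  then have "\<exists>B. B \<subseteq> E \<and> pairwise Linear_Algebra.orthogonal B \<and> (\<forall>b\<in>B. norm b = 1) \<and>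
     finite B \<and> card B = Real_Vector_Spaces.dim E \<and> Real_Vector_Spaces.span B = E"
    using independent_imp_finite by metis
  note * = someI_ex[OF this, folded orthobasis_def]
  show "orthobasis E \<subseteq> E" "finite (orthobasis E)" "card (orthobasis E) = Real_Vector_Spaces.dim E"
    using * by blast+
  fix x assume x: "x \<in> E"
  show "(\<Sum>b\<in>orthobasis E. (x \<bullet> b) *\<^sub>R b) = x"
  proof (rule orthonormal_basis_expand)
    show "x \<in> Real_Vector_Spaces.span (orthobasis E)" using * x by auto
  qed (use * in auto)
qed

section \<open>The chain rule for maps between two model spaces\<close>

context
  fixes E W :: "'a::euclidean_space set" and F V :: "'b::euclidean_space set"
    and f :: "'a \<Rightarrow> 'b"
  assumes E: "Real_Vector_Spaces.subspace E" and W: "openin (top_of_set E) W"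
    and F: "Real_Vector_Spaces.subspace F" and V: "openin (top_of_set F) V"
    and f: "smooth_on E W f" and fW: "f ` W \<subseteq> V"
begin

text \<open>The values of f lie in F, so f is fixed by the linear projection onto F. Differentiating
  this identity shows that the derivative lies in F as well, where directional derivatives of g are
  determined.\<close>

lemma dir_deriv_expand:
  assumes x: "x \<in> W" and v: "v \<in> E"
  shows "dir_deriv E v f x = (\<Sum>b\<in>orthobasis F. (dir_deriv E v f x \<bullet> b) *\<^sub>R b)"
proof -
  have L: "bounded_linear (\<lambda>y. \<Sum>b\<in>orthobasis F. (y \<bullet> b) *\<^sub>R b)"
    by (intro bounded_linear_sum bounded_linear_intros)
  have "dir_deriv E v f x = dir_deriv E v (\<lambda>x. \<Sum>b\<in>orthobasis F. (f x \<bullet> b) *\<^sub>R b) x"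
    using fW openin_subset[OF V] by (intro dir_deriv_local_cong[OF W x] orthobasis(4)[OF F, symmetric]) auto
  also have "\<dots> = (\<Sum>b\<in>orthobasis F. (dir_deriv E v f x \<bullet> b) *\<^sub>R b)"
    by (rule dir_deriv_linear[OF E W L f x v])
  finally show ?thesis .
qed

lemma compose_has_derivative:
  assumes g: "g differentiable (at (f x) within F)" and x: "x \<in> W"
  shows "((\<lambda>x. g (f x)) has_derivative (\<lambda>v. dir_deriv F (dir_deriv E v f x) g (f x))) (at x within E)"
  using has_derivative_compose_on[OF E W f _ x has_derivative_dir_deriv[OF g]] fW openin_subset[OF V] by auto

text \<open>The coordinate form (2) is a sum of products of a derivative of f with a derivative of g
  composed with f. This shape lets the induction for \<open>smooth_on_compose\<close> run over g
  while f stays fixed.\<close>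

lemma dir_deriv_compose:
  assumes g: "g differentiable (at (f x) within F)" and x: "x \<in> W" and v: "v \<in> E"
  shows "dir_deriv E v (\<lambda>x. g (f x)) x = dir_deriv F (dir_deriv E v f x) g (f x)"
    and "dir_deriv E v (\<lambda>x. g (f x)) x =
      (\<Sum>b\<in>orthobasis F. (dir_deriv E v f x \<bullet> b) *\<^sub>R dir_deriv F b g (f x))"
proof -
  show *: "dir_deriv E v (\<lambda>x. g (f x)) x = dir_deriv F (dir_deriv E v f x) g (f x)"
    using dir_deriv_eq[OF E _ v compose_has_derivative[OF g x]] x openin_subset[OF W] by auto
  interpret bounded_linear "\<lambda>v. dir_deriv F v g (f x)"
    using has_derivative_dir_deriv[OF g] by (rule has_derivative_bounded_linear)
  show "dir_deriv E v (\<lambda>x. g (f x)) x =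
      (\<Sum>b\<in>orthobasis F. (dir_deriv E v f x \<bullet> b) *\<^sub>R dir_deriv F b g (f x))"
    unfolding * by (subst dir_deriv_expand[OF x v]) (simp add: sum scaleR)
qed

lemma smooth_on_compose:
  assumes g: "smooth_on F V g"
  shows "smooth_on E W (\<lambda>x. g (f x))"
proof -
  have "Ck_on k E W (\<lambda>x. g (f x))" for k
    using g
  proof (induction k arbitrary: g)
    case 0
    then show ?case using smooth_on_continuous_on f fW continuous_on_compose2 by (metis Ck_on.simps(1))
  next
    case (Suc k)
    note gd = smooth_on_differentiable[OF Suc.prems]
    have "Ck_on k E W (dir_deriv E v (\<lambda>x. g (f x)))" if v: "v \<in> E" for v
    proof (rule Ck_on_cong[OF W])
      show "Ck_on k E W (\<lambda>x. \<Sum>b\<in>orthobasis F. (dir_deriv E v f x \<bullet> b) *\<^sub>R dir_deriv F b g (f x))"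
      proof (intro Ck_on_sum[OF E W] Ck_on_bilinear[OF E W bounded_bilinear_scaleR])
        fix b assume "b \<in> orthobasis F"
        then have "b \<in> F" using orthobasis(1)[OF F] by blast
        then show "Ck_on k E W (\<lambda>x. dir_deriv F b g (f x))"
          using Suc.IH smooth_on_dir_deriv[OF Suc.prems] by blast
        show "Ck_on k E W (\<lambda>x. dir_deriv E v f x \<bullet> b)"
          using smooth_on_dir_deriv[OF f v] unfolding smooth_on_def
          by (intro Ck_on_linear[OF E W bounded_linear_inner_left]) blast
      qed
      show "(\<Sum>b\<in>orthobasis F. (dir_deriv E v f x \<bullet> b) *\<^sub>R dir_deriv F b g (f x)) =
          dir_deriv E v (\<lambda>x. g (f x)) x" if x: "x \<in> W" for x
        using dir_deriv_compose(2)[OF gd x v] fW x by auto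
    qed
    moreover have "(\<lambda>x. g (f x)) differentiable (at x within E)" if x: "x \<in> W" for x
      using compose_has_derivative[OF gd x] fW x unfolding differentiable_def by blast
    ultimately show ?case by simp
  qed
  then show ?thesis unfolding smooth_on_def by blast
qed

text \<open>A map with constant derivative L contributes no terms from its own higher derivatives,
  so the list of directions is merely transported by L. Needed for the slices \<open>Pair s\<close>
  of a product.\<close>

lemma dir_derivs_affine:
  assumes lin: "\<And>v x. v \<in> E \<Longrightarrow> x \<in> W \<Longrightarrow> dir_deriv E v f x = L v"
    and L: "L ` E \<subseteq> F"
    and g: "smooth_on F V g" and x: "x \<in> W" and vs: "set vs \<subseteq> E"
  shows "dir_derivs E vs (\<lambda>x. g (f x)) x = dir_derivs F (map L vs) g (f x)"
  using x vs
proof (induction vs arbitrary: x)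
  case (Cons v vs)
  have v: "v \<in> E" and vs: "set vs \<subseteq> E" and mvs: "set (map L vs) \<subseteq> F" using Cons.prems L by auto
  have "dir_derivs E (v # vs) (\<lambda>x. g (f x)) x
      = dir_deriv E v (\<lambda>x. dir_derivs F (map L vs) g (f x)) x"
    unfolding dir_derivs.simps by (rule dir_deriv_local_cong[OF W Cons.prems(1)]) (rule Cons.IH[OF _ vs])
  also have "\<dots> = dir_deriv F (dir_deriv E v f x) (dir_derivs F (map L vs) g) (f x)"
    using fW Cons.prems(1)
    by (intro dir_deriv_compose(1)[OF _ Cons.prems(1) v] smooth_on_differentiable[OF smooth_on_dir_derivs[OF g mvs]])
      auto
  finally show ?case by (simp add: lin[OF v Cons.prems(1)])
qed simp

end

section \<open>Taylor expansion in terms of functions with independent differentials\<close>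

text \<open>Vanishing of the jet of order k - 1 at p. It plays the part of membership in the k-th
  power of the ideal of functions vanishing at p.\<close>

definition flat_at :: "'a::real_normed_vector set \<Rightarrow> 'a \<Rightarrow> nat \<Rightarrow> ('a \<Rightarrow> complex) \<Rightarrow> bool" where
  "flat_at E p k f \<longleftrightarrow> (\<forall>vs. set vs \<subseteq> E \<longrightarrow> length vs < k \<longrightarrow> dir_derivs E vs f p = 0)"

lemma flat_at_0 [simp]: "flat_at E p 0 f"
  by (simp add: flat_at_def)

lemma flat_at_mono: "flat_at E p k f \<Longrightarrow> m \<le> k \<Longrightarrow> flat_at E p m f"
  by (auto simp: flat_at_def)

text \<open>\<open>dir_derivs\<close> applies the head of the list last. Recursion on the function
  therefore strips the last entry of the list, the innermost derivative.\<close>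

lemma flat_at_Suc:
  "flat_at E p (Suc k) f \<longleftrightarrow> f p = 0 \<and> (\<forall>v\<in>E. flat_at E p k (dir_deriv E v f))"
proof safe
  assume *: "flat_at E p (Suc k) f"
  show "f p = 0" using *[unfolded flat_at_def, rule_format, of "[]"] by simp
  fix v assume v: "v \<in> E"
  show "flat_at E p k (dir_deriv E v f)" unfolding flat_at_def
  proof (intro allI impI)
    fix vs assume "set vs \<subseteq> E" "length vs < k"
    then show "dir_derivs E vs (dir_deriv E v f) p = 0"
      using *[unfolded flat_at_def, rule_format, of "vs @ [v]"] v by (simp add: dir_derivs_append)
  qed
next
  assume p: "f p = 0" and d: "\<forall>v\<in>E. flat_at E p k (dir_deriv E v f)"
  show "flat_at E p (Suc k) f" unfolding flat_at_def
  proof (intro allI impI)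
    fix vs assume vs: "set vs \<subseteq> E" "length vs < Suc k"
    show "dir_derivs E vs f p = 0"
    proof (cases vs rule: rev_cases)
      case (snoc ws v)
      then show ?thesis using d vs unfolding flat_at_def by (simp add: dir_derivs_append)
    qed (simp add: p)
  qed
qed

text \<open>The coordinate of p - x, not of x - p. A combination l of the \<open>q j\<close> with
  differential v \<mapsto> v \<bullet> b then makes \<open>coord p b x + l b x\<close> vanish to
  second order.\<close>

definition coord :: "'a::real_inner \<Rightarrow> 'a \<Rightarrow> 'a \<Rightarrow> complex" where
  "coord p b x = complex_of_real ((p - x) \<bullet> b)"

lemma coord_p [simp]: "coord p b p = 0"
  by (simp add: coord_def)

context
  fixes E W :: "'a::euclidean_space set"
  assumes E: "Real_Vector_Spaces.subspace E" and W: "openin (top_of_set E) W"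
begin

lemma coord_has_derivative:
  "(coord p b has_derivative (\<lambda>v. - complex_of_real (v \<bullet> b))) (at x within E)"
  unfolding coord_def by (auto intro!: derivative_eq_intros simp: inner_diff_left)

lemma smooth_coord: "smooth_on E W (coord p b)"
proof -
  have "smooth_on E W (\<lambda>x. complex_of_real (x \<bullet> b))"
    by (rule smooth_on_linear[OF E W bounded_linear_compose[OF bounded_linear_of_real
            bounded_linear_inner_left] smooth_on_ident[OF E W]])
  from smooth_on_diff[OF E W smooth_on_const[OF E W] this] show ?thesis
    unfolding coord_def[abs_def] inner_diff_left of_real_diff .
qed

lemma dir_deriv_coord: "x \<in> W \<Longrightarrow> v \<in> E \<Longrightarrow> dir_deriv E v (coord p b) x = - complex_of_real (v \<bullet> b)"
  by (rule dir_deriv_eq[OF E subsetD[OF openin_model_subset[OF E W]] _ coord_has_derivative])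

lemma dir_deriv_orthobasis:
  assumes "f differentiable (at x within E)" "v \<in> E"
  shows "(\<Sum>b\<in>orthobasis E. (v \<bullet> b) *\<^sub>R dir_deriv E b f x) = dir_deriv E v f x"
proof -
  interpret bounded_linear "\<lambda>v. dir_deriv E v f x"
    using has_derivative_dir_deriv[OF assms(1)] by (rule has_derivative_bounded_linear)
  have "dir_deriv E (\<Sum>b\<in>orthobasis E. (v \<bullet> b) *\<^sub>R b) f x = dir_deriv E v f x"
    by (simp add: orthobasis(4)[OF E assms(2)])
  then show ?thesis by (simp add: sum scaleR)
qed

end

context
  fixes E W :: "'a::euclidean_space set" and p :: 'a
  assumes E: "Real_Vector_Spaces.subspace E" and W: "openin (top_of_set E) W" and p: "p \<in> W"
begin

lemma flat_at_cong:
  "(\<And>x. x \<in> W \<Longrightarrow> f x = g x) \<Longrightarrow> flat_at E p k f \<Longrightarrow> flat_at E p k g"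
  using dir_derivs_local_cong[OF W _ p, of f g] unfolding flat_at_def by simp

lemma flat_at_add:
  assumes "smooth_on E W f" "smooth_on E W g" "flat_at E p k f" "flat_at E p k g"
  shows "flat_at E p k (\<lambda>x. f x + g x)"
  using assms
proof (induction k arbitrary: f g)
  case (Suc k)
  have "flat_at E p k (dir_deriv E v (\<lambda>x. f x + g x))" if v: "v \<in> E" for v
  proof (rule flat_at_cong)
    show "flat_at E p k (\<lambda>x. dir_deriv E v f x + dir_deriv E v g x)"
      using Suc.prems v by (intro Suc.IH smooth_on_dir_deriv) (auto simp: flat_at_Suc)
    show "dir_deriv E v f x + dir_deriv E v g x = dir_deriv E v (\<lambda>x. f x + g x) x" if "x \<in> W" for x
      using dir_deriv_add[OF E W Suc.prems(1,2) that v] by simp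
  qed
  then show ?case using Suc.prems by (simp add: flat_at_Suc)
qed simp

text \<open>By the Leibniz rule each differentiation costs one order in one factor. Truncated
  subtraction in \<open>a - 1\<close> and \<open>b - 1\<close> covers a factor of order 0: the other
  factor then has the whole order.\<close>

lemma flat_at_mult:
  assumes "smooth_on E W f" "smooth_on E W g" "flat_at E p a f" "flat_at E p b g" "k \<le> a + b"
  shows "flat_at E p k (\<lambda>x. f x * g x)"
  using assms
proof (induction k arbitrary: a b f g)
  case (Suc k)
  have dflat: "flat_at E p (m - 1) (dir_deriv E v h)" if "flat_at E p m h" "v \<in> E" for m v h
    using that by (cases m) (auto simp: flat_at_Suc)
  have "flat_at E p k (dir_deriv E v (\<lambda>x. f x * g x))" if v: "v \<in> E" for v
  proof (rule flat_at_cong)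
    have "flat_at E p k (\<lambda>x. f x * dir_deriv E v g x)"
      using Suc.prems v by (intro Suc.IH[of _ _ a "b - 1"] smooth_on_dir_deriv dflat) auto
    moreover have "flat_at E p k (\<lambda>x. dir_deriv E v f x * g x)"
      using Suc.prems v by (intro Suc.IH[of _ _ "a - 1" b] smooth_on_dir_deriv dflat) auto
    ultimately show "flat_at E p k (\<lambda>x. f x * dir_deriv E v g x + dir_deriv E v f x * g x)"
      using Suc.prems v by (intro flat_at_add smooth_on_mult[OF E W] smooth_on_dir_deriv)
    show "f x * dir_deriv E v g x + dir_deriv E v f x * g x = dir_deriv E v (\<lambda>x. f x * g x) x"
      if "x \<in> W" for x
      using dir_deriv_mult[OF E W Suc.prems(1,2) that v] by simp
  qed
  moreover have "f p * g p = 0"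
  proof (cases a)
    case 0
    then obtain b' where "b = Suc b'" using Suc.prems(5) by (cases b) auto
    then show ?thesis using Suc.prems by (simp add: flat_at_Suc)
  qed (use Suc.prems in \<open>simp add: flat_at_Suc\<close>)
  ultimately show ?case by (simp add: flat_at_Suc)
qed simp

lemma flat_at_zero: "flat_at E p k (\<lambda>_. 0)"
proof (induction k)
  case (Suc k)
  have "flat_at E p k (dir_deriv E v (\<lambda>_. 0))" if v: "v \<in> E" for v
    by (rule flat_at_cong[OF _ Suc]) (rule dir_deriv_const[OF E W _ v, symmetric])
  then show ?case by (simp add: flat_at_Suc)
qed simp

lemma flat_at_sum:
  "(\<And>i. i \<in> I \<Longrightarrow> smooth_on E W (f i)) \<Longrightarrow> (\<And>i. i \<in> I \<Longrightarrow> flat_at E p k (f i)) \<Longrightarrow>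
    flat_at E p k (\<lambda>x. \<Sum>i\<in>I. f i x)"
  by (induction I rule: infinite_finite_induct)
    (auto intro: flat_at_zero flat_at_add[of "f i" "\<lambda>x. \<Sum>i\<in>I. f i x" for i I] smooth_on_sum[OF E W, of _ f])

lemma flat_at_cmult:
  "smooth_on E W f \<Longrightarrow> flat_at E p k f \<Longrightarrow> flat_at E p k (\<lambda>x. c * f x)"
  by (rule flat_at_mult[where a=0 and b=k, OF smooth_on_const[OF E W] _ flat_at_0]) simp_all

lemma flat_at_diff:
  "smooth_on E W f \<Longrightarrow> smooth_on E W g \<Longrightarrow> flat_at E p k f \<Longrightarrow> flat_at E p k g \<Longrightarrow>
    flat_at E p k (\<lambda>x. f x - g x)"
  using flat_at_add[OF _ smooth_on_cmult[OF E W, of g "-1"] _ flat_at_cmult[of g k "-1"], of f] by simp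

text \<open>Euler's identity for homogeneous polynomials, modulo higher order terms. The coordinates carry
  a minus sign.\<close>

lemma flat_at_Euler:
  assumes "smooth_on E W f" "flat_at E p k f"
  shows "flat_at E p (Suc k) (\<lambda>x. of_nat k * f x + (\<Sum>b\<in>orthobasis E. coord p b x * dir_deriv E b f x))"
  using assms
proof (induction k arbitrary: f)
  case 0
  then show ?case by (simp add: flat_at_Suc)
next
  case (Suc k)
  note B = subsetD[OF orthobasis(1)[OF E]]
  have sm: "smooth_on E W (\<lambda>x. \<Sum>b\<in>orthobasis E. coord p b x * dir_deriv E b f x)"
    using Suc.prems B
    by (intro smooth_on_sum[OF E W] smooth_on_mult[OF E W] smooth_coord[OF E W] smooth_on_dir_deriv) auto
  have "flat_at E p (Suc k)
     (dir_deriv E v (\<lambda>x. of_nat (Suc k) * f x + (\<Sum>b\<in>orthobasis E. coord p b x * dir_deriv E b f x)))"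
    if v: "v \<in> E" for v
  proof (rule flat_at_cong)
    show "flat_at E p (Suc k) (\<lambda>x. of_nat k * dir_deriv E v f x +
       (\<Sum>b\<in>orthobasis E. coord p b x * dir_deriv E b (dir_deriv E v f) x))"
      using Suc.prems v by (intro Suc.IH smooth_on_dir_deriv) (auto simp: flat_at_Suc)
    fix x assume x: "x \<in> W"
    have "dir_deriv E v (\<lambda>x. of_nat (Suc k) * f x + (\<Sum>b\<in>orthobasis E. coord p b x * dir_deriv E b f x)) x
      = of_nat (Suc k) * dir_deriv E v f x +
        (\<Sum>b\<in>orthobasis E. dir_deriv E v (\<lambda>x. coord p b x * dir_deriv E b f x) x)"
      using Suc.prems v x B
      by (simp add: dir_deriv_add[OF E W _ sm x v] smooth_on_cmult[OF E W] dir_deriv_const[OF E W]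
          dir_deriv_mult[OF E W smooth_on_const[OF E W]] smooth_on_mult[OF E W] smooth_coord[OF E W]
          smooth_on_dir_deriv dir_deriv_sum[OF E W, of _ "\<lambda>b x. coord p b x * dir_deriv E b f x"])
    also have "(\<Sum>b\<in>orthobasis E. dir_deriv E v (\<lambda>x. coord p b x * dir_deriv E b f x) x)
      = (\<Sum>b\<in>orthobasis E. coord p b x * dir_deriv E b (dir_deriv E v f) x - (v \<bullet> b) *\<^sub>R dir_deriv E b f x)"
      using Suc.prems v x B
      by (intro sum.cong refl) (simp add: dir_deriv_mult[OF E W] smooth_coord[OF E W] smooth_on_dir_deriv
          dir_deriv_coord[OF E W] dir_deriv_commute[OF E W _ x v] scaleR_conv_of_real)
    \<comment> \<open>Differentiating the coordinates costs one copy of the derivative of f along v.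
      This lowers the factor k + 1 to k, so that Euler's expression of order k for that derivative
      remains.\<close>
    also have "\<dots> = (\<Sum>b\<in>orthobasis E. coord p b x * dir_deriv E b (dir_deriv E v f) x) - dir_deriv E v f x"
      using dir_deriv_orthobasis[OF E W smooth_on_differentiable[OF Suc.prems(1) x] v] by (simp add: sum_subtractf)
    finally show "of_nat k * dir_deriv E v f x +
       (\<Sum>b\<in>orthobasis E. coord p b x * dir_deriv E b (dir_deriv E v f) x) =
      dir_deriv E v (\<lambda>x. of_nat (Suc k) * f x + (\<Sum>b\<in>orthobasis E. coord p b x * dir_deriv E b f x)) x"
      by (simp add: algebra_simps)
  qed
  moreover have "f p = 0" using Suc.prems by (simp add: flat_at_Suc)
  ultimately show ?case by (subst flat_at_Suc) simp
qed

end

section \<open>Monomials and homogeneous polynomials in the functions \<open>q j\<close>\<close>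

definition monom_fun :: "nat \<Rightarrow> (nat \<Rightarrow> 'x \<Rightarrow> complex) \<Rightarrow> (nat \<Rightarrow> nat) \<Rightarrow> 'x \<Rightarrow> complex" where
  "monom_fun n q \<alpha> x = (\<Prod>j<n. q j x ^ \<alpha> j)"

lemma finite_multi_indices: "finite {\<alpha> \<in> multi_indices n. (\<Sum>j<n. \<alpha> j) < N}"
proof (rule finite_subset)
  show "{\<alpha> \<in> multi_indices n. (\<Sum>j<n. \<alpha> j) < N} \<subseteq> {f. \<forall>j. (j \<in> {..<n} \<longrightarrow> f j \<in> {..<N}) \<and> (j \<notin> {..<n} \<longrightarrow> f j = 0)}"
  proof (intro subsetI CollectI allI)
    fix \<alpha> :: "nat \<Rightarrow> nat" and j
    assume "\<alpha> \<in> {\<alpha> \<in> multi_indices n. (\<Sum>j<n. \<alpha> j) < N}"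
    then show "(j \<in> {..<n} \<longrightarrow> \<alpha> j \<in> {..<N}) \<and> (j \<notin> {..<n} \<longrightarrow> \<alpha> j = 0)"
      using member_le_sum[of j "{..<n}" \<alpha>] by (auto simp: multi_indices_def)
  qed
  show "finite {f. \<forall>j. (j \<in> {..<n} \<longrightarrow> f j \<in> {..<N}) \<and> (j \<notin> {..<n} \<longrightarrow> f j = (0::nat))}"
    by (rule finite_set_of_finite_funs) auto
qed

definition homogeneous :: "nat \<Rightarrow> (nat \<Rightarrow> 'x \<Rightarrow> complex) \<Rightarrow> nat \<Rightarrow> ('x \<Rightarrow> complex) \<Rightarrow> bool" where
  "homogeneous n q k h \<longleftrightarrow>
     (\<exists>c. h = (\<lambda>x. \<Sum>\<alpha> | \<alpha> \<in> multi_indices n \<and> (\<Sum>j<n. \<alpha> j) = k. c \<alpha> * monom_fun n q \<alpha> x))"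

lemma finite_multi_indices_eq: "finite {\<alpha>. \<alpha> \<in> multi_indices n \<and> (\<Sum>j<n. \<alpha> j) = k}"
  by (rule finite_subset[OF _ finite_multi_indices[of n "Suc k"]]) auto

lemma homogeneous_monom:
  assumes "\<alpha> \<in> multi_indices n" "(\<Sum>j<n. \<alpha> j) = k"
  shows "homogeneous n q k (\<lambda>x. a * monom_fun n q \<alpha> x)"
proof -
  have "(\<Sum>\<beta> | \<beta> \<in> multi_indices n \<and> (\<Sum>j<n. \<beta> j) = k. (if \<beta> = \<alpha> then a else 0) * monom_fun n q \<beta> x)
    = a * monom_fun n q \<alpha> x" for x
    using assms finite_multi_indices_eq[of n k] by (simp add: if_distrib[of "\<lambda>a. a * _"] cong: if_cong)
  then show ?thesis unfolding homogeneous_def by (intro exI[of _ "\<lambda>\<beta>. if \<beta> = \<alpha> then a else 0"]) simp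
qed

lemma homogeneous_add:
  "homogeneous n q k f \<Longrightarrow> homogeneous n q k g \<Longrightarrow> homogeneous n q k (\<lambda>x. f x + g x)"
  unfolding homogeneous_def
proof (elim exE)
  fix c d
  assume "f = (\<lambda>x. \<Sum>\<alpha> | \<alpha> \<in> multi_indices n \<and> (\<Sum>j<n. \<alpha> j) = k. c \<alpha> * monom_fun n q \<alpha> x)"
    "g = (\<lambda>x. \<Sum>\<alpha> | \<alpha> \<in> multi_indices n \<and> (\<Sum>j<n. \<alpha> j) = k. d \<alpha> * monom_fun n q \<alpha> x)"
  then show "\<exists>c. (\<lambda>x. f x + g x) =
      (\<lambda>x. \<Sum>\<alpha> | \<alpha> \<in> multi_indices n \<and> (\<Sum>j<n. \<alpha> j) = k. c \<alpha> * monom_fun n q \<alpha> x)"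
    by (intro exI[of _ "\<lambda>\<alpha>. c \<alpha> + d \<alpha>"]) (simp add: sum.distrib distrib_right)
qed

lemma homogeneous_zero: "homogeneous n q k (\<lambda>x. 0)"
  unfolding homogeneous_def by (intro exI[of _ "\<lambda>_. 0"]) simp

lemma homogeneous_sum:
  "(\<And>i. i \<in> I \<Longrightarrow> homogeneous n q k (f i)) \<Longrightarrow> homogeneous n q k (\<lambda>x. \<Sum>i\<in>I. f i x)"
  by (induction I rule: infinite_finite_induct) (auto intro: homogeneous_zero homogeneous_add)

lemma homogeneous_cmult: "homogeneous n q k f \<Longrightarrow> homogeneous n q k (\<lambda>x. a * f x)"
  unfolding homogeneous_def
proof (elim exE)
  fix c
  assume "f = (\<lambda>x. \<Sum>\<alpha> | \<alpha> \<in> multi_indices n \<and> (\<Sum>j<n. \<alpha> j) = k. c \<alpha> * monom_fun n q \<alpha> x)"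
  then show "\<exists>c. (\<lambda>x. a * f x) =
      (\<lambda>x. \<Sum>\<alpha> | \<alpha> \<in> multi_indices n \<and> (\<Sum>j<n. \<alpha> j) = k. c \<alpha> * monom_fun n q \<alpha> x)"
    by (intro exI[of _ "\<lambda>\<alpha>. a * c \<alpha>"]) (simp add: sum_distrib_left mult.assoc)
qed

lemma monom_fun_raise:
  assumes "j < n"
  shows "q j x * monom_fun n q \<alpha> x = monom_fun n q (\<alpha>(j := Suc (\<alpha> j))) x"
proof -
  have j: "j \<in> {..<n}" using assms by simp
  have "(\<Prod>i\<in>{..<n} - {j}. q i x ^ (\<alpha>(j := Suc (\<alpha> j))) i) = (\<Prod>i\<in>{..<n} - {j}. q i x ^ \<alpha> i)"
    by (intro prod.cong) auto
  then show ?thesis unfolding monom_fun_def by (simp add: prod.remove[OF finite_lessThan j] mult.assoc)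
qed

lemma homogeneous_raise:
  assumes "homogeneous n q k h" "j < n"
  shows "homogeneous n q (Suc k) (\<lambda>x. q j x * h x)"
proof -
  obtain c where h: "h = (\<lambda>x. \<Sum>\<alpha> | \<alpha> \<in> multi_indices n \<and> (\<Sum>j<n. \<alpha> j) = k. c \<alpha> * monom_fun n q \<alpha> x)"
    using assms(1) unfolding homogeneous_def by blast
  have deg: "(\<Sum>i<n. (\<alpha>(j := Suc (\<alpha> j))) i) = Suc (\<Sum>i<n. \<alpha> i)" for \<alpha> :: "nat \<Rightarrow> nat"
  proof -
    have "(\<Sum>i\<in>{..<n} - {j}. (\<alpha>(j := Suc (\<alpha> j))) i) = (\<Sum>i\<in>{..<n} - {j}. \<alpha> i)" by (intro sum.cong) auto
    then show ?thesis using assms(2) by (simp add: sum.remove[of "{..<n}" j])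
  qed
  \<comment> \<open>The sum is not reindexed by the raised multi-indices; each summand is
    homogeneous by itself, and so is their sum.\<close>
  have "(\<lambda>x. q j x * h x) = (\<lambda>x. \<Sum>\<alpha> | \<alpha> \<in> multi_indices n \<and> (\<Sum>j<n. \<alpha> j) = k.
      c \<alpha> * monom_fun n q (\<alpha>(j := Suc (\<alpha> j))) x)"
    unfolding h sum_distrib_left
    by (intro ext sum.cong refl) (simp add: monom_fun_raise[OF assms(2), symmetric] mult.left_commute)
  moreover have "homogeneous n q (Suc k) \<dots>"
    using assms(2) by (intro homogeneous_sum homogeneous_monom) (simp add: multi_indices_def, simp only: mem_Collect_eq deg)
  ultimately show ?thesis by simp
qed

section \<open>Taylor polynomials in functions whose differentials generate the coordinate
  forms\<close>

context
  fixes E W :: "'a::euclidean_space set" and p :: 'a and n :: nat and q :: "nat \<Rightarrow> 'a \<Rightarrow> complex"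
    and m :: "'a \<Rightarrow> nat \<Rightarrow> complex"
  assumes E: "Real_Vector_Spaces.subspace E" and W: "openin (top_of_set E) W" and p: "p \<in> W"
    and q: "\<And>j. j < n \<Longrightarrow> smooth_on E W (q j)" and qp: "\<And>j. j < n \<Longrightarrow> q j p = 0"
    and m: "\<And>b v. b \<in> orthobasis E \<Longrightarrow> v \<in> E \<Longrightarrow>
      (\<Sum>j<n. m b j * dir_deriv E v (q j) p) = complex_of_real (v \<bullet> b)"
begin

lemma smooth_on_monom_fun: "smooth_on E W (monom_fun n q \<alpha>)"
proof -
  have "smooth_on E W (\<lambda>x. \<Prod>j\<in>J. q j x ^ \<alpha> j)" if "J \<subseteq> {..<n}" for J
    using finite_subset[OF that finite_lessThan] that
    by (induction rule: finite_induct)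
      (auto intro!: smooth_on_const[OF E W] smooth_on_mult[OF E W] smooth_on_power[OF E W] q)
  then show ?thesis by (simp add: monom_fun_def[abs_def])
qed

lemma smooth_on_homogeneous: "homogeneous n q k h \<Longrightarrow> smooth_on E W h"
  unfolding homogeneous_def
  by (auto intro!: smooth_on_sum[OF E W] smooth_on_cmult[OF E W] smooth_on_monom_fun)

text \<open>In degree 0 the polynomial is the constant f p. In degree k + 1, let h b be the degree k
  part of the derivative of f along b, and l b the combination of the \<open>q j\<close> with the
  differential of the b-th coordinate. Modulo order k + 2, Euler's identity gives (k + 1) f = \<Sum>
  l b * h b, so the sum divided by k + 1 is the sought polynomial.\<close>

lemma flat_at_homogeneous_step:
  assumes "smooth_on E W f" "flat_at E p k f"
  shows "\<exists>h. homogeneous n q k h \<and> flat_at E p (Suc k) (\<lambda>x. f x - h x)"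
  using assms
proof (induction k arbitrary: f)
  case 0
  have "homogeneous n q 0 (\<lambda>x. f p * monom_fun n q (\<lambda>_. 0) x)"
    by (rule homogeneous_monom) (auto simp: multi_indices_def)
  then show ?case by (auto intro!: exI[of _ "\<lambda>x. f p"] simp: flat_at_Suc monom_fun_def)
next
  case (Suc k)
  define B where "B = orthobasis E"
  have B: "b \<in> E" if "b \<in> B" for b using that orthobasis(1)[OF E] by (auto simp: B_def)
  have "\<exists>h. homogeneous n q k h \<and> flat_at E p (Suc k) (\<lambda>x. dir_deriv E b f x - h x)" if "b \<in> B" for b
    using Suc.prems B[OF that] by (intro Suc.IH smooth_on_dir_deriv) (auto simp: flat_at_Suc)
  then obtain h where h: "\<And>b. b \<in> B \<Longrightarrow> homogeneous n q k (h b)"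
    "\<And>b. b \<in> B \<Longrightarrow> flat_at E p (Suc k) (\<lambda>x. dir_deriv E b f x - h b x)" by metis
  note sm = smooth_on_sum[OF E W] smooth_on_mult[OF E W] smooth_on_add[OF E W] smooth_on_diff[OF E W]
    smooth_on_const[OF E W] smooth_coord[OF E W] q
  define l where "l b x = (\<Sum>j<n. m b j * q j x)" for b x
  define g where "g x = (\<Sum>b\<in>B. l b x * h b x)" for x
  have sf: "smooth_on E W (dir_deriv E b f)" if "b \<in> B" for b
    using smooth_on_dir_deriv[OF Suc.prems(1) B[OF that]] .
  have sh: "smooth_on E W (h b)" if "b \<in> B" for b using smooth_on_homogeneous[OF h(1)[OF that]] .
  have sl: "smooth_on E W (l b)" for b unfolding l_def by (intro sm) auto
  have sg: "smooth_on E W g" unfolding g_def by (intro sm sl sh)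
  have lflat: "flat_at E p 1 (l b)" for b using qp by (simp add: flat_at_Suc l_def)
  have cflat: "flat_at E p 2 (\<lambda>x. coord p b x + l b x)" if b: "b \<in> B" for b
  proof -
    have "dir_deriv E v (\<lambda>x. coord p b x + l b x) p = 0" if v: "v \<in> E" for v
    proof -
      have "dir_deriv E v (l b) p = (\<Sum>j<n. dir_deriv E v (\<lambda>x. m b j * q j x) p)"
        unfolding l_def by (rule dir_deriv_sum[OF E W _ p v]) (intro sm, auto)
      also have "\<dots> = (\<Sum>j<n. m b j * dir_deriv E v (q j) p)"
        using dir_deriv_mult[OF E W smooth_on_const[OF E W] q p v] qp by simp
      also have "\<dots> = complex_of_real (v \<bullet> b)" using m b v by (simp add: B_def)
      finally show ?thesis
        using dir_deriv_add[OF E W smooth_coord[OF E W] sl p v] dir_deriv_coord[OF E W p v] by simp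
    qed
    then show ?thesis using lflat[of b] by (simp add: numeral_2_eq_2 flat_at_Suc coord_p)
  qed
  have euler: "flat_at E p (Suc (Suc k)) (\<lambda>x. of_nat (Suc k) * f x + (\<Sum>b\<in>B. coord p b x * dir_deriv E b f x))"
    using flat_at_Euler[OF E W p Suc.prems] by (simp add: B_def)
  have a1: "flat_at E p (Suc (Suc k)) (\<lambda>x. \<Sum>b\<in>B. (coord p b x + l b x) * dir_deriv E b f x)"
    using Suc.prems B cflat
    by (intro flat_at_sum[OF E W p] flat_at_mult[OF E W p, where a=2 and b=k] sm sl sf) (auto simp: flat_at_Suc)
  have a2: "flat_at E p (Suc (Suc k)) (\<lambda>x. \<Sum>b\<in>B. l b x * (dir_deriv E b f x - h b x))"
    by (intro flat_at_sum[OF E W p] flat_at_mult[OF E W p, where a=1 and b="Suc k"] sm sl sf sh h(2) lflat) auto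
  have s1: "smooth_on E W (\<lambda>x. of_nat (Suc k) * f x + (\<Sum>b\<in>B. coord p b x * dir_deriv E b f x))"
    by (intro sm sf Suc.prems(1))
  have s2: "smooth_on E W (\<lambda>x. \<Sum>b\<in>B. (coord p b x + l b x) * dir_deriv E b f x)"
    by (intro sm sf sl)
  have s3: "smooth_on E W (\<lambda>x. \<Sum>b\<in>B. l b x * (dir_deriv E b f x - h b x))"
    by (intro sm sf sl sh)
  \<comment> \<open>In \<open>euler\<close> minus \<open>a1\<close> plus \<open>a2\<close> all terms
    with derivatives of f cancel and (k + 1) f - g is left.\<close>
  have "flat_at E p (Suc (Suc k)) (\<lambda>x. (of_nat (Suc k) * f x + (\<Sum>b\<in>B. coord p b x * dir_deriv E b f x)) -
     (\<Sum>b\<in>B. (coord p b x + l b x) * dir_deriv E b f x) + (\<Sum>b\<in>B. l b x * (dir_deriv E b f x - h b x)))"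
    by (intro flat_at_add[OF E W p] flat_at_diff[OF E W p] smooth_on_diff[OF E W] euler a1 a2 s1 s2 s3)
  also have "(\<lambda>x. (of_nat (Suc k) * f x + (\<Sum>b\<in>B. coord p b x * dir_deriv E b f x)) -
     (\<Sum>b\<in>B. (coord p b x + l b x) * dir_deriv E b f x) + (\<Sum>b\<in>B. l b x * (dir_deriv E b f x - h b x)))
     = (\<lambda>x. of_nat (Suc k) * f x - g x)"
    by (simp add: g_def algebra_simps sum.distrib sum_subtractf)
  finally have "flat_at E p (Suc (Suc k)) (\<lambda>x. inverse (of_nat (Suc k)) * (of_nat (Suc k) * f x - g x))"
    by (intro flat_at_cmult[OF E W p] smooth_on_diff[OF E W] smooth_on_cmult[OF E W] Suc.prems(1) sg)
  moreover have "inverse (of_nat (Suc k)) * (of_nat (Suc k) * f x - g x) = f x - inverse (of_nat (Suc k)) * g x" for x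
    by (simp add: right_diff_distrib mult.assoc[symmetric] del: of_nat_Suc)
  moreover have "homogeneous n q (Suc k) (\<lambda>x. inverse (of_nat (Suc k)) * g x)"
  proof -
    have "g = (\<lambda>x. \<Sum>b\<in>B. \<Sum>j<n. m b j * (q j x * h b x))"
      by (rule ext) (simp add: g_def l_def sum_distrib_right mult.assoc)
    moreover have "homogeneous n q (Suc k) \<dots>"
      using h(1) by (intro homogeneous_sum homogeneous_cmult homogeneous_raise) auto
    ultimately show ?thesis by (simp add: homogeneous_cmult)
  qed
  ultimately show ?case by (intro exI[of _ "\<lambda>x. inverse (of_nat (Suc k)) * g x"]) simp
qed

lemma flat_at_Taylor:
  assumes f: "smooth_on E W f" "flat_at E p l f"
  shows "\<exists>c. flat_at E p N (\<lambda>x. f x -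
    (\<Sum>\<alpha> | \<alpha> \<in> multi_indices n \<and> l \<le> (\<Sum>j<n. \<alpha> j) \<and> (\<Sum>j<n. \<alpha> j) < N. c \<alpha> * monom_fun n q \<alpha> x))"
proof (induction N)
  case (Suc N)
  show ?case
  proof (cases "l \<le> N")
    case False
    then have "{\<alpha>. \<alpha> \<in> multi_indices n \<and> l \<le> (\<Sum>j<n. \<alpha> j) \<and> (\<Sum>j<n. \<alpha> j) < Suc N} = {}" by auto
    then show ?thesis using flat_at_mono[OF f(2), of "Suc N"] False by (simp only: sum.empty) simp
  next
    case True
    define A where "A N = {\<alpha>. \<alpha> \<in> multi_indices n \<and> l \<le> (\<Sum>j<n. \<alpha> j) \<and> (\<Sum>j<n. \<alpha> j) < N}" for N
    define H where "H = {\<alpha>. \<alpha> \<in> multi_indices n \<and> (\<Sum>j<n. \<alpha> j) = N}"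
    obtain c where c: "flat_at E p N (\<lambda>x. f x - (\<Sum>\<alpha>\<in>A N. c \<alpha> * monom_fun n q \<alpha> x))"
      using Suc unfolding A_def by blast
    have "smooth_on E W (\<lambda>x. f x - (\<Sum>\<alpha>\<in>A N. c \<alpha> * monom_fun n q \<alpha> x))"
      by (intro smooth_on_diff[OF E W] smooth_on_sum[OF E W] smooth_on_cmult[OF E W] smooth_on_monom_fun f(1))
    from flat_at_homogeneous_step[OF this c] obtain d where
      d: "flat_at E p (Suc N) (\<lambda>x. f x - (\<Sum>\<alpha>\<in>A N. c \<alpha> * monom_fun n q \<alpha> x) - (\<Sum>\<alpha>\<in>H. d \<alpha> * monom_fun n q \<alpha> x))"
      unfolding homogeneous_def H_def by blast
    have AH: "A (Suc N) = A N \<union> H" "A N \<inter> H = {}" using True by (auto simp: A_def H_def)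
    have fin: "finite (A N)" "finite H"
      by (auto intro: finite_subset[OF _ finite_multi_indices] finite_multi_indices_eq simp: A_def H_def)
    have "(\<Sum>\<alpha>\<in>A (Suc N). (if \<alpha> \<in> H then d \<alpha> else c \<alpha>) * monom_fun n q \<alpha> x)
      = (\<Sum>\<alpha>\<in>A N. c \<alpha> * monom_fun n q \<alpha> x) + (\<Sum>\<alpha>\<in>H. d \<alpha> * monom_fun n q \<alpha> x)" for x
      unfolding AH(1) sum.union_disjoint[OF fin AH(2)] using AH(2)
      by (intro arg_cong2[where f="(+)"] sum.cong) auto
    then show ?thesis using d unfolding A_def[symmetric]
      by (intro exI[of _ "\<lambda>\<alpha>. if \<alpha> \<in> H then d \<alpha> else c \<alpha>"]) (simp add: diff_diff_eq)
  qed
qed simp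

end

section \<open>Linear differential operators along a map\<close>

text \<open>A differential operator along the map \<mu>: derivatives of f are taken at \<mu> z,
  coefficients depend on z. This class contains f \<mapsto> f (\<mu> z) and is closed under
  differentiation in z, so no formula for higher derivatives of a composition is required. For the
  identity map it has the shape of \<open>diff_operator\<close> in a chart.\<close>

definition jet_op :: "'a::real_normed_vector set \<Rightarrow> 'a set \<Rightarrow> 'b::real_normed_vector set \<Rightarrow> 'b set \<Rightarrow>
    ('b \<Rightarrow> 'a) \<Rightarrow> nat \<Rightarrow> (('a \<Rightarrow> complex) \<Rightarrow> 'b \<Rightarrow> complex) \<Rightarrow> bool" where
  "jet_op E V F D \<mu> m T \<longleftrightarrow> (\<exists>L a. finite L \<and>
     (\<forall>w\<in>L. set w \<subseteq> E \<and> length w \<le> m \<and> smooth_on F D (a w)) \<and>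
     (\<forall>f. smooth_on E V f \<longrightarrow> (\<forall>z\<in>D. T f z = (\<Sum>w\<in>L. a w z * dir_derivs E w f (\<mu> z)))))"

lemma jet_op_cong:
  assumes "jet_op E V F D \<mu> m T" "\<And>f z. smooth_on E V f \<Longrightarrow> z \<in> D \<Longrightarrow> T f z = T' f z"
  shows "jet_op E V F D \<mu> m T'"
  using assms unfolding jet_op_def by metis

lemma jet_opE:
  assumes "jet_op E V F D \<mu> m T"
  obtains L a where "finite L" "\<And>w. w \<in> L \<Longrightarrow> set w \<subseteq> E \<and> length w \<le> m \<and> smooth_on F D (a w)"
    "\<And>f z. smooth_on E V f \<Longrightarrow> z \<in> D \<Longrightarrow> T f z = (\<Sum>w\<in>L. a w z * dir_derivs E w f (\<mu> z))"
proof -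
  from assms obtain L a where "finite L \<and>
     (\<forall>w\<in>L. set w \<subseteq> E \<and> length w \<le> m \<and> smooth_on F D (a w)) \<and>
     (\<forall>f. smooth_on E V f \<longrightarrow> (\<forall>z\<in>D. T f z = (\<Sum>w\<in>L. a w z * dir_derivs E w f (\<mu> z))))"
    unfolding jet_op_def by (elim exE)
  then show thesis by (intro that[of L a]) simp_all
qed

lemma diff_operatorE:
  assumes "diff_operator G m P" "c \<in> atlas G"
  obtains L a where "finite L"
    "\<And>w. w \<in> L \<Longrightarrow> set w \<subseteq> model G \<and> length w \<le> m \<and> smooth_on (model G) (chart_img c) (a w)"
    "\<And>f x. f \<in> smooth_funs G \<Longrightarrow> x \<in> chart_dom c \<Longrightarrow> P f x =
       (\<Sum>w\<in>L. a w (chart_map c x) * dir_derivs (model G) w (f \<circ> chart_inv c) (chart_map c x))"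
proof -
  obtain L a where "finite L \<and>
     (\<forall>w\<in>L. set w \<subseteq> model G \<and> length w \<le> m \<and> smooth_on (model G) (chart_img c) (a w)) \<and>
     (\<forall>f\<in>smooth_funs G. \<forall>x\<in>chart_dom c. P f x =
       (\<Sum>w\<in>L. a w (chart_map c x) * dir_derivs (model G) w (f \<circ> chart_inv c) (chart_map c x)))"
    using bspec[OF assms(1)[unfolded diff_operator_def] assms(2)] by (elim exE)
  then show thesis by (intro that[of L a]) simp_all
qed

context
  fixes E V :: "'a::euclidean_space set" and F D :: "'b::euclidean_space set" and \<mu> :: "'b \<Rightarrow> 'a"
  assumes E: "Real_Vector_Spaces.subspace E" and V: "openin (top_of_set E) V"
    and F: "Real_Vector_Spaces.subspace F" and D: "openin (top_of_set F) D"
    and \<mu>: "smooth_on F D \<mu>" and \<mu>D: "\<mu> ` D \<subseteq> V"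
begin

lemma jet_op_zero: "jet_op E V F D \<mu> m (\<lambda>f z. 0)"
  unfolding jet_op_def by (intro exI[of _ "{}"]) simp

lemma jet_op_single:
  "set w \<subseteq> E \<Longrightarrow> length w \<le> m \<Longrightarrow> smooth_on F D a \<Longrightarrow>
    jet_op E V F D \<mu> m (\<lambda>f z. a z * dir_derivs E w f (\<mu> z))"
  unfolding jet_op_def by (intro exI[of _ "{w}"] exI[of _ "\<lambda>_. a"]) simp

lemma jet_op_add:
  assumes "jet_op E V F D \<mu> m S" "jet_op E V F D \<mu> m T"
  shows "jet_op E V F D \<mu> m (\<lambda>f z. S f z + T f z)"
proof -
  obtain L a where L: "finite L" "\<And>w. w \<in> L \<Longrightarrow> set w \<subseteq> E \<and> length w \<le> m \<and> smooth_on F D (a w)"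
    and S: "\<And>f z. smooth_on E V f \<Longrightarrow> z \<in> D \<Longrightarrow> S f z = (\<Sum>w\<in>L. a w z * dir_derivs E w f (\<mu> z))"
    using assms(1) by (rule jet_opE) (rule that)
  obtain M b where M: "finite M" "\<And>w. w \<in> M \<Longrightarrow> set w \<subseteq> E \<and> length w \<le> m \<and> smooth_on F D (b w)"
    and T: "\<And>f z. smooth_on E V f \<Longrightarrow> z \<in> D \<Longrightarrow> T f z = (\<Sum>w\<in>M. b w z * dir_derivs E w f (\<mu> z))"
    using assms(2) by (rule jet_opE) (rule that)
  \<comment> \<open>A list carries a single coefficient, so lists common to both operators have
    their coefficients added; the others are extended by zero.\<close>
  define c where "c w = (\<lambda>z. (if w \<in> L then a w z else 0) + (if w \<in> M then b w z else 0))" for w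
  have "smooth_on F D (c w)" if "w \<in> L \<union> M" for w
    using L(2)[of w] M(2)[of w] unfolding c_def
    by (intro smooth_on_add[OF F D]) (cases "w \<in> L"; cases "w \<in> M"; simp add: smooth_on_const[OF F D])+
  moreover have "S f z + T f z = (\<Sum>w\<in>L \<union> M. c w z * dir_derivs E w f (\<mu> z))"
    if "smooth_on E V f" "z \<in> D" for f z
  proof -
    have "(\<Sum>w\<in>L. a w z * dir_derivs E w f (\<mu> z))
      = (\<Sum>w\<in>L \<union> M. (if w \<in> L then a w z else 0) * dir_derivs E w f (\<mu> z))"
      using L(1) M(1) by (intro sum.mono_neutral_cong_left) auto
    moreover have "(\<Sum>w\<in>M. b w z * dir_derivs E w f (\<mu> z))
      = (\<Sum>w\<in>L \<union> M. (if w \<in> M then b w z else 0) * dir_derivs E w f (\<mu> z))"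
      using L(1) M(1) by (intro sum.mono_neutral_cong_left) auto
    ultimately show ?thesis
      unfolding S[OF that] T[OF that] c_def by (simp only: sum.distrib distrib_right)
  qed
  ultimately show ?thesis unfolding jet_op_def using L M
    by (intro exI[of _ "L \<union> M"] exI[of _ c]) blast
qed

lemma jet_op_sum:
  "(\<And>i. i \<in> I \<Longrightarrow> jet_op E V F D \<mu> m (T i)) \<Longrightarrow> jet_op E V F D \<mu> m (\<lambda>f z. \<Sum>i\<in>I. T i f z)"
  by (induction I rule: infinite_finite_induct) (simp_all add: jet_op_zero jet_op_add)

lemma jet_op_mult:
  assumes "jet_op E V F D \<mu> m T" "smooth_on F D c"
  shows "jet_op E V F D \<mu> m (\<lambda>f z. c z * T f z)"
proof -
  obtain L a where L: "finite L" "\<And>w. w \<in> L \<Longrightarrow> set w \<subseteq> E \<and> length w \<le> m \<and> smooth_on F D (a w)"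
    and T: "\<And>f z. smooth_on E V f \<Longrightarrow> z \<in> D \<Longrightarrow> T f z = (\<Sum>w\<in>L. a w z * dir_derivs E w f (\<mu> z))"
    using assms(1) by (rule jet_opE) (rule that)
  show ?thesis
  proof (rule jet_op_cong)
    show "jet_op E V F D \<mu> m (\<lambda>f z. \<Sum>w\<in>L. (c z * a w z) * dir_derivs E w f (\<mu> z))"
      by (rule jet_op_sum, rule jet_op_single) (use L(2) assms(2) smooth_on_mult[OF F D assms(2)] in auto)
    show "(\<Sum>w\<in>L. (c z * a w z) * dir_derivs E w f (\<mu> z)) = c z * T f z"
      if "smooth_on E V f" "z \<in> D" for f z
      using T[OF that] by (simp add: sum_distrib_left mult.assoc)
  qed
qed

lemma jet_op_mono: "jet_op E V F D \<mu> k T \<Longrightarrow> k \<le> m \<Longrightarrow> jet_op E V F D \<mu> m T"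
  unfolding jet_op_def by (meson order_trans)

text \<open>By the chain rule a word w becomes b # w, with the b-component of the derivative of
  \<mu> as an extra coefficient; differentiating the old coefficient leaves w unchanged. Hence the
  order grows by at most one.\<close>

lemma jet_op_dir_deriv:
  assumes "jet_op E V F D \<mu> m T" and u: "u \<in> F"
  shows "jet_op E V F D \<mu> (Suc m) (\<lambda>f z. dir_deriv F u (T f) z)"
proof -
  obtain L a where L: "finite L" "\<And>w. w \<in> L \<Longrightarrow> set w \<subseteq> E \<and> length w \<le> m \<and> smooth_on F D (a w)"
    and T: "\<And>f z. smooth_on E V f \<Longrightarrow> z \<in> D \<Longrightarrow> T f z = (\<Sum>w\<in>L. a w z * dir_derivs E w f (\<mu> z))"
    using assms(1) by (rule jet_opE) (rule that)
  note B = subsetD[OF orthobasis(1)[OF E]]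
  define e where "e b z = complex_of_real (dir_deriv F u \<mu> z \<bullet> b)" for b z
  have e: "smooth_on F D (e b)" for b
    unfolding e_def[abs_def]
    by (rule smooth_on_linear[OF F D bounded_linear_compose[OF bounded_linear_of_real
            bounded_linear_inner_left] smooth_on_dir_deriv[OF \<mu> u]])
  show ?thesis
  proof (rule jet_op_cong)
    show "jet_op E V F D \<mu> (Suc m) (\<lambda>f z. \<Sum>w\<in>L.
        (\<Sum>b\<in>orthobasis E. (a w z * e b z) * dir_derivs E (b # w) f (\<mu> z)) +
        dir_deriv F u (a w) z * dir_derivs E w f (\<mu> z))"
    proof (rule jet_op_sum, rule jet_op_add)
      fix w assume w: "w \<in> L"
      show "jet_op E V F D \<mu> (Suc m) (\<lambda>f z. \<Sum>b\<in>orthobasis E. (a w z * e b z) * dir_derivs E (b # w) f (\<mu> z))"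
        by (rule jet_op_sum, rule jet_op_single)
          (use L(2)[OF w] B smooth_on_mult[OF F D _ e] in auto)
      show "jet_op E V F D \<mu> (Suc m) (\<lambda>f z. dir_deriv F u (a w) z * dir_derivs E w f (\<mu> z))"
        by (rule jet_op_single) (use L(2)[OF w] u in \<open>auto intro: smooth_on_dir_deriv\<close>)
    qed
    fix f :: "'a \<Rightarrow> complex" and z assume f: "smooth_on E V f" and z: "z \<in> D"
    have sf: "smooth_on E V (dir_derivs E w f)" if "w \<in> L" for w
      using smooth_on_dir_derivs[OF f] L(2)[OF that] by blast
    have sc: "smooth_on F D (\<lambda>z. dir_derivs E w f (\<mu> z))" if "w \<in> L" for w
      by (rule smooth_on_compose[OF F D E V \<mu> \<mu>D sf[OF that]])
    have "dir_deriv F u (T f) z = dir_deriv F u (\<lambda>z. \<Sum>w\<in>L. a w z * dir_derivs E w f (\<mu> z)) z"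
      by (rule dir_deriv_local_cong[OF D z T[OF f]])
    also have "\<dots> = (\<Sum>w\<in>L. dir_deriv F u (\<lambda>z. a w z * dir_derivs E w f (\<mu> z)) z)"
      using L(2) sc by (intro dir_deriv_sum[OF F D _ z u] smooth_on_mult[OF F D]) auto
    also have "\<dots> = (\<Sum>w\<in>L. a w z * dir_deriv F u (\<lambda>z. dir_derivs E w f (\<mu> z)) z +
        dir_deriv F u (a w) z * dir_derivs E w f (\<mu> z))"
      using L(2) sc by (intro sum.cong refl dir_deriv_mult[OF F D _ _ z u]) auto
    also have "\<dots> = (\<Sum>w\<in>L. (\<Sum>b\<in>orthobasis E. (a w z * e b z) * dir_derivs E (b # w) f (\<mu> z)) +
        dir_deriv F u (a w) z * dir_derivs E w f (\<mu> z))"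
    proof (intro sum.cong refl arg_cong2[where f="(+)"])
      fix w assume w: "w \<in> L"
      have "\<mu> z \<in> V" using \<mu>D z by blast
      from dir_deriv_compose(2)[OF F D E V \<mu> \<mu>D smooth_on_differentiable[OF sf[OF w] this] z u]
      show "a w z * dir_deriv F u (\<lambda>z. dir_derivs E w f (\<mu> z)) z =
        (\<Sum>b\<in>orthobasis E. (a w z * e b z) * dir_derivs E (b # w) f (\<mu> z))"
        by (simp add: e_def sum_distrib_left scaleR_conv_of_real mult.assoc)
    qed
    finally show "(\<Sum>w\<in>L. (\<Sum>b\<in>orthobasis E. (a w z * e b z) * dir_derivs E (b # w) f (\<mu> z)) +
        dir_deriv F u (a w) z * dir_derivs E w f (\<mu> z)) = dir_deriv F u (T f) z" by simp
  qed
qed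

lemma jet_op_dir_derivs:
  assumes "jet_op E V F D \<mu> m T" "set us \<subseteq> F"
  shows "jet_op E V F D \<mu> (length us + m) (\<lambda>f z. dir_derivs F us (T f) z)"
  using assms(2)
proof (induction us)
  case (Cons u us)
  then show ?case using jet_op_dir_deriv[of "length us + m" "\<lambda>f. dir_derivs F us (T f)" u] by simp
qed (simp add: assms(1))

end

section \<open>Affine slices of a product of model spaces\<close>

lemma smooth_on_affine:
  assumes E: "Real_Vector_Spaces.subspace E" and W: "openin (top_of_set E) W" and L: "bounded_linear L"
  shows "smooth_on E W (\<lambda>x. a + L x)"
    and "\<And>v x. v \<in> E \<Longrightarrow> x \<in> W \<Longrightarrow> dir_deriv E v (\<lambda>x. a + L x) x = L v"
proof -
  show "smooth_on E W (\<lambda>x. a + L x)"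
    by (rule smooth_on_add[OF E W smooth_on_const[OF E W] smooth_on_linear[OF E W L smooth_on_ident[OF E W]]])
  have "((\<lambda>x. a + L x) has_derivative (\<lambda>x. 0 + L x)) (at x within E)" for x
    by (rule has_derivative_add[OF has_derivative_const bounded_linear_imp_has_derivative[OF L]])
  then show "dir_deriv E v (\<lambda>x. a + L x) x = L v" if "v \<in> E" "x \<in> W" for v x
    using dir_deriv_eq[OF E subsetD[OF openin_model_subset[OF E W] that(2)] that(1)] by force
qed

lemma smooth_on_Pair:
  fixes E W :: "'a::euclidean_space set" and s :: "'b::real_normed_vector"
  assumes E: "Real_Vector_Spaces.subspace E" and W: "openin (top_of_set E) W"
  shows "smooth_on E W (Pair s)" "smooth_on E W (\<lambda>t. (t, s))"
    and "\<And>v x. v \<in> E \<Longrightarrow> x \<in> W \<Longrightarrow> dir_deriv E v (Pair s) x = (0, v)"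
    and "\<And>v x. v \<in> E \<Longrightarrow> x \<in> W \<Longrightarrow> dir_deriv E v (\<lambda>t. (t, s)) x = (v, 0)"
proof -
  have *: "(\<lambda>x::'a. (s, 0) + (0, x)) = Pair s" "(\<lambda>x::'a. (0, s) + (x, 0)) = (\<lambda>x. (x, s))" by auto
  have **: "bounded_linear (\<lambda>x. (0, x))" "bounded_linear (\<lambda>x. (x, 0))"
    by (auto intro!: bounded_linear_Pair bounded_linear_ident bounded_linear_zero)
  show "smooth_on E W (Pair s)" "smooth_on E W (\<lambda>t. (t, s))"
    and "\<And>v x. v \<in> E \<Longrightarrow> x \<in> W \<Longrightarrow> dir_deriv E v (Pair s) x = (0, v)"
    and "\<And>v x. v \<in> E \<Longrightarrow> x \<in> W \<Longrightarrow> dir_deriv E v (\<lambda>t. (t, s)) x = (v, 0)"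
    using smooth_on_affine[OF E W **(1), where a="(s, 0)"] smooth_on_affine[OF E W **(2), where a="(0, s)"]
    unfolding * by blast+
qed

lemma openin_slice:
  assumes "openin (top_of_set (E \<times> F)) D"
  shows "s \<in> E \<Longrightarrow> openin (top_of_set F) {t. (s, t) \<in> D}" "t \<in> F \<Longrightarrow> openin (top_of_set E) {s. (s, t) \<in> D}"
proof -
  obtain T where T: "open T" "D = (E \<times> F) \<inter> T" using assms by (auto simp: openin_open)
  have "open (Pair s -` T)" "open ((\<lambda>s. (s, t)) -` T)"
    using T(1) by (auto intro!: open_vimage continuous_intros)
  then show "s \<in> E \<Longrightarrow> openin (top_of_set F) {t. (s, t) \<in> D}" "t \<in> F \<Longrightarrow> openin (top_of_set E) {s. (s, t) \<in> D}"
    unfolding openin_open T(2) by (auto intro!: exI[of _ "Pair s -` T"] exI[of _ "(\<lambda>s. (s, t)) -` T"])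
qed

section \<open>Smooth functions and left-invariant operators on a Lie group\<close>

context lie_group
begin

abbreviation E where "E \<equiv> model G"

lemmas subspace_prod = subspace_Times[OF subspace_model subspace_model]

lemma
  assumes c: "c \<in> atlas G"
  shows chart_dom_subset: "chart_dom c \<subseteq> carrier G"
    and chart_inv_map: "\<And>x. x \<in> chart_dom c \<Longrightarrow> chart_inv c (chart_map c x) = x"
    and chart_map_inv: "\<And>s. s \<in> chart_img c \<Longrightarrow> chart_map c (chart_inv c s) = s"
    and chart_inv_mem: "\<And>s. s \<in> chart_img c \<Longrightarrow> chart_inv c s \<in> chart_dom c"
    and chart_map_mem: "\<And>x. x \<in> chart_dom c \<Longrightarrow> chart_map c x \<in> chart_img c"
    and chart_img_subset: "chart_img c \<subseteq> E"
    and chart_map_continuous: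
      "continuous_map (subtopology (topo G) (chart_dom c)) (top_of_set (chart_img c)) (chart_map c)"
    and chart_inv_continuous: "continuous_map (top_of_set (chart_img c)) (topo G) (chart_inv c)"
proof -
  show d: "chart_dom c \<subseteq> carrier G" using atlas_cover c by blast
  show "chart_img c \<subseteq> E" using openin_subset[OF chart_img_open[OF c]] by simp
  note h = chart_homeo[OF c]
  have ts: "topspace (subtopology (topo G) (chart_dom c)) = chart_dom c"
    using d topspace_topo by (auto simp: topspace_subtopology)
  have inj: "inj_on (chart_map c) (chart_dom c)" using homeomorphic_imp_injective_map[OF h] ts by simp
  show i: "chart_inv c (chart_map c x) = x" if "x \<in> chart_dom c" for x
    using inv_into_f_f[OF inj that] by (simp add: chart_inv_def)
  show "chart_map c (chart_inv c s) = s" "chart_inv c s \<in> chart_dom c" if "s \<in> chart_img c" for s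
    using that by (simp_all add: chart_inv_def chart_img_def f_inv_into_f inv_into_into)
  show "chart_map c x \<in> chart_img c" if "x \<in> chart_dom c" for x
    using that by (simp add: chart_img_def)
  show "continuous_map (subtopology (topo G) (chart_dom c)) (top_of_set (chart_img c)) (chart_map c)"
    by (rule homeomorphic_imp_continuous_map[OF h])
  \<comment> \<open>\<open>chart_inv\<close> is an \<open>inv_into\<close>; its continuity comes
    from agreeing on the chart image with the inverse that the homeomorphism provides.\<close>
  obtain g where g: "homeomorphic_maps (subtopology (topo G) (chart_dom c)) (top_of_set (chart_img c)) (chart_map c) g"
    using h homeomorphic_map_maps by blast
  then have "continuous_map (top_of_set (chart_img c)) (topo G) g"
    by (auto simp: homeomorphic_maps_def continuous_map_in_subtopology)
  moreover have "g s = chart_inv c s" if "s \<in> chart_img c" for s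
    using that g i ts by (auto simp: homeomorphic_maps_def chart_img_def)
  ultimately show "continuous_map (top_of_set (chart_img c)) (topo G) (chart_inv c)"
    using continuous_map_eq[of "top_of_set (chart_img c)" "topo G" g "chart_inv c"] by simp
qed

lemma chart_inv_carrier: "c \<in> atlas G \<Longrightarrow> s \<in> chart_img c \<Longrightarrow> chart_inv c s \<in> carrier G"
  using chart_inv_mem chart_dom_subset by blast

lemma unit_chart: "unit_chart G \<in> atlas G" "\<one> \<in> chart_dom (unit_chart G)"
proof -
  have "\<exists>c. c \<in> atlas G \<and> \<one> \<in> chart_dom c" using atlas_cover one_closed by blast
  from someI_ex[OF this] show "unit_chart G \<in> atlas G" "\<one> \<in> chart_dom (unit_chart G)"
    unfolding unit_chart_def by auto
qed

abbreviation unit_coord where "unit_coord \<equiv> chart_map (unit_chart G) \<one>"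

lemmas unit_coord_mem = chart_map_mem[OF unit_chart]

lemma mult_domain_open:
  assumes "a \<in> atlas G" "b \<in> atlas G" "c \<in> atlas G"
  shows "openin (top_of_set (E \<times> E))
    {(s, t). s \<in> chart_img a \<and> t \<in> chart_img b \<and> chart_inv a s \<otimes> chart_inv b t \<in> chart_dom c}"
    (is "openin _ ?D")
proof -
  let ?X = "prod_topology (top_of_set (chart_img a)) (top_of_set (chart_img b))"
  have "continuous_map ?X (prod_topology (topo G) (topo G)) (\<lambda>z. (chart_inv a (fst z), chart_inv b (snd z)))"
    unfolding continuous_map_pairwise
    using continuous_map_compose[OF continuous_map_fst chart_inv_continuous[OF assms(1)],
        of "top_of_set (chart_img b)"]
      continuous_map_compose[OF continuous_map_snd chart_inv_continuous[OF assms(2)],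
        of "top_of_set (chart_img a)"]
    by (auto simp: o_def)
  from continuous_map_compose[OF this mult_continuous]
  have "continuous_map ?X (topo G) (\<lambda>z. chart_inv a (fst z) \<otimes> chart_inv b (snd z))"
    by (simp add: o_def)
  from openin_continuous_map_preimage[OF this chart_dom_open[OF assms(3)]]
  have "openin (top_of_set (chart_img a \<times> chart_img b)) ?D"
    by (simp add: prod_topology_subtopology_eu case_prod_beta' mem_Times_iff conj_assoc)
  moreover have "openin (top_of_set (E \<times> E)) (chart_img a \<times> chart_img b)"
    using chart_img_open assms by (simp add: openin_Times)
  ultimately show ?thesis by (rule openin_trans)
qed

lemma smooth_funsD: "f \<in> smooth_funs G \<Longrightarrow> c \<in> atlas G \<Longrightarrow> smooth_on E (chart_img c) (\<lambda>s. f (chart_inv c s))"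
  by (simp add: smooth_funs_def o_def)

lemma smooth_funsI:
  "(\<And>c. c \<in> atlas G \<Longrightarrow> smooth_on E (chart_img c) (\<lambda>s. f (chart_inv c s))) \<Longrightarrow> f \<in> smooth_funs G"
  by (simp add: smooth_funs_def o_def)

lemma smooth_funs_cong:
  assumes "f \<in> smooth_funs G" "\<And>x. x \<in> carrier G \<Longrightarrow> f x = g x"
  shows "g \<in> smooth_funs G"
proof (rule smooth_funsI)
  fix c assume c: "c \<in> atlas G"
  show "smooth_on E (chart_img c) (\<lambda>s. g (chart_inv c s))"
    by (rule smooth_on_cong[OF chart_img_open[OF c] _ smooth_funsD[OF assms(1) c]])
      (simp add: assms(2) chart_inv_carrier[OF c])
qed

lemma smooth_funs_const: "(\<lambda>_. a) \<in> smooth_funs G"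
  by (rule smooth_funsI, rule smooth_on_const[OF subspace_model chart_img_open])

lemma smooth_funs_add: "f \<in> smooth_funs G \<Longrightarrow> g \<in> smooth_funs G \<Longrightarrow> (\<lambda>x. f x + g x) \<in> smooth_funs G"
  by (rule smooth_funsI, rule smooth_on_add[OF subspace_model chart_img_open]) (simp_all add: smooth_funsD)

lemma smooth_funs_mult: "f \<in> smooth_funs G \<Longrightarrow> g \<in> smooth_funs G \<Longrightarrow> (\<lambda>x. f x * g x) \<in> smooth_funs G"
  by (rule smooth_funsI, rule smooth_on_mult[OF subspace_model chart_img_open]) (simp_all add: smooth_funsD)

lemma smooth_funs_cnj: "f \<in> smooth_funs G \<Longrightarrow> (\<lambda>x. cnj (f x)) \<in> smooth_funs G"
  by (rule smooth_funsI, rule smooth_on_linear[OF subspace_model chart_img_open bounded_linear_cnj])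
    (simp_all add: smooth_funsD)

lemma smooth_funs_sum:
  "(\<And>i. i \<in> I \<Longrightarrow> f i \<in> smooth_funs G) \<Longrightarrow> (\<lambda>x. \<Sum>i\<in>I. f i x) \<in> smooth_funs G"
  by (induction I rule: infinite_finite_induct) (auto intro: smooth_funs_const smooth_funs_add)

lemma smooth_funs_power: "f \<in> smooth_funs G \<Longrightarrow> (\<lambda>x. f x ^ k) \<in> smooth_funs G"
  by (induction k) (auto intro: smooth_funs_const smooth_funs_mult)

lemma smooth_funs_prod:
  "(\<And>i. i \<in> I \<Longrightarrow> f i \<in> smooth_funs G) \<Longrightarrow> (\<lambda>x. \<Prod>i\<in>I. f i x) \<in> smooth_funs G"
  by (induction I rule: infinite_finite_induct) (auto intro: smooth_funs_const smooth_funs_mult)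

text \<open>Differentiation acts on the right factor, so left translations pass through it. The list
  is applied as coordinate derivatives at a single point, not as a composition of left-invariant
  vector fields; this avoids lower-order corrections, and at the unit exactly
  \<open>dir_derivs\<close> in the unit chart appears.\<close>

definition left_inv_op :: "'e list \<Rightarrow> ('g \<Rightarrow> complex) \<Rightarrow> 'g \<Rightarrow> complex" where
  "left_inv_op vs f x = dir_derivs E vs (\<lambda>t. f (x \<otimes> chart_inv (unit_chart G) t)) unit_coord"

lemma left_invariant_left_inv_op: "left_invariant G (left_inv_op vs)"
  unfolding left_invariant_def left_inv_op_def
  by (intro ballI dir_derivs_local_cong[OF chart_img_open[OF unit_chart(1)] _ unit_coord_mem])
    (simp add: m_assoc chart_inv_carrier[OF unit_chart(1)])

lemma left_inv_op_one:
  "left_inv_op vs f \<one> = dir_derivs E vs (\<lambda>t. f (chart_inv (unit_chart G) t)) unit_coord"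
  unfolding left_inv_op_def
  by (intro dir_derivs_local_cong[OF chart_img_open[OF unit_chart(1)] _ unit_coord_mem])
    (simp add: chart_inv_carrier[OF unit_chart(1)])

text \<open>In a chart c the value at x is a derivative of f composed with the coordinate form \<mu>
  of the multiplication, taken in the second variable only. It is therefore a differential operator
  along \<mu>; on the slice where the second variable is the coordinate of the unit, \<mu> is the
  identity, and an operator in the chart c is left.\<close>

lemma diff_operator_left_inv_op:
  assumes vs: "set vs \<subseteq> E"
  shows "diff_operator G (length vs) (left_inv_op vs)"
  unfolding diff_operator_def
proof
  fix c assume c: "c \<in> atlas G"
  let ?e = "unit_chart G"
  define D where "D = {(s, t). s \<in> chart_img c \<and> t \<in> chart_img ?e \<and> chart_inv c s \<otimes> chart_inv ?e t \<in> chart_dom c}"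
  define \<mu> where "\<mu> = (\<lambda>(s, t). chart_map c (chart_inv c s \<otimes> chart_inv ?e t))"
  have D: "openin (top_of_set (E \<times> E)) D"
    unfolding D_def by (rule mult_domain_open[OF c unit_chart(1) c])
  have \<mu>: "smooth_on (E \<times> E) D \<mu>"
    unfolding D_def \<mu>_def by (rule mult_smooth[OF c unit_chart(1) c])
  have \<mu>D: "\<mu> ` D \<subseteq> chart_img c" unfolding D_def \<mu>_def by (auto intro: chart_map_mem[OF c])
  note V = chart_img_open[OF c]
  note ctx = subspace_model V subspace_prod D \<mu> \<mu>D
  have "jet_op E (chart_img c) (E \<times> E) D \<mu> 0 (\<lambda>f z. f (\<mu> z))"
    using jet_op_single[OF ctx, of "[]" 0 "\<lambda>_. 1"] by (simp add: smooth_on_const[OF subspace_prod D])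
  \<comment> \<open>Directions (0, v) leave the first variable as a parameter, in which the
    coefficients remain smooth.\<close>
  from jet_op_dir_derivs[OF ctx this, of "map (Pair 0) vs"]
  have "jet_op E (chart_img c) (E \<times> E) D \<mu> (length vs) (\<lambda>f z. dir_derivs (E \<times> E) (map (Pair 0) vs) (\<lambda>z. f (\<mu> z)) z)"
    using vs Real_Vector_Spaces.subspace_0[OF subspace_model] by auto
  then obtain L a where L: "finite L" "\<forall>w\<in>L. set w \<subseteq> E \<and> length w \<le> length vs \<and> smooth_on (E \<times> E) D (a w)"
    and T: "\<forall>f::'e \<Rightarrow> complex. smooth_on E (chart_img c) f \<longrightarrow> (\<forall>z\<in>D.
      dir_derivs (E \<times> E) (map (Pair 0) vs) (\<lambda>z. f (\<mu> z)) z = (\<Sum>w\<in>L. a w z * dir_derivs E w f (\<mu> z)))"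
    unfolding jet_op_def by (elim exE conjE) (rule that)
  note L = L(1) bspec[OF L(2)] and T = bspec[OF mp[OF spec[OF T]]]
  have mem: "(s, unit_coord) \<in> D" if "s \<in> chart_img c" for s
    using that unit_coord_mem chart_inv_mem[OF c that] chart_inv_carrier[OF c that]
    by (simp add: D_def chart_inv_map[OF unit_chart])
  show "\<exists>L a. finite L \<and>
     (\<forall>vsa\<in>L. set vsa \<subseteq> E \<and> length vsa \<le> length vs \<and> smooth_on E (chart_img c) (a vsa)) \<and>
     (\<forall>f\<in>smooth_funs G. \<forall>x\<in>chart_dom c.
        left_inv_op vs f x = (\<Sum>vs\<in>L. a vs (chart_map c x) * dir_derivs E vs (f \<circ> chart_inv c) (chart_map c x)))"
  proof (intro exI[of _ L] exI[of _ "\<lambda>w s. a w (s, unit_coord)"] conjI ballI)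
    show "finite L" by (rule L(1))
    fix w assume w: "w \<in> L"
    show "set w \<subseteq> E" "length w \<le> length vs" using L(2)[OF w] by auto
    show "smooth_on E (chart_img c) (\<lambda>s. a w (s, unit_coord))"
      by (rule smooth_on_compose[OF subspace_model V subspace_prod D smooth_on_Pair(2)[OF subspace_model V]])
        (use L(2)[OF w] mem in auto)
  next
    fix f x assume f: "f \<in> smooth_funs G" and x: "x \<in> chart_dom c"
    define s where "s = chart_map c x"
    have s: "s \<in> chart_img c" "chart_inv c s = x"
      using chart_map_mem[OF c x] chart_inv_map[OF c x] by (auto simp: s_def)
    have sE: "s \<in> E" using chart_img_subset[OF c] s(1) by blast
    define W where "W = {t. (s, t) \<in> D}"
    have W: "openin (top_of_set E) W" "unit_coord \<in> W"
      using openin_slice(1)[OF D sE] mem[OF s(1)] by (auto simp: W_def)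
    have sf: "smooth_on (E \<times> E) D (\<lambda>z. f (chart_inv c (\<mu> z)))"
      by (rule smooth_on_compose[OF subspace_prod D subspace_model V \<mu> \<mu>D smooth_funsD[OF f c]])
    have "left_inv_op vs f x = dir_derivs E vs (\<lambda>t. f (chart_inv c (\<mu> (s, t)))) unit_coord"
      unfolding left_inv_op_def
      by (rule dir_derivs_local_cong[OF W(1) _ W(2)])
        (auto simp: W_def D_def \<mu>_def s(2) chart_inv_map[OF c])
    also have "\<dots> = dir_derivs (E \<times> E) (map (Pair 0) vs) (\<lambda>z. f (chart_inv c (\<mu> z))) (s, unit_coord)"
      by (rule dir_derivs_affine[OF subspace_model W(1) subspace_prod D smooth_on_Pair(1)[OF subspace_model W(1)]
            _ smooth_on_Pair(3)[OF subspace_model W(1)] _ sf W(2) vs])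
        (auto simp: W_def Real_Vector_Spaces.subspace_0[OF subspace_model])
    also have "\<dots> = (\<Sum>w\<in>L. a w (s, unit_coord) * dir_derivs E w (f \<circ> chart_inv c) (\<mu> (s, unit_coord)))"
      using T[OF smooth_funsD[OF f c] mem[OF s(1)]] by (simp add: o_def)
    \<comment> \<open>Multiplication by the unit: the derivatives of f are taken at the coordinate
      of x itself.\<close>
    also have "\<mu> (s, unit_coord) = s"
      using chart_inv_carrier[OF c s(1)] chart_map_inv[OF c s(1)] by (simp add: \<mu>_def chart_inv_map[OF unit_chart])
    finally show "left_inv_op vs f x = (\<Sum>w\<in>L. a w (chart_map c x, unit_coord) *
        dir_derivs E w (f \<circ> chart_inv c) (chart_map c x))" by (simp add: s_def o_def)
  qed
qed

text \<open>One direction tests q against \<open>left_inv_op\<close>, which realises every list of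
  chart derivatives at the unit. For the other, an operator of order m < k expanded in the unit
  chart involves only lists of length at most m, each of which gives 0.\<close>

lemma vanishes_of_order_iff_flat:
  assumes q: "q \<in> smooth_funs G"
  shows "vanishes_of_order G k q \<longleftrightarrow> flat_at E unit_coord k (\<lambda>t. q (chart_inv (unit_chart G) t))"
proof
  assume v: "vanishes_of_order G k q"
  show "flat_at E unit_coord k (\<lambda>t. q (chart_inv (unit_chart G) t))"
    unfolding flat_at_def
  proof (intro allI impI)
    fix vs assume vs: "set vs \<subseteq> E" "length vs < k"
    then have "left_inv_op vs q \<one> = 0"
      using v diff_operator_left_inv_op[OF vs(1)] left_invariant_left_inv_op unfolding vanishes_of_order_def by blast
    then show "dir_derivs E vs (\<lambda>t. q (chart_inv (unit_chart G) t)) unit_coord = 0"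
      by (simp add: left_inv_op_one)
  qed
next
  assume fl: "flat_at E unit_coord k (\<lambda>t. q (chart_inv (unit_chart G) t))"
  show "vanishes_of_order G k q"
    unfolding vanishes_of_order_def
  proof (intro allI impI)
    fix m P assume m: "m < k" and P: "diff_operator G m P"
    obtain L a where L: "\<And>w. w \<in> L \<Longrightarrow> set w \<subseteq> E \<and> length w \<le> m \<and> smooth_on E (chart_img (unit_chart G)) (a w)"
      and Pf: "\<And>f x. f \<in> smooth_funs G \<Longrightarrow> x \<in> chart_dom (unit_chart G) \<Longrightarrow> P f x =
        (\<Sum>w\<in>L. a w (chart_map (unit_chart G) x) *
          dir_derivs E w (f \<circ> chart_inv (unit_chart G)) (chart_map (unit_chart G) x))"
      using P unit_chart(1) by (rule diff_operatorE) (rule that)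
    have "dir_derivs E w (q \<circ> chart_inv (unit_chart G)) unit_coord = 0" if "w \<in> L" for w
      using fl L[OF that] m unfolding flat_at_def o_def by auto
    then show "P q \<one> = 0" using Pf[OF q unit_chart(2)] by simp
  qed
qed

text \<open>The Leibniz rule, obtained from closure of \<open>jet_op\<close> along the identity map,
  started at f \<mapsto> q f. It provides the seminorms that bound a distribution multiplied by
  q.\<close>

lemma diff_operator_mult:
  assumes P: "diff_operator G m P" and q: "q \<in> smooth_funs G"
  shows "diff_operator G m (\<lambda>f. P (\<lambda>x. q x * f x))"
  unfolding diff_operator_def
proof
  fix c assume c: "c \<in> atlas G"
  note V = chart_img_open[OF c]
  note ctx = subspace_model V subspace_model V smooth_on_ident[OF subspace_model V]
  let ?V = "chart_img c"
  have id: "(\<lambda>x. x) ` ?V \<subseteq> ?V" by simp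
  let ?q = "\<lambda>s. q (chart_inv c s)"
  note qs = smooth_funsD[OF q c]
  obtain L a where L: "finite L" "\<And>w. w \<in> L \<Longrightarrow> set w \<subseteq> E \<and> length w \<le> m \<and> smooth_on E ?V (a w)"
    and Pf: "\<And>f x. f \<in> smooth_funs G \<Longrightarrow> x \<in> chart_dom c \<Longrightarrow>
      P f x = (\<Sum>w\<in>L. a w (chart_map c x) * dir_derivs E w (f \<circ> chart_inv c) (chart_map c x))"
    using P c by (rule diff_operatorE) (rule that)
  have j0: "jet_op E ?V E ?V (\<lambda>x. x) 0 (\<lambda>f z. ?q z * f z)"
    using jet_op_single[OF ctx id, of "[]" 0 ?q] qs by simp
  have "jet_op E ?V E ?V (\<lambda>x. x) m (\<lambda>f z. \<Sum>w\<in>L. a w z * dir_derivs E w (\<lambda>s. ?q s * f s) z)"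
  proof (intro jet_op_sum[OF ctx id] jet_op_mult[OF ctx id])
    fix w assume w: "w \<in> L"
    show "smooth_on E ?V (a w)" using L(2)[OF w] by blast
    have "jet_op E ?V E ?V (\<lambda>x. x) (length w) (\<lambda>f. dir_derivs E w (\<lambda>s. ?q s * f s))"
      using jet_op_dir_derivs[OF ctx id j0, of w] L(2)[OF w] by simp
    then show "jet_op E ?V E ?V (\<lambda>x. x) m (\<lambda>f. dir_derivs E w (\<lambda>s. ?q s * f s))"
      by (rule jet_op_mono[OF ctx id]) (use L(2)[OF w] in blast)
  qed
  then obtain M b where M: "finite M" "\<forall>w\<in>M. set w \<subseteq> E \<and> length w \<le> m \<and> smooth_on E ?V (b w)"
    and T: "\<forall>f::'e \<Rightarrow> complex. smooth_on E ?V f \<longrightarrow> (\<forall>z\<in>?V.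
      (\<Sum>w\<in>L. a w z * dir_derivs E w (\<lambda>s. ?q s * f s) z) = (\<Sum>w\<in>M. b w z * dir_derivs E w f z))"
    unfolding jet_op_def by (elim exE conjE) (rule that)
  note T = bspec[OF mp[OF spec[OF T]]]
  have "P (\<lambda>x. q x * f x) x = (\<Sum>w\<in>M. b w (chart_map c x) * dir_derivs E w (f \<circ> chart_inv c) (chart_map c x))"
    if f: "f \<in> smooth_funs G" and x: "x \<in> chart_dom c" for f x
    using Pf[OF smooth_funs_mult[OF q f] x] T[OF smooth_funsD[OF f c] chart_map_mem[OF c x]]
    by (simp add: o_def)
  then show "\<exists>L a. finite L \<and>
     (\<forall>vs\<in>L. set vs \<subseteq> E \<and> length vs \<le> m \<and> smooth_on E ?V (a vs)) \<and>
     (\<forall>f\<in>smooth_funs G. \<forall>x\<in>chart_dom c. P (\<lambda>x. q x * f x) x =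
        (\<Sum>vs\<in>L. a vs (chart_map c x) * dir_derivs E vs (f \<circ> chart_inv c) (chart_map c x)))"
    using M by (intro exI[of _ M] exI[of _ b]) simp
qed

end

section \<open>Continuity and Haar integration\<close>

lemma continuous_map_locally:
  assumes "\<And>x. x \<in> topspace X \<Longrightarrow> \<exists>U. openin X U \<and> x \<in> U \<and> continuous_map (subtopology X U) Y f"
  shows "continuous_map X Y f"
proof -
  obtain U where "\<And>x. x \<in> topspace X \<Longrightarrow> openin X (U x) \<and> x \<in> U x \<and> continuous_map (subtopology X (U x)) Y f"
    using assms by metis
  then show ?thesis by (intro pasting_lemma[of "topspace X" X U Y "\<lambda>_. f"]) auto
qed

lemma continuous_map_compose_on:
  "continuous_map X (top_of_set S) f \<Longrightarrow> continuous_on S g \<Longrightarrow> continuous_map X euclidean (\<lambda>x. g (f x))"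
  using continuous_map_compose[of X "top_of_set S" f euclidean g] by (simp add: o_def)

lemma continuous_map_mult:
  fixes f g :: "'x \<Rightarrow> 'a::real_normed_algebra"
  assumes "continuous_map X euclidean f" "continuous_map X euclidean g"
  shows "continuous_map X euclidean (\<lambda>x. f x * g x)"
proof -
  have "continuous_map X euclidean (\<lambda>x. (f x, g x))"
    unfolding prod_topology_euclidean[symmetric] continuous_map_pairwise using assms by (simp add: o_def)
  then have "continuous_map X (top_of_set UNIV) (\<lambda>x. (f x, g x))" by simp
  moreover have "continuous_on UNIV (\<lambda>z::'a \<times> 'a. fst z * snd z)" by (intro continuous_intros)
  ultimately show ?thesis using continuous_map_compose_on[of X UNIV "\<lambda>x. (f x, g x)" "\<lambda>z. fst z * snd z"] by simp
qed

text \<open>Being smooth near every point of W passes from f to \<open>dir_deriv E v f\<close>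
  itself, and differentiability is tested point by point, so coinduction applies to this
  class.\<close>

lemma smooth_on_locally:
  assumes W: "openin (top_of_set E) W"
    and loc: "\<And>x. x \<in> W \<Longrightarrow> \<exists>U. openin (top_of_set E) U \<and> x \<in> U \<and> smooth_on E U f"
  shows "smooth_on E W f"
proof -
  define S where "S f \<longleftrightarrow> (\<forall>x\<in>W. \<exists>U. x \<in> U \<and> smooth_on E U f)" for f :: "'a \<Rightarrow> 'b"
  have d: "f differentiable (at x within E)" if S: "S f" "x \<in> W" for f x
  proof -
    obtain U where "x \<in> U" "smooth_on E U f" using S unfolding S_def by auto
    then show ?thesis by (intro smooth_on_differentiable)
  qed
  have s: "S (dir_deriv E v f)" if S: "S f" "v \<in> E" for f v
    unfolding S_def
  proof
    fix x assume "x \<in> W"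
    then obtain U where "x \<in> U" "smooth_on E U f" using S(1) unfolding S_def by auto
    then show "\<exists>U. x \<in> U \<and> smooth_on E U (dir_deriv E v f)"
      using smooth_on_dir_deriv[OF _ S(2)] by (intro exI[of _ U]) simp
  qed
  show ?thesis
  proof (rule smooth_on_coinduct[OF W, of S])
    show "S f" unfolding S_def using loc by metis
    show "\<exists>g. S g \<and> (\<forall>x\<in>W. dir_deriv E v f x = g x)" if "S f" "v \<in> E" for f v
      using s[OF that] by (intro exI[of _ "dir_deriv E v f"]) simp
  qed (rule d)
qed

context lie_group
begin

lemma chart_at:
  assumes "x \<in> carrier G"
  obtains c where "c \<in> atlas G" "x \<in> chart_dom c"
  using assms atlas_cover by blast

lemma continuous_map_charts:
  assumes "\<And>c. c \<in> atlas G \<Longrightarrow> continuous_on (chart_img c) (\<lambda>s. f (chart_inv c s))"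
  shows "continuous_map (topo G) euclidean f"
proof (rule continuous_map_locally)
  fix x assume "x \<in> topspace (topo G)"
  then obtain c where c: "c \<in> atlas G" "x \<in> chart_dom c" using chart_at by (auto simp: topspace_topo)
  have "continuous_map (subtopology (topo G) (chart_dom c)) euclidean (\<lambda>x. f (chart_inv c (chart_map c x)))"
    by (rule continuous_map_compose_on[OF chart_map_continuous[OF c(1)] assms[OF c(1)]])
  then have "continuous_map (subtopology (topo G) (chart_dom c)) euclidean f"
    by (rule continuous_map_eq) (simp add: chart_inv_map[OF c(1)])
  then show "\<exists>U. openin (topo G) U \<and> x \<in> U \<and> continuous_map (subtopology (topo G) U) euclidean f"
    using chart_dom_open[OF c(1)] c(2) by blast
qed

lemma smooth_funs_continuous: "f \<in> smooth_funs G \<Longrightarrow> continuous_map (topo G) euclidean f"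
  by (rule continuous_map_charts, rule smooth_on_continuous_on, rule smooth_funsD)

lemma diff_operator_continuous:
  assumes P: "diff_operator G m P" and f: "f \<in> smooth_funs G"
  shows "continuous_map (topo G) euclidean (P f)"
proof (rule continuous_map_charts)
  fix c assume c: "c \<in> atlas G"
  obtain L a where L: "finite L"
    "\<And>w. w \<in> L \<Longrightarrow> set w \<subseteq> E \<and> length w \<le> m \<and> smooth_on E (chart_img c) (a w)"
    and Pf: "\<And>f x. f \<in> smooth_funs G \<Longrightarrow> x \<in> chart_dom c \<Longrightarrow> P f x =
       (\<Sum>w\<in>L. a w (chart_map c x) * dir_derivs E w (f \<circ> chart_inv c) (chart_map c x))"
    using P c by (rule diff_operatorE) (rule that)
  have "continuous_on (chart_img c) (\<lambda>s. \<Sum>w\<in>L. a w s * dir_derivs E w (\<lambda>s. f (chart_inv c s)) s)"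
    using L(2) by (intro continuous_on_sum continuous_on_mult smooth_on_continuous_on[of E]
        smooth_on_dir_derivs smooth_funsD[OF f c]) auto
  then show "continuous_on (chart_img c) (\<lambda>s. P f (chart_inv c s))"
    by (rule continuous_on_eq)
      (simp add: Pf[OF f] chart_inv_mem[OF c] chart_map_inv[OF c] o_def)
qed

lemma left_translation_continuous:
  assumes "g \<in> carrier G"
  shows "continuous_map (topo G) (topo G) (\<lambda>x. g \<otimes> x)"
proof -
  have "continuous_map (topo G) (prod_topology (topo G) (topo G)) (\<lambda>x. (g, x))"
    using assms by (simp add: continuous_map_pairwise o_def topspace_topo)
  from continuous_map_compose[OF this mult_continuous] show ?thesis by (simp add: o_def)
qed

end

section \<open>Boundedness, distributions and Haar measure on the compact group\<close>

context compact_lie_group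
begin

lemma continuous_bounded:
  fixes f :: "_ \<Rightarrow> 'z::real_normed_vector"
  assumes "continuous_map (topo G) euclidean f"
  obtains B where "B > 0" "\<And>x. x \<in> carrier G \<Longrightarrow> norm (f x) \<le> B"
proof -
  have "compactin (topo G) (carrier G)" using compact_topo topspace_topo by (simp add: compact_space_def)
  from image_compactin[OF this assms] have "bounded (f ` carrier G)" by (simp add: compact_imp_bounded)
  then show thesis using that unfolding bounded_pos by auto
qed

text \<open>A real supremum is meaningful only for a set bounded above; compactness bounds the
  continuous function P f.\<close>

lemma SUP_diff_operator_nonneg:
  assumes "diff_operator G m P" "f \<in> smooth_funs G"
  shows "0 \<le> (SUP x\<in>carrier G. cmod (P f x))"
proof -
  obtain B where "\<And>x. x \<in> carrier G \<Longrightarrow> cmod (P f x) \<le> B"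
    using continuous_bounded[OF diff_operator_continuous[OF assms]] by metis
  then have "bdd_above ((\<lambda>x. cmod (P f x)) ` carrier G)" by (rule bdd_aboveI2)
  from cSUP_upper2[OF this one_closed, of 0] show ?thesis by simp
qed

lemma dist_mult_distributions:
  assumes u: "u \<in> distributions G" and q: "q \<in> smooth_funs G"
  shows "dist_mult q u \<in> distributions G"
proof -
  define S where "S P f = (SUP x\<in>carrier G. cmod (P f x))" for P :: "('a \<Rightarrow> complex) \<Rightarrow> 'a \<Rightarrow> complex" and f
  obtain \<P> C where P: "finite \<P>" "\<forall>P\<in>\<P>. \<exists>m. diff_operator G m P"
    "\<forall>f\<in>smooth_funs G. cmod (u f) \<le> C * (\<Sum>P\<in>\<P>. S P f)"
    using u unfolding distributions_def S_def by blast
  have add: "u (\<lambda>x. f x + g x) = u f + u g" if "f \<in> smooth_funs G" "g \<in> smooth_funs G" for f g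
    using u that unfolding distributions_def by blast
  have scale: "u (\<lambda>x. a * f x) = a * u f" if "f \<in> smooth_funs G" for f a
    using u that unfolding distributions_def by blast
  define h where "h P = (\<lambda>f. P (\<lambda>x. q x * f x))" for P :: "('a \<Rightarrow> complex) \<Rightarrow> 'a \<Rightarrow> complex"
  have hP: "\<exists>m. diff_operator G m (h P)" if "P \<in> \<P>" for P
    using diff_operator_mult[OF _ q] P(2) that unfolding h_def by blast
  have nonneg: "0 \<le> S (h P) f" if "P \<in> \<P>" "f \<in> smooth_funs G" for P f
    using hP[OF that(1)] SUP_diff_operator_nonneg[OF _ that(2)] unfolding S_def by blast
  \<comment> \<open>The map h may identify several operators, so a sum over \<P> is not a sum over
    its image. Each summand is instead bounded by the whole sum over the image, which costs the
    factor \<open>card \<P>\<close>. The absolute value covers a negative C.\<close>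
  have "cmod (dist_mult q u f) \<le> (\<bar>C\<bar> * card \<P>) * (\<Sum>P\<in>h ` \<P>. S P f)" if f: "f \<in> smooth_funs G" for f
  proof -
    have "cmod (dist_mult q u f) \<le> C * (\<Sum>P\<in>\<P>. S P (\<lambda>x. q x * f x))"
      using P(3) smooth_funs_mult[OF q f] unfolding dist_mult_def by blast
    also have "(\<Sum>P\<in>\<P>. S P (\<lambda>x. q x * f x)) = (\<Sum>P\<in>\<P>. S (h P) f)"
      by (simp add: S_def h_def)
    also have "C * \<dots> \<le> \<bar>C\<bar> * (\<Sum>P\<in>\<P>. S (h P) f)"
      using nonneg[OF _ f] by (intro mult_right_mono sum_nonneg) auto
    also have "\<dots> \<le> \<bar>C\<bar> * (\<Sum>P\<in>\<P>. \<Sum>P\<in>h ` \<P>. S P f)"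
      using nonneg[OF _ f] P(1) by (intro mult_left_mono sum_mono member_le_sum) auto
    finally show ?thesis by simp
  qed
  then have "finite (h ` \<P>) \<and> (\<forall>P\<in>h ` \<P>. \<exists>m. diff_operator G m P) \<and>
      (\<forall>f\<in>smooth_funs G. cmod (dist_mult q u f) \<le> (\<bar>C\<bar> * card \<P>) *
        (\<Sum>P\<in>h ` \<P>. SUP x\<in>carrier G. cmod (P f x)))"
    using P(1) hP by (simp add: S_def)
  moreover have "dist_mult q u (\<lambda>x. f x + g x) = dist_mult q u f + dist_mult q u g"
    if "f \<in> smooth_funs G" "g \<in> smooth_funs G" for f g
    using add[OF smooth_funs_mult[OF q that(1)] smooth_funs_mult[OF q that(2)]]
    by (simp add: dist_mult_def distrib_left)
  moreover have "dist_mult q u (\<lambda>x. a * f x) = a * dist_mult q u f" if "f \<in> smooth_funs G" for f a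
    using scale[OF smooth_funs_mult[OF q that]] by (simp add: dist_mult_def mult.left_commute)
  ultimately show ?thesis unfolding distributions_def by blast
qed

text \<open>Linearity is available for smooth summands only. Applied to products of multipliers with
  matrix entries, this is what makes the smoothness of the entries indispensable.\<close>

lemma distribution_sum:
  assumes u: "u \<in> distributions G" and "finite I" "\<And>i. i \<in> I \<Longrightarrow> f i \<in> smooth_funs G"
  shows "u (\<lambda>x. \<Sum>i\<in>I. a i * f i x) = (\<Sum>i\<in>I. a i * u (f i))"
  using assms(2,3)
proof (induction I rule: finite_induct)
  case empty
  \<comment> \<open>The value at the zero function comes from homogeneity, scaling a constant
    function by 0.\<close>
  have "\<forall>a. \<forall>f\<in>smooth_funs G. u (\<lambda>x. a * f x) = a * u f" using u unfolding distributions_def by simp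
  from bspec[OF spec[OF this, of 0] smooth_funs_const[of 0]] show ?case by simp
next
  case (insert i I)
  have "u (\<lambda>x. a i * f i x + (\<Sum>i\<in>I. a i * f i x)) = u (\<lambda>x. a i * f i x) + u (\<lambda>x. \<Sum>i\<in>I. a i * f i x)"
    using u insert.prems
      smooth_funs_mult[OF smooth_funs_const, of "f i" "a i"]
      smooth_funs_sum[of I "\<lambda>i x. a i * f i x"] smooth_funs_mult[OF smooth_funs_const, of "f _" "a _"]
    unfolding distributions_def by simp
  also have "u (\<lambda>x. a i * f i x) = a i * u (f i)"
    using u insert.prems unfolding distributions_def by simp
  finally show ?case using insert by simp
qed

lemma finite_measure_haar: "finite_measure (haar G)"
  by (rule finite_measureI) (simp add: space_haar haar_normalized)

lemma measure_haar: "measure (haar G) (space (haar G)) = 1"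
  by (simp add: measure_def space_haar haar_normalized)

lemma open_in_sets_haar: "openin (topo G) U \<Longrightarrow> U \<in> sets (haar G)"
  by (simp add: sets_haar sigma_sets.Basic)

lemma continuous_measurable:
  fixes f :: "_ \<Rightarrow> 'z::topological_space"
  assumes "continuous_map (topo G) euclidean f"
  shows "f \<in> borel_measurable (haar G)"
proof (rule borel_measurableI)
  fix S :: "'z set" assume "open S"
  then have "openin (topo G) {x \<in> topspace (topo G). f x \<in> S}"
    using openin_continuous_map_preimage[OF assms, of S] by simp
  moreover have "{x \<in> topspace (topo G). f x \<in> S} = f -` S \<inter> space (haar G)"
    by (auto simp: topspace_topo space_haar)
  ultimately show "f -` S \<inter> space (haar G) \<in> sets (haar G)" using open_in_sets_haar by simp
qed

lemma continuous_integrable: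
  fixes f :: "_ \<Rightarrow> 'z::{banach,second_countable_topology}"
  assumes "continuous_map (topo G) euclidean f"
  shows "integrable (haar G) f"
proof -
  obtain B where "\<And>x. x \<in> carrier G \<Longrightarrow> norm (f x) \<le> B" using continuous_bounded[OF assms] by metis
  then show ?thesis
    by (intro finite_measure.integrable_const_bound[OF finite_measure_haar, of _ B]
        continuous_measurable[OF assms] AE_I2) (simp add: space_haar)
qed

lemma norm_haar_integral_le:
  fixes f :: "_ \<Rightarrow> 'z::{banach,second_countable_topology}"
  assumes "continuous_map (topo G) euclidean f" "\<And>x. x \<in> carrier G \<Longrightarrow> norm (f x) \<le> C"
  shows "norm (LINT x|haar G. f x) \<le> C"
proof -
  have "norm (LINT x|haar G. f x) \<le> (LINT x|haar G. norm (f x))"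
    by (rule integral_norm_bound)
  also have "\<dots> \<le> (LINT x|haar G. C)"
    by (rule integral_mono[OF integrable_norm[OF continuous_integrable[OF assms(1)]]
          finite_measure.integrable_const[OF finite_measure_haar]])
      (simp add: space_haar assms(2))
  also have "\<dots> = C" by (simp add: measure_haar)
  finally show ?thesis .
qed

text \<open>Invariance is assumed for images of sets under translations, whereas
  \<open>distr\<close> uses preimages: the preimage under translation by g is the image under
  translation by its inverse.\<close>

lemma haar_translate:
  assumes g: "g \<in> carrier G"
  shows "distr (haar G) (haar G) (\<lambda>x. g \<otimes> x) = haar G"
    and "(\<lambda>x. g \<otimes> x) \<in> measurable (haar G) (haar G)"
proof -
  show m: "(\<lambda>x. g \<otimes> x) \<in> measurable (haar G) (haar G)"
  proof (rule measurable_sigma_sets[OF sets_haar])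
    show "{U. openin (topo G) U} \<subseteq> Pow (carrier G)" using openin_subset topspace_topo by auto
    show "(\<lambda>x. g \<otimes> x) \<in> space (haar G) \<rightarrow> carrier G" using g by (auto simp: space_haar)
    fix U assume "U \<in> {U. openin (topo G) U}"
    then have "openin (topo G) {x \<in> topspace (topo G). g \<otimes> x \<in> U}"
      using openin_continuous_map_preimage[OF left_translation_continuous[OF g]] by auto
    moreover have "{x \<in> topspace (topo G). g \<otimes> x \<in> U} = (\<lambda>x. g \<otimes> x) -` U \<inter> space (haar G)"
      by (auto simp: topspace_topo space_haar)
    ultimately show "(\<lambda>x. g \<otimes> x) -` U \<inter> space (haar G) \<in> sets (haar G)" using open_in_sets_haar by simp
  qed
  show "distr (haar G) (haar G) (\<lambda>x. g \<otimes> x) = haar G"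
  proof (rule measure_eqI)
    fix B assume "B \<in> sets (distr (haar G) (haar G) (\<lambda>x. g \<otimes> x))"
    then have B: "B \<in> sets (haar G)" by simp
    then have Bc: "B \<subseteq> carrier G" using sets.sets_into_space space_haar by blast
    have "(\<lambda>x. g \<otimes> x) -` B \<inter> space (haar G) = (\<lambda>y. inv g \<otimes> y) ` B"
    proof (intro subset_antisym subsetI)
      fix x assume "x \<in> (\<lambda>x. g \<otimes> x) -` B \<inter> space (haar G)"
      then have "g \<otimes> x \<in> B" "x \<in> space (haar G)" by auto
      moreover from this have "x = inv g \<otimes> (g \<otimes> x)"
        using g by (simp add: space_haar m_assoc[symmetric])
      ultimately show "x \<in> (\<lambda>y. inv g \<otimes> y) ` B" by blast
    next
      fix x assume "x \<in> (\<lambda>y. inv g \<otimes> y) ` B"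
      then obtain y where y: "y \<in> B" "x = inv g \<otimes> y" by blast
      then have "g \<otimes> (inv g \<otimes> y) = y" "inv g \<otimes> y \<in> carrier G" using g Bc by (auto simp: m_assoc[symmetric])
      then show "x \<in> (\<lambda>x. g \<otimes> x) -` B \<inter> space (haar G)" using y by (simp add: space_haar)
    qed
    then show "emeasure (distr (haar G) (haar G) (\<lambda>x. g \<otimes> x)) B = emeasure (haar G) B"
      using emeasure_distr[OF m B] haar_left_invariant[OF inv_closed[OF g] B] by simp
  qed simp
qed

lemma haar_integral_translate:
  fixes f :: "_ \<Rightarrow> 'z::{banach,second_countable_topology}"
  assumes g: "g \<in> carrier G" and f: "continuous_map (topo G) euclidean f"
  shows "(LINT x|haar G. f (g \<otimes> x)) = (LINT x|haar G. f x)"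
  using integral_distr[OF haar_translate(2)[OF g] continuous_measurable[OF f]] haar_translate(1)[OF g] by simp

text \<open>By compactness finitely many left translates of U cover the group, and all have the
  measure of U. If that were 0, the total mass would be 0 instead of 1.\<close>

lemma haar_open_pos:
  assumes U: "openin (topo G) U" and one: "\<one> \<in> U"
  shows "measure (haar G) U > 0"
proof (rule ccontr)
  assume "\<not> measure (haar G) U > 0"
  then have "measure (haar G) U = 0" using zero_less_measure_iff by blast
  then have z: "emeasure (haar G) U = 0"
    using finite_measure.emeasure_eq_measure[OF finite_measure_haar] by simp
  have Uc: "U \<subseteq> carrier G" using openin_subset[OF U] topspace_topo by simp
  define \<U> where "\<U> = (\<lambda>g. (\<lambda>x. g \<otimes> x) ` U) ` carrier G"
  have op: "openin (topo G) ((\<lambda>x. g \<otimes> x) ` U)" if g: "g \<in> carrier G" for g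
  proof -
    have "(\<lambda>x. g \<otimes> x) ` U = {x \<in> topspace (topo G). inv g \<otimes> x \<in> U}"
    proof (intro subset_antisym subsetI)
      fix z assume "z \<in> (\<lambda>x. g \<otimes> x) ` U"
      then obtain x where x: "x \<in> U" "z = g \<otimes> x" by blast
      then have "inv g \<otimes> (g \<otimes> x) = x" "g \<otimes> x \<in> carrier G" using g Uc by (auto simp: m_assoc[symmetric])
      then show "z \<in> {x \<in> topspace (topo G). inv g \<otimes> x \<in> U}" using x by (simp add: topspace_topo)
    next
      fix x assume "x \<in> {x \<in> topspace (topo G). inv g \<otimes> x \<in> U}"
      then have "x \<in> topspace (topo G)" "inv g \<otimes> x \<in> U" by auto
      moreover from this have "x = g \<otimes> (inv g \<otimes> x)" using g by (simp add: topspace_topo m_assoc[symmetric])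
      ultimately show "x \<in> (\<lambda>x. g \<otimes> x) ` U" by blast
    qed
    then show ?thesis
      using openin_continuous_map_preimage[OF left_translation_continuous[OF inv_closed[OF g]] U] by simp
  qed
  have cov: "carrier G \<subseteq> \<Union>\<U>"
  proof
    fix g assume g: "g \<in> carrier G"
    then have "g = g \<otimes> \<one>" by simp
    then show "g \<in> \<Union>\<U>" using g one unfolding \<U>_def by blast
  qed
  have "compactin (topo G) (carrier G)" using compact_topo topspace_topo by (simp add: compact_space_def)
  moreover have "\<forall>U\<in>\<U>. openin (topo G) U" using op by (auto simp: \<U>_def)
  ultimately obtain \<F> where F: "finite \<F>" "\<F> \<subseteq> \<U>" "carrier G \<subseteq> \<Union>\<F>"
    using cov unfolding compactin_def by metis
  have null: "emeasure (haar G) A = 0" if "A \<in> \<F>" for A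
    using that F(2) z haar_left_invariant[OF _ open_in_sets_haar[OF U]] by (auto simp: \<U>_def)
  have Fs: "(\<lambda>A. A) ` \<F> \<subseteq> sets (haar G)" using F(2) op open_in_sets_haar by (auto simp: \<U>_def)
  have "emeasure (haar G) (carrier G) \<le> emeasure (haar G) (\<Union>((\<lambda>A. A) ` \<F>))"
    using F Fs by (intro emeasure_mono sets.finite_Union) auto
  also have "\<dots> \<le> (\<Sum>A\<in>\<F>. emeasure (haar G) A)" by (rule emeasure_subadditive_finite[OF F(1) Fs])
  also have "\<dots> = 0" using null by simp
  finally show False using haar_normalized by simp
qed

end

section \<open>Differentiation under the Haar integral\<close>

context lie_group
begin

text \<open>The condition is made for repeated differentiation under the integral over y: every
  derivative in s exists and is jointly continuous. It is inherited by derivatives in s and by a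
  continuous change of the variable y.\<close>

definition smooth_kernel :: "'e set \<Rightarrow> ('e \<Rightarrow> 'g \<Rightarrow> complex) \<Rightarrow> bool" where
  "smooth_kernel V k \<longleftrightarrow> (\<forall>y\<in>carrier G. smooth_on E V (\<lambda>s. k s y)) \<and>
     (\<forall>vs. set vs \<subseteq> E \<longrightarrow> continuous_map (prod_topology (top_of_set V) (topo G)) euclidean
       (\<lambda>z. dir_derivs E vs (\<lambda>s. k s (snd z)) (fst z)))"

lemma smooth_kernel_dir_deriv:
  assumes k: "smooth_kernel V k" and v: "v \<in> E"
  shows "smooth_kernel V (\<lambda>s y. dir_deriv E v (\<lambda>s. k s y) s)"
  unfolding smooth_kernel_def
proof (intro conjI ballI allI impI)
  show "smooth_on E V (dir_deriv E v (\<lambda>s. k s y))" if "y \<in> carrier G" for y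
    using k that v unfolding smooth_kernel_def by (auto intro: smooth_on_dir_deriv)
  fix vs assume "set vs \<subseteq> E"
  then have "continuous_map (prod_topology (top_of_set V) (topo G)) euclidean
       (\<lambda>z. dir_derivs E (vs @ [v]) (\<lambda>s. k s (snd z)) (fst z))"
    using k v unfolding smooth_kernel_def by simp
  then show "continuous_map (prod_topology (top_of_set V) (topo G)) euclidean
       (\<lambda>z. dir_derivs E vs (dir_deriv E v (\<lambda>s. k s (snd z))) (fst z))"
    by (simp add: dir_derivs_append)
qed

text \<open>Turns the kernel of y \<otimes> x, treated with the smooth multiplication, into the
  convolution kernel of inv y \<otimes> x by continuity of the inversion.\<close>

lemma smooth_kernel_inv:
  assumes k: "smooth_kernel V k"
  shows "smooth_kernel V (\<lambda>s y. k s (inv y))"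
  unfolding smooth_kernel_def
proof (intro conjI ballI allI impI)
  show "smooth_on E V (\<lambda>s. k s (inv y))" if "y \<in> carrier G" for y
    using k that unfolding smooth_kernel_def by simp
  fix vs assume vs: "set vs \<subseteq> E"
  have "continuous_map (prod_topology (top_of_set V) (topo G)) (prod_topology (top_of_set V) (topo G))
      (\<lambda>z. (fst z, inv (snd z)))"
    unfolding continuous_map_pairwise
    using continuous_map_compose[OF continuous_map_snd inv_continuous, of "top_of_set V"] continuous_map_fst
    by (auto simp: o_def)
  from continuous_map_compose[OF this k[unfolded smooth_kernel_def, THEN conjunct2, rule_format, OF vs]]
  show "continuous_map (prod_topology (top_of_set V) (topo G)) euclidean
       (\<lambda>z. dir_derivs E vs (\<lambda>s. k s (inv (snd z))) (fst z))"
    by (simp add: o_def)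
qed

lemma kernel_slice_continuous:
  assumes "continuous_map (prod_topology (top_of_set V) (topo G)) euclidean (\<lambda>z. h (fst z) (snd z))" "s \<in> V"
  shows "continuous_map (topo G) euclidean (h s)"
proof -
  have "continuous_map (topo G) (prod_topology (top_of_set V) (topo G)) (Pair s)"
    using assms(2) by (simp add: continuous_map_pairwise o_def)
  from continuous_map_compose[OF this assms(1)] show ?thesis by (simp add: o_def)
qed

text \<open>In the variables of a chart, the derivatives of the kernel in the first argument are slices of
  derivatives of a smooth function of two variables, hence jointly continuous.\<close>

lemma translation_kernel_local:
  assumes a: "a \<in> atlas G" and c: "c \<in> atlas G" and d: "d \<in> atlas G" and \<phi>: "\<phi> \<in> smooth_funs G"
  defines "D \<equiv> {(t, s). t \<in> chart_img a \<and> s \<in> chart_img c \<and> chart_inv a t \<otimes> chart_inv c s \<in> chart_dom d}"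
  obtains H where "smooth_on (E \<times> E) D H"
    and "\<And>t. t \<in> chart_img a \<Longrightarrow> smooth_on E {s. (t, s) \<in> D} (\<lambda>s. \<phi> (chart_inv a t \<otimes> chart_inv c s))"
    and "\<And>vs t s. set vs \<subseteq> E \<Longrightarrow> (t, s) \<in> D \<Longrightarrow>
      dir_derivs E vs (\<lambda>s. \<phi> (chart_inv a t \<otimes> chart_inv c s)) s = dir_derivs (E \<times> E) (map (Pair 0) vs) H (t, s)"
proof -
  define \<mu> where "\<mu> = (\<lambda>(t, s). chart_map d (chart_inv a t \<otimes> chart_inv c s))"
  define H where "H = (\<lambda>z. \<phi> (chart_inv d (\<mu> z)))"
  have D: "openin (top_of_set (E \<times> E)) D" unfolding D_def by (rule mult_domain_open[OF a c d])
  have \<mu>: "smooth_on (E \<times> E) D \<mu>" unfolding D_def \<mu>_def by (rule mult_smooth[OF a c d])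
  have \<mu>D: "\<mu> ` D \<subseteq> chart_img d" unfolding D_def \<mu>_def by (auto intro: chart_map_mem[OF d])
  have H: "smooth_on (E \<times> E) D H"
    unfolding H_def
    by (rule smooth_on_compose[OF subspace_prod D subspace_model chart_img_open[OF d] \<mu> \<mu>D smooth_funsD[OF \<phi> d]])
  have eq: "H (t, s) = \<phi> (chart_inv a t \<otimes> chart_inv c s)" if "(t, s) \<in> D" for t s
    using that by (simp add: H_def \<mu>_def D_def chart_inv_map[OF d])
  have W: "openin (top_of_set E) {s. (t, s) \<in> D}" if "t \<in> chart_img a" for t
    using openin_slice(1)[OF D] chart_img_subset[OF a] that by blast
  show thesis
  proof (rule that[OF H])
    fix t assume t: "t \<in> chart_img a"
    have "smooth_on E {s. (t, s) \<in> D} (\<lambda>s. H (t, s))"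
      by (rule smooth_on_compose[OF subspace_model W[OF t] subspace_prod D smooth_on_Pair(1)[OF subspace_model W[OF t]] _ H])
        auto
    then show "smooth_on E {s. (t, s) \<in> D} (\<lambda>s. \<phi> (chart_inv a t \<otimes> chart_inv c s))"
      by (rule smooth_on_cong[OF W[OF t], rotated]) (simp add: eq)
  next
    fix vs t s assume vs: "set vs \<subseteq> E" and ts: "(t, s) \<in> D"
    then have t: "t \<in> chart_img a" by (simp add: D_def)
    have s: "s \<in> {s. (t, s) \<in> D}" using ts by simp
    have "dir_derivs E vs (\<lambda>s. \<phi> (chart_inv a t \<otimes> chart_inv c s)) s = dir_derivs E vs (\<lambda>s. H (t, s)) s"
      by (rule dir_derivs_local_cong[OF W[OF t] _ s]) (simp add: eq)
    also have "\<dots> = dir_derivs (E \<times> E) (map (Pair 0) vs) H (t, s)"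
      by (rule dir_derivs_affine[OF subspace_model W[OF t] subspace_prod D smooth_on_Pair(1)[OF subspace_model W[OF t]]
            _ smooth_on_Pair(3)[OF subspace_model W[OF t]] _ H s vs])
        (auto simp: Real_Vector_Spaces.subspace_0[OF subspace_model])
    finally show "dir_derivs E vs (\<lambda>s. \<phi> (chart_inv a t \<otimes> chart_inv c s)) s = dir_derivs (E \<times> E) (map (Pair 0) vs) H (t, s)" .
  qed
qed

lemma smooth_kernel_translation:
  assumes c: "c \<in> atlas G" and \<phi>: "\<phi> \<in> smooth_funs G"
  shows "smooth_kernel (chart_img c) (\<lambda>s y. \<phi> (y \<otimes> chart_inv c s))"
proof -
  have charts: "\<exists>a d. a \<in> atlas G \<and> d \<in> atlas G \<and> y \<in> chart_dom a \<and> y \<otimes> chart_inv c s \<in> chart_dom d"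
    if "y \<in> carrier G" "s \<in> chart_img c" for s y
    using chart_at that chart_inv_carrier[OF c that(2)] m_closed by metis
  show ?thesis
    unfolding smooth_kernel_def
  proof (intro conjI ballI allI impI)
    fix y assume y: "y \<in> carrier G"
    show "smooth_on E (chart_img c) (\<lambda>s. \<phi> (y \<otimes> chart_inv c s))"
    proof (rule smooth_on_locally[OF chart_img_open[OF c]])
      fix s assume s: "s \<in> chart_img c"
      obtain a d where a: "a \<in> atlas G" and d: "d \<in> atlas G" and ya: "y \<in> chart_dom a"
        and yd: "y \<otimes> chart_inv c s \<in> chart_dom d" using charts[OF y s] by blast
      define D where "D = {(t, s). t \<in> chart_img a \<and> s \<in> chart_img c \<and> chart_inv a t \<otimes> chart_inv c s \<in> chart_dom d}"
      note t = chart_map_mem[OF a ya] and it = chart_inv_map[OF a ya]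
      have "smooth_on E {s. (chart_map a y, s) \<in> D} (\<lambda>s. \<phi> (chart_inv a (chart_map a y) \<otimes> chart_inv c s))"
        by (rule translation_kernel_local[OF a c d \<phi>, folded D_def]) (use t in blast)
      moreover have "openin (top_of_set E) {s. (chart_map a y, s) \<in> D}"
        unfolding D_def by (rule openin_slice(1)[OF mult_domain_open[OF a c d] subsetD[OF chart_img_subset[OF a] t]])
      moreover have "s \<in> {s. (chart_map a y, s) \<in> D}" using s t yd by (simp add: D_def it)
      ultimately show "\<exists>U. openin (top_of_set E) U \<and> s \<in> U \<and> smooth_on E U (\<lambda>s. \<phi> (y \<otimes> chart_inv c s))"
        unfolding it by blast
    qed
  next
    fix vs assume vs: "set vs \<subseteq> E"
    let ?X = "prod_topology (top_of_set (chart_img c)) (topo G)"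
    show "continuous_map ?X euclidean (\<lambda>z. dir_derivs E vs (\<lambda>s. \<phi> (snd z \<otimes> chart_inv c s)) (fst z))"
    proof (rule continuous_map_locally)
      fix z0 assume "z0 \<in> topspace ?X"
      then have z0: "fst z0 \<in> chart_img c" "snd z0 \<in> carrier G" by (auto simp: topspace_topo)
      obtain a d where a: "a \<in> atlas G" and d: "d \<in> atlas G" and ya: "snd z0 \<in> chart_dom a"
        and yd: "snd z0 \<otimes> chart_inv c (fst z0) \<in> chart_dom d" using charts[OF z0(2,1)] by blast
      define D where "D = {(t, s). t \<in> chart_img a \<and> s \<in> chart_img c \<and> chart_inv a t \<otimes> chart_inv c s \<in> chart_dom d}"
      obtain H where H: "smooth_on (E \<times> E) D H" and Hd: "\<And>vs t s. set vs \<subseteq> E \<Longrightarrow> (t, s) \<in> D \<Longrightarrow>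
        dir_derivs E vs (\<lambda>s. \<phi> (chart_inv a t \<otimes> chart_inv c s)) s = dir_derivs (E \<times> E) (map (Pair 0) vs) H (t, s)"
        by (rule translation_kernel_local[OF a c d \<phi>, folded D_def]) (rule that)
      \<comment> \<open>On U the group element lies in the chart a and the product in the chart d,
        so the coordinates of z lie in D, where H is smooth.\<close>
      define U where "U = {z \<in> topspace ?X. snd z \<in> chart_dom a} \<inter> {z \<in> topspace ?X. snd z \<otimes> chart_inv c (fst z) \<in> chart_dom d}"
      have "continuous_map ?X (prod_topology (topo G) (topo G)) (\<lambda>z. (snd z, chart_inv c (fst z)))"
        unfolding continuous_map_pairwise
        using continuous_map_snd continuous_map_compose[OF continuous_map_fst chart_inv_continuous[OF c], of "topo G"]
        by (auto simp: o_def)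
      from continuous_map_compose[OF this mult_continuous]
      have "continuous_map ?X (topo G) (\<lambda>z. snd z \<otimes> chart_inv c (fst z))" by (simp add: o_def)
      from openin_Int[OF openin_continuous_map_preimage[OF continuous_map_snd chart_dom_open[OF a]]
          openin_continuous_map_preimage[OF this chart_dom_open[OF d]]]
      have U: "openin ?X U" unfolding U_def .
      have 1: "continuous_map (subtopology ?X U) (top_of_set (chart_img a)) (\<lambda>z. chart_map a (snd z))"
      proof -
        have "continuous_map (subtopology ?X U) (subtopology (topo G) (chart_dom a)) snd"
          using continuous_map_from_subtopology[OF continuous_map_snd]
          by (intro continuous_map_into_subtopology) (auto simp: U_def)
        from continuous_map_compose[OF this chart_map_continuous[OF a]] show ?thesis by (simp add: o_def)
      qed
      have 2: "continuous_map (subtopology ?X U) euclidean fst"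
        using continuous_map_into_fulltopology[OF continuous_map_from_subtopology[OF continuous_map_fst]] .
      have 3: "(chart_map a (snd z), fst z) \<in> D" if "z \<in> U" for z
        using that by (auto simp: U_def D_def chart_map_mem[OF a] chart_inv_map[OF a])
      have "continuous_map (subtopology ?X U) euclidean (\<lambda>z. (chart_map a (snd z), fst z))"
        unfolding prod_topology_euclidean[symmetric] continuous_map_pairwise
        using continuous_map_into_fulltopology[OF 1] 2 by (simp add: o_def)
      then have "continuous_map (subtopology ?X U) (top_of_set D) (\<lambda>z. (chart_map a (snd z), fst z))"
        using 3 by (intro continuous_map_into_subtopology) auto
      moreover have "set (map (Pair 0) vs) \<subseteq> E \<times> E"
        using vs Real_Vector_Spaces.subspace_0[OF subspace_model] by auto
      ultimately have "continuous_map (subtopology ?X U) euclidean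
          (\<lambda>z. dir_derivs (E \<times> E) (map (Pair 0) vs) H (chart_map a (snd z), fst z))"
        by (intro continuous_map_compose_on[where S=D] smooth_on_continuous_on[of "E \<times> E"] smooth_on_dir_derivs[OF H])
      then have "continuous_map (subtopology ?X U) euclidean (\<lambda>z. dir_derivs E vs (\<lambda>s. \<phi> (snd z \<otimes> chart_inv c s)) (fst z))"
      proof (rule continuous_map_eq)
        fix z assume "z \<in> topspace (subtopology ?X U)"
        then have z: "z \<in> U" by simp
        then show "dir_derivs (E \<times> E) (map (Pair 0) vs) H (chart_map a (snd z), fst z) =
            dir_derivs E vs (\<lambda>s. \<phi> (snd z \<otimes> chart_inv c s)) (fst z)"
          using Hd[OF vs 3[OF z]] by (simp add: U_def chart_inv_map[OF a])
      qed
      moreover have "z0 \<in> U" using z0 ya yd by (simp add: U_def topspace_topo mem_Times_iff)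
      ultimately show "\<exists>U. openin ?X U \<and> z0 \<in> U \<and> continuous_map (subtopology ?X U) euclidean
          (\<lambda>z. dir_derivs E vs (\<lambda>s. \<phi> (snd z \<otimes> chart_inv c s)) (fst z))" using U by blast
    qed
  qed
qed

end

context compact_lie_group
begin

text \<open>The tube lemma: by compactness of the group, a neighbourhood of {s0} \<times> G contains
  a product U \<times> G, so continuity at s0 is uniform in y.\<close>

lemma kernel_uniformly_close:
  fixes h :: "_ \<Rightarrow> _ \<Rightarrow> 'z::real_normed_vector"
  assumes V: "openin (top_of_set E) V"
    and h: "continuous_map (prod_topology (top_of_set V) (topo G)) euclidean (\<lambda>z. h (fst z) (snd z))"
    and s0: "s0 \<in> V" and \<epsilon>: "\<epsilon> > 0"
  obtains \<delta> where "\<delta> > 0"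
    "\<And>s y. s \<in> E \<Longrightarrow> dist s s0 < \<delta> \<Longrightarrow> y \<in> carrier G \<Longrightarrow> s \<in> V \<and> norm (h s y - h s0 y) < \<epsilon>"
proof -
  let ?X = "prod_topology (top_of_set V) (topo G)"
  have "continuous_map ?X ?X (\<lambda>z. (s0, snd z))"
    using s0 continuous_map_snd by (simp add: continuous_map_pairwise o_def)
  from continuous_map_compose[OF this h] have "continuous_map ?X euclidean (\<lambda>z. h s0 (snd z))"
    by (simp add: o_def)
  note diff = continuous_map_norm[OF continuous_map_diff[OF h this]]
  define Z where "Z = {z \<in> topspace ?X. norm (h (fst z) (snd z) - h s0 (snd z)) \<in> {..<\<epsilon>}}"
  have Z: "openin ?X Z"
    unfolding Z_def by (rule openin_continuous_map_preimage[OF diff]) simp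
  have cpt: "compactin (topo G) (carrier G)" using compact_topo topspace_topo by (simp add: compact_space_def)
  have "{s0} \<times> carrier G \<subseteq> Z"
    unfolding Z_def using s0 \<epsilon> by (auto simp: topspace_topo)
  from tube_lemma_right[OF Z cpt _ this] s0 obtain U Y where U: "openin (top_of_set V) U" "s0 \<in> U"
    and Y: "carrier G \<subseteq> Y" and UY: "U \<times> Y \<subseteq> Z"
    by auto
  obtain \<delta> where \<delta>: "\<delta> > 0" "\<And>s. s \<in> E \<Longrightarrow> dist s s0 < \<delta> \<Longrightarrow> s \<in> U"
    using openin_subspace_ball[OF openin_trans[OF U(1) V] U(2)] by metis
  have "s \<in> V \<and> norm (h s y - h s0 y) < \<epsilon>" if "s \<in> E" "dist s s0 < \<delta>" "y \<in> carrier G" for s y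
  proof -
    have "(s, y) \<in> U \<times> Y" using \<delta>(2)[OF that(1,2)] Y that(3) by auto
    with UY have "(s, y) \<in> Z" by (rule subsetD)
    then show ?thesis by (simp add: Z_def)
  qed
  then show thesis by (rule that[OF \<delta>(1)])
qed

text \<open>The mean value inequality on the segment from s0 to s, which stays in the ball of radius
  \<delta>. Expanding the direction s - s0 in the orthonormal basis reduces the required closeness
  to finitely many directional derivatives, whatever s is.\<close>

lemma kernel_linearization_bound:
  assumes V: "openin (top_of_set E) V" and k: "smooth_on E V k"
    and s0: "s0 \<in> E" and s: "s \<in> E" "dist s s0 < \<delta>" and \<eta>: "\<eta> \<ge> 0"
    and near: "\<And>b s. b \<in> orthobasis E \<Longrightarrow> s \<in> E \<Longrightarrow> dist s s0 < \<delta> \<Longrightarrow>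
      s \<in> V \<and> norm (dir_deriv E b k s - dir_deriv E b k s0) \<le> \<eta>"
    and V': "\<And>s. s \<in> E \<Longrightarrow> dist s s0 < \<delta> \<Longrightarrow> s \<in> V"
  shows "norm (k s - k s0 - (\<Sum>b\<in>orthobasis E. ((s - s0) \<bullet> b) *\<^sub>R dir_deriv E b k s0))
    \<le> \<eta> * (\<Sum>b\<in>orthobasis E. norm b) * norm (s - s0)"
proof -
  define w where "w = s - s0"
  have w: "w \<in> E" unfolding w_def using Real_Vector_Spaces.subspace_diff[OF subspace_model] s s0 by blast
  define D where "D a = (\<Sum>b\<in>orthobasis E. (w \<bullet> b) *\<^sub>R dir_deriv E b k (s0 + a *\<^sub>R w))" for a
  have inE: "s0 + a *\<^sub>R w \<in> E" for a
    using s0 w subspace_model by (intro Real_Vector_Spaces.subspace_add Real_Vector_Spaces.subspace_scale) auto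
  have close: "dist (s0 + a *\<^sub>R w) s0 < \<delta>" if "a \<in> {0..1}" for a
  proof -
    have "\<bar>a\<bar> * norm w \<le> 1 * norm w" using that by (intro mult_right_mono) auto
    then show ?thesis using s(2) by (simp add: dist_norm w_def)
  qed
  \<comment> \<open>Subtracting the linear term makes the derivative of g the change D a - D 0,
    which is small.\<close>
  define g where "g a = k (s0 + a *\<^sub>R w) - a *\<^sub>R D 0" for a
  have gd: "(g has_vector_derivative D a - D 0) (at a within {0..1})" if a: "a \<in> {0..1}" for a
  proof -
    have diff: "k differentiable (at (s0 + a *\<^sub>R w) within E)"
      by (rule smooth_on_differentiable[OF k V'[OF inE close[OF a]]])
    have "((\<lambda>a. k (s0 + a *\<^sub>R w)) has_vector_derivative dir_deriv E w k (s0 + a *\<^sub>R w)) (at a within {0..1})"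
      by (rule line_has_vector_derivative[OF subspace_model s0 w, where f'="\<lambda>v. dir_deriv E v k (s0 + a *\<^sub>R w)"])
        (rule has_derivative_dir_deriv[OF diff])
    moreover have "dir_deriv E w k (s0 + a *\<^sub>R w) = D a"
      unfolding D_def by (rule dir_deriv_orthobasis[OF subspace_model V diff w, symmetric])
    moreover have "((\<lambda>a. a *\<^sub>R D 0) has_vector_derivative D 0) (at a within {0..1})"
      by (auto intro!: derivative_eq_intros simp: has_vector_derivative_def)
    ultimately show ?thesis unfolding g_def by (auto intro: has_vector_derivative_diff)
  qed
  have "norm (g 1 - g 0) \<le> (\<eta> * (\<Sum>b\<in>orthobasis E. norm b) * norm w) * norm (1 - 0 :: real)"
  proof (rule differentiable_bound[where S="{0..1}" and f'="\<lambda>a h. h *\<^sub>R (D a - D 0)"])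
    fix a :: real assume a: "a \<in> {0..1}"
    show "(g has_derivative (\<lambda>h. h *\<^sub>R (D a - D 0))) (at a within {0..1})"
      using gd[OF a] unfolding has_vector_derivative_def .
    have "norm (D a - D 0) = norm (\<Sum>b\<in>orthobasis E. (w \<bullet> b) *\<^sub>R (dir_deriv E b k (s0 + a *\<^sub>R w) - dir_deriv E b k s0))"
      unfolding D_def by (simp add: sum_subtractf scaleR_diff_right)
    also have "\<dots> \<le> (\<Sum>b\<in>orthobasis E. norm w * norm b * \<eta>)"
    proof (rule sum_norm_le)
      fix b assume b: "b \<in> orthobasis E"
      have "norm (dir_deriv E b k (s0 + a *\<^sub>R w) - dir_deriv E b k s0) \<le> \<eta>"
        using near[OF b inE close[OF a]] by simp
      then show "norm ((w \<bullet> b) *\<^sub>R (dir_deriv E b k (s0 + a *\<^sub>R w) - dir_deriv E b k s0)) \<le> norm w * norm b * \<eta>"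
        unfolding norm_scaleR using Cauchy_Schwarz_ineq2[of w b] by (intro mult_mono) auto
    qed
    also have "\<dots> = \<eta> * (\<Sum>b\<in>orthobasis E. norm b) * norm w"
      by (simp add: sum_distrib_left sum_distrib_right mult_ac)
    finally show "onorm (\<lambda>h. h *\<^sub>R (D a - D 0)) \<le> \<eta> * (\<Sum>b\<in>orthobasis E. norm b) * norm w"
      by (intro onorm_le) (simp add: mult.commute mult_left_mono)
  qed auto
  moreover have "g 1 - g 0 = k s - k s0 - D 0" by (simp add: g_def w_def)
  ultimately show ?thesis by (simp add: D_def w_def)
qed

context
  fixes V k and \<psi> :: "'a \<Rightarrow> complex"
  assumes V: "openin (top_of_set E) V" and k: "smooth_kernel V k"
    and \<psi>: "continuous_map (topo G) euclidean \<psi>"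
begin

lemma kernel_integrand_continuous: "s \<in> V \<Longrightarrow> continuous_map (topo G) euclidean (\<lambda>y. k s y * \<psi> y)"
  using kernel_slice_continuous[OF k[unfolded smooth_kernel_def, THEN conjunct2, rule_format, of "[]", simplified]]
  by (intro continuous_map_mult \<psi>) auto

lemma kernel_deriv_continuous:
  "v \<in> E \<Longrightarrow> continuous_map (prod_topology (top_of_set V) (topo G)) euclidean
     (\<lambda>z. dir_deriv E v (\<lambda>s. k s (snd z)) (fst z))"
  using k[unfolded smooth_kernel_def, THEN conjunct2, rule_format, of "[v]"] by simp

lemma kernel_deriv_integrand_continuous:
  "s \<in> V \<Longrightarrow> v \<in> E \<Longrightarrow> continuous_map (topo G) euclidean (\<lambda>y. dir_deriv E v (\<lambda>s. k s y) s * \<psi> y)"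
  using kernel_slice_continuous[OF kernel_deriv_continuous, of v s] by (intro continuous_map_mult \<psi>) auto

text \<open>The linearization error of the kernel at s0 is bounded uniformly in y, and the Haar
  measure has total mass 1, so the integral against the bounded function \<psi> has an error of the
  same order.\<close>

lemma kernel_integral_has_derivative:
  assumes s0: "s0 \<in> V"
  shows "((\<lambda>s. LINT y|haar G. k s y * \<psi> y) has_derivative
    (\<lambda>v. \<Sum>b\<in>orthobasis E. (v \<bullet> b) *\<^sub>R (LINT y|haar G. dir_deriv E b (\<lambda>s. k s y) s0 * \<psi> y))) (at s0 within E)"
    (is "(?I has_derivative ?D) _")
  unfolding has_derivative_within_alt
proof (intro conjI allI impI)
  show "bounded_linear ?D" by (intro bounded_linear_sum bounded_linear_intros)
  fix e :: real assume e: "e > 0"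
  note B = subsetD[OF orthobasis(1)[OF subspace_model]]
  have s0E: "s0 \<in> E" using s0 openin_subset[OF V] by auto
  obtain M where M: "M > 0" "\<And>y. y \<in> carrier G \<Longrightarrow> norm (\<psi> y) \<le> M" using continuous_bounded[OF \<psi>] by metis
  define K where "K = (\<Sum>b\<in>orthobasis E. norm b)"
  have K: "K \<ge> 0" unfolding K_def by (intro sum_nonneg) simp
  \<comment> \<open>M bounds \<psi> and K collects the norms of the basis vectors; K + 1 keeps the
    denominator positive when the basis is empty.\<close>
  define \<eta> where "\<eta> = e / (M * (K + 1))"
  have \<eta>: "\<eta> > 0" unfolding \<eta>_def using e M(1) K by simp
  have "\<exists>\<delta>>0. \<forall>s y. s \<in> E \<longrightarrow> dist s s0 < \<delta> \<longrightarrow> y \<in> carrier G \<longrightarrow>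
      s \<in> V \<and> norm (dir_deriv E b (\<lambda>s. k s y) s - dir_deriv E b (\<lambda>s. k s y) s0) < \<eta>" if b: "b \<in> orthobasis E" for b
    using kernel_uniformly_close[OF V kernel_deriv_continuous[OF B[OF b]] s0 \<eta>] by metis
  then obtain \<delta> where \<delta>: "\<And>b. b \<in> orthobasis E \<Longrightarrow> \<delta> b > 0"
    "\<And>b s y. b \<in> orthobasis E \<Longrightarrow> s \<in> E \<Longrightarrow> dist s s0 < \<delta> b \<Longrightarrow> y \<in> carrier G \<Longrightarrow>
      s \<in> V \<and> norm (dir_deriv E b (\<lambda>s. k s y) s - dir_deriv E b (\<lambda>s. k s y) s0) < \<eta>" by metis
  obtain r where r: "r > 0" "\<And>s. s \<in> E \<Longrightarrow> dist s s0 < r \<Longrightarrow> s \<in> V" using openin_subspace_ball[OF V s0] by metis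
  \<comment> \<open>Including r keeps s in V and keeps the set nonempty when E is {0}.\<close>
  define d where "d = Min (insert r (\<delta> ` orthobasis E))"
  have fin: "finite (insert r (\<delta> ` orthobasis E))" using orthobasis(2)[OF subspace_model] by simp
  have d: "d > 0" unfolding d_def using fin \<delta>(1) r(1) by (subst Min_gr_iff) auto
  have dle: "d \<le> r" "\<And>b. b \<in> orthobasis E \<Longrightarrow> d \<le> \<delta> b" unfolding d_def using fin by auto
  have main: "norm (?I s - ?I s0 - ?D (s - s0)) \<le> e * norm (s - s0)" if s: "s \<in> E" "norm (s - s0) < d" for s
  proof -
    have ds: "dist s s0 < d" using s(2) by (simp add: dist_norm)
    have sV: "s \<in> V" using r(2)[OF s(1)] ds dle(1) by simp
    define R where "R y = k s y - k s0 y - (\<Sum>b\<in>orthobasis E. ((s - s0) \<bullet> b) *\<^sub>R dir_deriv E b (\<lambda>s. k s y) s0)" for y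
    have R: "norm (R y) \<le> \<eta> * K * norm (s - s0)" if y: "y \<in> carrier G" for y
      unfolding R_def K_def
    proof (rule kernel_linearization_bound[OF V _ s0E s(1) ds less_imp_le[OF \<eta>]])
      show "smooth_on E V (\<lambda>s. k s y)" using k y unfolding smooth_kernel_def by blast
    next
      fix b s assume "b \<in> orthobasis E" "s \<in> E" "dist s s0 < d"
      then show "s \<in> V \<and> norm (dir_deriv E b (\<lambda>s. k s y) s - dir_deriv E b (\<lambda>s. k s y) s0) \<le> \<eta>"
        using \<delta>(2)[of b s y] dle(2)[of b] y by auto
    next
      fix s assume "s \<in> E" "dist s s0 < d"
      then show "s \<in> V" using r(2)[of s] dle(1) by auto
    qed
    have Rsplit: "R y * \<psi> y = k s y * \<psi> y - k s0 y * \<psi> y -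
        (\<Sum>b\<in>orthobasis E. ((s - s0) \<bullet> b) *\<^sub>R (dir_deriv E b (\<lambda>s. k s y) s0 * \<psi> y))" for y
      unfolding R_def by (simp add: algebra_simps sum_distrib_right sum_distrib_left)
    have int: "integrable (haar G) (\<lambda>y. dir_deriv E b (\<lambda>s. k s y) s0 * \<psi> y)" if "b \<in> orthobasis E" for b
      by (rule continuous_integrable[OF kernel_deriv_integrand_continuous[OF s0 B[OF that]]])
    have "?I s - ?I s0 - ?D (s - s0) = (LINT y|haar G. R y * \<psi> y)"
      unfolding Rsplit
      using int continuous_integrable[OF kernel_integrand_continuous[OF sV]]
        continuous_integrable[OF kernel_integrand_continuous[OF s0]]
      by (simp add: Bochner_Integration.integral_diff Bochner_Integration.integrable_diff
          Bochner_Integration.integrable_sum Bochner_Integration.integral_sum)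
    also have "norm \<dots> \<le> \<eta> * K * norm (s - s0) * M"
    proof (rule norm_haar_integral_le)
      have "continuous_map (topo G) euclidean (\<lambda>y. \<Sum>b\<in>orthobasis E. ((s - s0) \<bullet> b) *\<^sub>R (dir_deriv E b (\<lambda>s. k s y) s0 * \<psi> y))"
      proof (rule continuous_map_sum[OF orthobasis(2)[OF subspace_model]])
        fix b assume b: "b \<in> orthobasis E"
        have "continuous_map (topo G) euclidean (\<lambda>y. complex_of_real ((s - s0) \<bullet> b) * (dir_deriv E b (\<lambda>s. k s y) s0 * \<psi> y))"
          by (rule continuous_map_mult[OF _ kernel_deriv_integrand_continuous[OF s0 B[OF b]]]) simp
        then show "continuous_map (topo G) euclidean (\<lambda>y. ((s - s0) \<bullet> b) *\<^sub>R (dir_deriv E b (\<lambda>s. k s y) s0 * \<psi> y))"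
          by (simp add: scaleR_conv_of_real)
      qed
      then show "continuous_map (topo G) euclidean (\<lambda>y. R y * \<psi> y)"
        unfolding Rsplit
        by (intro continuous_map_diff kernel_integrand_continuous s0 sV)
      show "norm (R y * \<psi> y) \<le> \<eta> * K * norm (s - s0) * M" if "y \<in> carrier G" for y
        unfolding norm_mult using R[OF that] M(2)[OF that] \<eta> K by (intro mult_mono) auto
    qed
    also have "\<dots> \<le> e * norm (s - s0)"
    proof -
      have "\<eta> * K * M \<le> \<eta> * (M * (K + 1))" using \<eta> M(1) by (simp add: algebra_simps)
      also have "\<dots> = e" unfolding \<eta>_def using M(1) K by simp
      finally have "\<eta> * K * M \<le> e" .
      from mult_right_mono[OF this norm_ge_zero[of "s - s0"]] show ?thesis by (simp add: mult_ac)
    qed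
    finally show ?thesis .
  qed
  show "\<exists>d>0. \<forall>y\<in>E. norm (y - s0) < d \<longrightarrow> norm (?I y - ?I s0 - ?D (y - s0)) \<le> e * norm (y - s0)"
    using d main by blast
qed

lemma dir_deriv_kernel_integral:
  assumes s0: "s0 \<in> V" and v: "v \<in> E"
  shows "dir_deriv E v (\<lambda>s. LINT y|haar G. k s y * \<psi> y) s0 = (LINT y|haar G. dir_deriv E v (\<lambda>s. k s y) s0 * \<psi> y)"
proof -
  note B = subsetD[OF orthobasis(1)[OF subspace_model]]
  have int: "integrable (haar G) (\<lambda>y. dir_deriv E b (\<lambda>s. k s y) s0 * \<psi> y)" if "b \<in> orthobasis E" for b
    by (rule continuous_integrable[OF kernel_deriv_integrand_continuous[OF s0 B[OF that]]])
  have "dir_deriv E v (\<lambda>s. LINT y|haar G. k s y * \<psi> y) s0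
      = (\<Sum>b\<in>orthobasis E. (v \<bullet> b) *\<^sub>R (LINT y|haar G. dir_deriv E b (\<lambda>s. k s y) s0 * \<psi> y))"
    using dir_deriv_eq[OF subspace_model _ v kernel_integral_has_derivative[OF s0]] openin_subset[OF V] s0 by auto
  also have "\<dots> = (LINT y|haar G. (\<Sum>b\<in>orthobasis E. (v \<bullet> b) *\<^sub>R (dir_deriv E b (\<lambda>s. k s y) s0 * \<psi> y)))"
    using int by (simp add: Bochner_Integration.integral_sum)
  also have "\<dots> = (LINT y|haar G. dir_deriv E v (\<lambda>s. k s y) s0 * \<psi> y)"
  proof (rule Bochner_Integration.integral_cong[OF refl])
    fix y assume "y \<in> space (haar G)"
    then have "smooth_on E V (\<lambda>s. k s y)" using k by (simp add: smooth_kernel_def space_haar)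
    note eq = dir_deriv_orthobasis[OF subspace_model V smooth_on_differentiable[OF this s0] v]
    show "(\<Sum>b\<in>orthobasis E. (v \<bullet> b) *\<^sub>R (dir_deriv E b (\<lambda>s. k s y) s0 * \<psi> y)) = dir_deriv E v (\<lambda>s. k s y) s0 * \<psi> y"
      unfolding eq[symmetric] sum_distrib_right by simp
  qed
  finally show ?thesis .
qed

end

text \<open>The derivative of such an integral is the integral of another smooth kernel against the
  same \<psi>, so these integrals form a class suited to coinduction.\<close>

lemma smooth_kernel_integral:
  assumes V: "openin (top_of_set E) V" and k: "smooth_kernel V k"
    and \<psi>: "continuous_map (topo G) euclidean \<psi>"
  shows "smooth_on E V (\<lambda>s. LINT y|haar G. k s y * \<psi> y)"
proof (rule smooth_on_coinduct[OF V, where S="\<lambda>I. \<exists>k. smooth_kernel V k \<and> I = (\<lambda>s. LINT y|haar G. k s y * \<psi> y)"])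
  show "\<exists>k'. smooth_kernel V k' \<and> (\<lambda>s. LINT y|haar G. k s y * \<psi> y) = (\<lambda>s. LINT y|haar G. k' s y * \<psi> y)"
    using k by blast
next
  fix I :: "'b \<Rightarrow> complex" and x
  assume "\<exists>k. smooth_kernel V k \<and> I = (\<lambda>s. LINT y|haar G. k s y * \<psi> y)" "x \<in> V"
  then obtain k where "smooth_kernel V k" "I = (\<lambda>s. LINT y|haar G. k s y * \<psi> y)" by (elim exE conjE)
  with kernel_integral_has_derivative[OF V _ \<psi> \<open>x \<in> V\<close>, of k] show "I differentiable at x within E"
    by (auto simp: differentiable_def)
next
  fix I :: "'b \<Rightarrow> complex" and v
  assume "\<exists>k. smooth_kernel V k \<and> I = (\<lambda>s. LINT y|haar G. k s y * \<psi> y)" and v: "v \<in> E"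
  then obtain k where k: "smooth_kernel V k" and I: "I = (\<lambda>s. LINT y|haar G. k s y * \<psi> y)" by (elim exE conjE)
  show "\<exists>g. (\<exists>k. smooth_kernel V k \<and> g = (\<lambda>s. LINT y|haar G. k s y * \<psi> y)) \<and> (\<forall>x\<in>V. dir_deriv E v I x = g x)"
  proof (intro exI[of _ "\<lambda>s. LINT y|haar G. dir_deriv E v (\<lambda>s. k s y) s * \<psi> y"]
      exI[of _ "\<lambda>s y. dir_deriv E v (\<lambda>s. k s y) s"] conjI ballI)
    show "smooth_kernel V (\<lambda>s y. dir_deriv E v (\<lambda>s. k s y) s)" by (rule smooth_kernel_dir_deriv[OF k v])
    show "dir_deriv E v I x = (LINT y|haar G. dir_deriv E v (\<lambda>s. k s y) x * \<psi> y)" if "x \<in> V" for x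
      unfolding I by (rule dir_deriv_kernel_integral[OF V k \<psi> that v])
  qed simp
qed

text \<open>All derivatives fall on \<phi>. This allows \<psi> to be a matrix coefficient, about
  which only continuity is known at this point.\<close>

lemma smooth_funs_convolution:
  assumes \<phi>: "\<phi> \<in> smooth_funs G" and \<psi>: "continuous_map (topo G) euclidean \<psi>"
  shows "(\<lambda>x. LINT y|haar G. \<phi> (inv y \<otimes> x) * \<psi> y) \<in> smooth_funs G"
  by (rule smooth_funsI, rule smooth_kernel_integral[OF chart_img_open _ \<psi>])
    (auto intro: smooth_kernel_inv[OF smooth_kernel_translation[OF _ \<phi>]])

end

section \<open>Smoothness of matrix coefficients\<close>

lemma mat_adjoint_complex:
  fixes A :: "complex mat"
  assumes "A \<in> carrier_mat d d"
  shows "mat_adjoint A \<in> carrier_mat d d"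
    and "\<And>i j. i < d \<Longrightarrow> j < d \<Longrightarrow> mat_adjoint A $$ (i, j) = cnj (A $$ (j, i))"
  using assms by (auto simp: mat_adjoint_def mat_of_rows_def)

text \<open>If the matrix were singular, let v be a nonzero kernel vector and i an index of maximal
  modulus. The i-th equation gives |v i| \<le> d * (1 / (2 d)) * |v i|, half of itself, hence v =
  0.\<close>

lemma near_identity_right_inverse:
  fixes A :: "nat \<Rightarrow> nat \<Rightarrow> complex"
  assumes A: "\<And>i j. i < d \<Longrightarrow> j < d \<Longrightarrow> norm (A i j - (if i = j then 1 else 0)) \<le> 1 / (2 * real d)"
  obtains B where "\<And>i j. i < d \<Longrightarrow> j < d \<Longrightarrow> (\<Sum>k<d. A i k * B k j) = (if i = j then 1 else 0)"
proof -
  define M where "M = Matrix.mat d d (\<lambda>(i, j). A i j)"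
  have M: "M \<in> carrier_mat d d" by (simp add: M_def)
  have "Determinant.det M \<noteq> 0"
  proof
    assume "Determinant.det M = 0"
    then obtain v where v: "v \<in> carrier_vec d" "v \<noteq> 0\<^sub>v d" "M *\<^sub>v v = 0\<^sub>v d"
      using det_0_iff_vec_prod_zero_field[OF M] by blast
    obtain l where l: "l < d" "v $ l \<noteq> 0" using v(1,2) by (auto simp: vec_eq_iff)
    define V where "V = (\<lambda>i. norm (v $ i)) ` {..<d}"
    have V: "finite V" "V \<noteq> {}" using l(1) by (auto simp: V_def)
    obtain i where i: "i < d" "norm (v $ i) = Max V" using Max_in[OF V] by (auto simp: V_def)
    have i_max: "norm (v $ j) \<le> norm (v $ i)" if "j < d" for j
      unfolding i(2) using that V(1) by (intro Max_ge) (auto simp: V_def)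
    have "(M *\<^sub>v v) $ i = (\<Sum>j<d. A i j * v $ j)"
      using i(1) v(1) by (simp add: M_def scalar_prod_def atLeast0LessThan)
    then have z: "(\<Sum>j<d. A i j * v $ j) = 0" using v(3) i(1) by simp
    have "v $ i = (\<Sum>j<d. (if i = j then 1 else 0) * v $ j)"
      using i(1) by (simp add: if_distrib[of "\<lambda>a. a * _"] cong: if_cong)
    also have "\<dots> = - (\<Sum>j<d. (A i j - (if i = j then 1 else 0)) * v $ j)"
      using z by (simp add: left_diff_distrib sum_subtractf)
    finally have "norm (v $ i) = norm (\<Sum>j<d. (A i j - (if i = j then 1 else 0)) * v $ j)" by simp
    also have "\<dots> \<le> (\<Sum>j<d. 1 / (2 * real d) * norm (v $ i))"
      by (rule sum_norm_le, unfold norm_mult, rule mult_mono) (use A i(1) i_max in auto)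
    also have "\<dots> = norm (v $ i) / 2" using l(1) by simp
    finally have "v $ i = 0" by simp
    then show False using i_max[OF l(1)] l(2) by simp
  qed
  from det_non_zero_imp_unit[OF M this, of "()"]
  obtain N where N: "N \<in> carrier_mat d d" "M * N = 1\<^sub>m d"
    unfolding Units_def by (auto simp: ring_mat_simps)
  show thesis
  proof (rule that[of "\<lambda>k j. N $$ (k, j)"])
    fix i j assume ij: "i < d" "j < d"
    have "(M * N) $$ (i, j) = (\<Sum>k<d. A i k * N $$ (k, j))"
      using ij N(1) by (simp add: M_def scalar_prod_def atLeast0LessThan)
    then show "(\<Sum>k<d. A i k * N $$ (k, j)) = (if i = j then 1 else 0)" using N(2) ij by simp
  qed
qed

context compact_lie_group
begin

text \<open>Powers of a function that attains its maximum 1 only at the unit form an approximate identity.\<close>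

lemma powers_concentrate:
  fixes g :: "_ \<Rightarrow> real" and f :: "'i \<Rightarrow> _ \<Rightarrow> complex"
  assumes g: "continuous_map (topo G) euclidean g" and g01: "\<And>x. x \<in> carrier G \<Longrightarrow> 0 \<le> g x \<and> g x \<le> 1"
    and g1: "g \<one> = 1" and g1D: "\<And>x. x \<in> carrier G \<Longrightarrow> g x = 1 \<Longrightarrow> x = \<one>"
    and I: "finite I" and f: "\<And>i. i \<in> I \<Longrightarrow> continuous_map (topo G) euclidean (f i)"
    and f1: "\<And>i. i \<in> I \<Longrightarrow> f i \<one> = 0" and \<eta>: "\<eta> > 0"
  obtains k where "0 < (LINT x|haar G. g x ^ k)"
    "\<And>i. i \<in> I \<Longrightarrow> norm (LINT x|haar G. complex_of_real (g x ^ k) * f i x) \<le> \<eta> * (LINT x|haar G. g x ^ k)"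
proof -
  \<comment> \<open>A single majorant for all f i, so that one exponent k serves the whole finite
    family.\<close>
  define F where "F x = (\<Sum>i\<in>I. norm (f i x))" for x
  have F: "continuous_map (topo G) euclidean F"
    unfolding F_def[abs_def] by (intro continuous_map_sum[OF I] continuous_map_norm f)
  have F0: "F x \<ge> 0" "F \<one> = 0" for x unfolding F_def using f1 by (auto intro: sum_nonneg)
  have fF: "norm (f i x) \<le> F x" if "i \<in> I" for i x
    unfolding F_def using I that by (intro member_le_sum) auto
  obtain R where R: "R > 0" "\<And>x. x \<in> carrier G \<Longrightarrow> norm (F x) \<le> R" using continuous_bounded[OF F] by metis
  have cpt: "compactin (topo G) (carrier G)" using compact_topo topspace_topo by (simp add: compact_space_def)
  \<comment> \<open>Away from K the functions are small by themselves. K is compact and misses the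
    unit, so g stays below some \<alpha> < 1 on it.\<close>
  define K where "K = {x \<in> topspace (topo G). F x \<in> {\<eta> / 2..}}"
  have "closedin (topo G) K" unfolding K_def by (rule closedin_continuous_map_preimage[OF F]) simp
  then have "compactin (topo G) K" using closed_compactin[OF cpt] by (simp add: K_def topspace_topo)
  from image_compactin[OF this g] have gK: "compact (g ` K)" by simp
  obtain \<alpha> where \<alpha>: "0 \<le> \<alpha>" "\<alpha> < 1" "\<And>x. x \<in> K \<Longrightarrow> g x \<le> \<alpha>"
  proof (cases "K = {}")
    case False
    then obtain x where x: "x \<in> K" "\<And>y. y \<in> K \<Longrightarrow> g y \<le> g x"
      using compact_attains_sup[OF gK] by auto
    have "g x \<noteq> 1" using x(1) g1D F0(2) \<eta> by (auto simp: K_def topspace_topo)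
    then show thesis using that[of "g x"] x g01[of x] by (force simp: K_def topspace_topo)
  qed (use that[of 0] in auto)
  \<comment> \<open>Any value strictly between \<alpha> and 1 serves: where g exceeds \<beta> there
    is a neighbourhood of the unit of positive measure m, so the integral of g ^ k is at least
    \<beta> ^ k * m and outweighs \<alpha> ^ k for large k.\<close>
  define \<beta> where "\<beta> = (1 + \<alpha>) / 2"
  have \<beta>: "\<alpha> < \<beta>" "\<beta> < 1" "0 < \<beta>" unfolding \<beta>_def using \<alpha> by auto
  define U where "U = {x \<in> topspace (topo G). g x \<in> {\<beta><..}}"
  have U: "openin (topo G) U" unfolding U_def by (rule openin_continuous_map_preimage[OF g]) simp
  define m where "m = measure (haar G) U"
  have m: "m > 0" unfolding m_def by (rule haar_open_pos[OF U]) (use g1 \<beta> in \<open>simp add: U_def topspace_topo\<close>)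
  have "\<alpha> / \<beta> < 1" using \<beta> by simp
  moreover have "\<eta> / 2 * m / R > 0" using \<eta> m R by simp
  \<comment> \<open>With this k the part over K, at most R \<alpha> ^ k, uses up half of the allowed
    error; the part off K uses the other half.\<close>
  ultimately obtain k where k: "(\<alpha> / \<beta>) ^ k < \<eta> / 2 * m / R" using real_arch_pow_inv by blast
  then have k: "R * \<alpha> ^ k \<le> \<eta> / 2 * (\<beta> ^ k * m)"
    using R(1) \<beta>(3) by (simp add: power_divide field_simps)
  have gk: "continuous_map (topo G) euclidean (\<lambda>x. g x ^ k)"
    by (rule continuous_map_compose_on[of _ UNIV g]) (use g in \<open>auto intro: continuous_intros\<close>)
  have gki: "integrable (haar G) (\<lambda>x. g x ^ k)" by (rule continuous_integrable[OF gk])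
  define c where "c = (LINT x|haar G. g x ^ k)"
  have c: "\<beta> ^ k * m \<le> c"
  proof -
    have "\<beta> ^ k * m = (LINT x|haar G. \<beta> ^ k * indicator U x)"
      using finite_measure.emeasure_finite[OF finite_measure_haar, of U] open_in_sets_haar[OF U]
      by (simp add: m_def)
    also have "\<dots> \<le> c" unfolding c_def
    proof (rule integral_mono)
      show "integrable (haar G) (\<lambda>x. \<beta> ^ k * indicator U x)"
        using finite_measure.emeasure_finite[OF finite_measure_haar, of U] open_in_sets_haar[OF U]
        by (intro integrable_mult_right integrable_real_indicator) (auto simp: top.not_eq_extremum)
      show "\<beta> ^ k * indicator U x \<le> g x ^ k" if "x \<in> space (haar G)" for x
        using g01[of x] that \<beta> by (auto simp: U_def space_haar indicator_def intro: power_mono)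
    qed (rule gki)
    finally show ?thesis .
  qed
  have cpos: "c > 0" using c \<beta>(3) m by (smt (verit) mult_pos_pos zero_less_power)
  have "norm (LINT x|haar G. complex_of_real (g x ^ k) * f i x) \<le> \<eta> * c" if i: "i \<in> I" for i
  proof -
    have cgf: "continuous_map (topo G) euclidean (\<lambda>x. complex_of_real (g x ^ k) * f i x)"
      by (intro continuous_map_mult f[OF i])
        (rule continuous_map_compose_on[of _ UNIV g], use g in \<open>auto intro: continuous_intros\<close>)
    have "norm (LINT x|haar G. complex_of_real (g x ^ k) * f i x)
      \<le> (LINT x|haar G. norm (complex_of_real (g x ^ k) * f i x))" by (rule integral_norm_bound)
    also have "\<dots> \<le> (LINT x|haar G. \<eta> / 2 * g x ^ k + R * \<alpha> ^ k)"
    proof (rule integral_mono)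
      show "integrable (haar G) (\<lambda>x. norm (complex_of_real (g x ^ k) * f i x))"
        by (rule integrable_norm[OF continuous_integrable[OF cgf]])
      show "integrable (haar G) (\<lambda>x. \<eta> / 2 * g x ^ k + R * \<alpha> ^ k)"
        by (intro Bochner_Integration.integrable_add integrable_mult_right gki
            finite_measure.integrable_const[OF finite_measure_haar])
      fix x assume "x \<in> space (haar G)"
      then have x: "x \<in> carrier G" by (simp add: space_haar)
      have "norm (complex_of_real (g x ^ k) * f i x) = g x ^ k * norm (f i x)"
        using g01[OF x] by (simp add: norm_mult norm_power)
      also have "\<dots> \<le> g x ^ k * F x" using fF[OF i] g01[OF x] by (intro mult_left_mono) auto
      also have "\<dots> \<le> \<eta> / 2 * g x ^ k + R * \<alpha> ^ k"
      proof (cases "x \<in> K")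
        case True
        have "g x ^ k * F x \<le> \<alpha> ^ k * R"
          using R(2)[OF x] F0(1)[of x] \<alpha>(3)[OF True] g01[OF x] \<alpha>(1) by (intro mult_mono power_mono) auto
        moreover have "0 \<le> \<eta> / 2 * g x ^ k" using \<eta> g01[OF x] by simp
        ultimately show ?thesis by (simp add: mult.commute)
      next
        case False
        then have "F x \<le> \<eta> / 2" using x by (simp add: K_def topspace_topo)
        from mult_left_mono[OF this, of "g x ^ k"] have "g x ^ k * F x \<le> \<eta> / 2 * g x ^ k"
          using g01[OF x] by (simp add: mult.commute)
        moreover have "0 \<le> R * \<alpha> ^ k" using R(1) \<alpha>(1) by simp
        ultimately show ?thesis by simp
      qed
      finally show "norm (complex_of_real (g x ^ k) * f i x) \<le> \<eta> / 2 * g x ^ k + R * \<alpha> ^ k" .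
    qed
    also have "\<dots> = \<eta> / 2 * c + R * \<alpha> ^ k"
      using gki finite_measure.integrable_const[OF finite_measure_haar, of "R * \<alpha> ^ k"]
      by (simp add: c_def measure_haar)
    also have "\<dots> \<le> \<eta> * c"
    proof -
      have "\<eta> / 2 * (\<beta> ^ k * m) \<le> \<eta> / 2 * c" using c \<eta> by (intro mult_left_mono) auto
      then show ?thesis using k by simp
    qed
    finally show ?thesis .
  qed
  then show thesis using that[of k] cpos unfolding c_def by blast
qed

lemma unitary_rep_one:
  assumes "unitary_rep G d \<xi>"
  shows "\<xi> \<one> = 1\<^sub>m d"
proof -
  have u: "\<xi> \<one> \<in> carrier_mat d d" "\<xi> \<one> * mat_adjoint (\<xi> \<one>) = 1\<^sub>m d" "\<xi> (\<one> \<otimes> \<one>) = \<xi> \<one> * \<xi> \<one>"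
    using assms one_closed unfolding unitary_rep_def by blast+
  have a: "mat_adjoint (\<xi> \<one>) \<in> carrier_mat d d" using u(1) by (rule mat_adjoint_complex(1))
  have "\<xi> \<one> = \<xi> \<one> * (\<xi> \<one> * mat_adjoint (\<xi> \<one>))" using u by simp
  also have "\<dots> = \<xi> \<one> * \<xi> \<one> * mat_adjoint (\<xi> \<one>)" using u(1) a by (simp add: assoc_mult_mat)
  also have "\<dots> = 1\<^sub>m d" using u by simp
  finally show ?thesis .
qed

lemma matrix_coefficient_smooth:
  fixes n :: nat
  assumes q: "\<And>j. j < n \<Longrightarrow> q j \<in> smooth_funs G" and zero: "{x \<in> carrier G. \<forall>j<n. q j x = 0} = {\<one>}"
    and \<xi>: "unitary_rep G d \<xi>" and ij: "i < d" "j < d"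
  shows "(\<lambda>x. \<xi> x $$ (i, j)) \<in> smooth_funs G"
proof -
  define h where "h x = (\<Sum>j<n. q j x * cnj (q j x))" for x
  have hr: "h x = complex_of_real (\<Sum>j<n. (norm (q j x))\<^sup>2)" for x
    unfolding h_def of_real_sum complex_norm_square ..
  have h: "h \<in> smooth_funs G" unfolding h_def[abs_def] by (intro smooth_funs_sum smooth_funs_mult smooth_funs_cnj q) auto
  obtain M where M: "M > 0" "\<And>x. x \<in> carrier G \<Longrightarrow> norm (h x) \<le> M"
    using continuous_bounded[OF smooth_funs_continuous[OF h]] by metis
  \<comment> \<open>M bounds the sum of squares, so w takes values between 0 and 1; it equals 1
    exactly where all \<open>q j\<close> vanish, that is at the unit.\<close>
  define w where "w x = 1 - (\<Sum>j<n. (norm (q j x))\<^sup>2) / M" for x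
  have w_smooth: "(\<lambda>x. complex_of_real (w x)) \<in> smooth_funs G"
  proof -
    have "(\<lambda>x. 1 + complex_of_real (- 1 / M) * h x) \<in> smooth_funs G"
      by (intro smooth_funs_add smooth_funs_mult smooth_funs_const h)
    moreover have "1 + complex_of_real (- 1 / M) * h x = complex_of_real (w x)" for x
      unfolding hr w_def by simp
    ultimately show ?thesis by simp
  qed
  \<comment> \<open>After translating the integration variable, the weight in the convolution
    appears at the inverse argument, so concentration is applied to w composed with
    inversion.\<close>
  define g where "g z = w (inv z)" for z
  have w01: "0 \<le> w x" "w x \<le> 1" if "x \<in> carrier G" for x
  proof -
    have "0 \<le> (\<Sum>j<n. (norm (q j x))\<^sup>2)" by (intro sum_nonneg) simp
    moreover from this have "(\<Sum>j<n. (norm (q j x))\<^sup>2) \<le> M" using M(2)[OF that] unfolding hr norm_of_real by simp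
    ultimately show "0 \<le> w x" "w x \<le> 1" using M(1) by (simp_all add: w_def)
  qed
  have w1: "w x = 1 \<longleftrightarrow> x = \<one>" if x: "x \<in> carrier G" for x
  proof -
    have "w x = 1 \<longleftrightarrow> (\<Sum>j<n. (norm (q j x))\<^sup>2) = 0" using M(1) by (simp add: w_def)
    also have "\<dots> \<longleftrightarrow> (\<forall>j<n. q j x = 0)" by (subst sum_nonneg_eq_0_iff) auto
    also have "\<dots> \<longleftrightarrow> x = \<one>" using zero x by blast
    finally show ?thesis .
  qed
  have wc: "continuous_map (topo G) euclidean w"
  proof -
    have "continuous_map (topo G) euclidean (\<lambda>x. Re (complex_of_real (w x)))"
      by (rule continuous_map_compose_on[of _ UNIV]) (use smooth_funs_continuous[OF w_smooth] in \<open>auto intro: continuous_intros\<close>)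
    then show ?thesis by simp
  qed
  have gc: "continuous_map (topo G) euclidean g"
    using continuous_map_compose[OF inv_continuous wc] by (simp add: g_def[abs_def] o_def)
  define r where "r i j x = \<xi> x $$ (i, j)" for i j x
  have rc: "continuous_map (topo G) euclidean (r i j)" if "i < d" "j < d" for i j
    using \<xi> that unfolding unitary_rep_def r_def[abs_def] by blast
  have r_mult: "r i j (x \<otimes> y) = (\<Sum>k<d. r i k x * r k j y)" if "x \<in> carrier G" "y \<in> carrier G" "i < d" "j < d" for i j x y
  proof -
    have "\<xi> x \<in> carrier_mat d d" "\<xi> y \<in> carrier_mat d d" "\<xi> (x \<otimes> y) = \<xi> x * \<xi> y"
      using \<xi> that unfolding unitary_rep_def by blast+
    then show ?thesis using that by (simp add: r_def scalar_prod_def atLeast0LessThan)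
  qed
  have r1: "r i j \<one> = (if i = j then 1 else 0)" if "i < d" "j < d" for i j
    using that by (simp add: r_def unitary_rep_one[OF \<xi>])
  have d: "d > 0" using ij by simp
  define f where "f = (\<lambda>(i, j) x. r i j x - (if i = j then 1 else 0))"
  obtain k where k: "0 < (LINT x|haar G. g x ^ k)" "\<And>p. p \<in> {..<d} \<times> {..<d} \<Longrightarrow>
      norm (LINT x|haar G. complex_of_real (g x ^ k) * f p x) \<le> 1 / (2 * real d) * (LINT x|haar G. g x ^ k)"
  proof (rule powers_concentrate[OF gc])
    show "0 \<le> g x \<and> g x \<le> 1" if "x \<in> carrier G" for x using w01[of "inv x"] that by (simp add: g_def)
    show "g \<one> = 1" using w1[of \<one>] by (simp add: g_def)
    show "x = \<one>" if "x \<in> carrier G" "g x = 1" for x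
      using w1[of "inv x"] that inv_inv[of x] by (auto simp: g_def)
    show "finite ({..<d} \<times> {..<d})" by simp
    show "continuous_map (topo G) euclidean (f p)" if "p \<in> {..<d} \<times> {..<d}" for p
      using that rc by (auto simp: f_def split: prod.splits intro!: continuous_map_diff)
    show "f p \<one> = 0" if "p \<in> {..<d} \<times> {..<d}" for p using that r1 by (auto simp: f_def)
    show "1 / (2 * real d) > 0" using d by simp
  qed (rule that)
  define c where "c = (LINT x|haar G. g x ^ k)"
  have c: "c > 0" using k(1) by (simp add: c_def)
  define A where "A i j = (LINT x|haar G. complex_of_real (g x ^ k) * r i j x)" for i j
  have gkc: "continuous_map (topo G) euclidean (\<lambda>x. complex_of_real (g x ^ k))"
    by (rule continuous_map_compose_on[of _ UNIV g]) (use gc in \<open>auto intro: continuous_intros\<close>)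
  have grc: "continuous_map (topo G) euclidean (\<lambda>x. complex_of_real (g x ^ k) * r i j x)" if "i < d" "j < d" for i j
    by (rule continuous_map_mult[OF gkc rc[OF that]])
  \<comment> \<open>A / c is the average of \<xi> with respect to a normalised weight, to be
    compared with the value of \<xi> at the unit, the identity matrix.\<close>
  have A: "norm (A i j / c - (if i = j then 1 else 0)) \<le> 1 / (2 * real d)" if "i < d" "j < d" for i j
  proof -
    have cc: "(LINT x|haar G. complex_of_real (g x ^ k)) = complex_of_real c"
      unfolding c_def by (rule integral_complex_of_real)
    have "(LINT x|haar G. complex_of_real (g x ^ k) * f (i, j) x)
      = (LINT x|haar G. complex_of_real (g x ^ k) * r i j x - complex_of_real (g x ^ k) * (if i = j then 1 else 0))"
      by (simp add: f_def right_diff_distrib)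
    also have "\<dots> = A i j - complex_of_real c * (if i = j then 1 else 0)"
      unfolding A_def cc[symmetric]
      using continuous_integrable[OF grc[OF that]] continuous_integrable[OF gkc] by simp
    finally have "norm (A i j - complex_of_real c * (if i = j then 1 else 0)) \<le> 1 / (2 * real d) * c"
      using k(2)[of "(i, j)"] that by (simp add: c_def)
    moreover have "A i j / c - (if i = j then 1 else 0) = (A i j - complex_of_real c * (if i = j then 1 else 0)) / c"
      using c by (simp add: diff_divide_distrib)
    ultimately show ?thesis using c by (simp only: norm_divide norm_of_real) (simp add: pos_divide_le_eq)
  qed
  obtain B where B: "\<And>i j. i < d \<Longrightarrow> j < d \<Longrightarrow> (\<Sum>k<d. A i k / c * B k j) = (if i = j then 1 else 0)"
    using near_identity_right_inverse[of d "\<lambda>i j. A i j / c", OF A] by metis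
  define \<phi> where "\<phi> x = complex_of_real (w x ^ k)" for x
  have \<phi>: "\<phi> \<in> smooth_funs G" using smooth_funs_power[OF w_smooth, of k] by (simp add: \<phi>_def[abs_def])
  define F where "F i j x = (LINT y|haar G. \<phi> (inv y \<otimes> x) * r i j y)" for i j x
  have F: "F i j \<in> smooth_funs G" if "i < d" "j < d" for i j
    unfolding F_def[abs_def] by (rule smooth_funs_convolution[OF \<phi> rc[OF that]])
  have Feq: "F i j x = (\<Sum>k<d. r i k x * A k j)" if x: "x \<in> carrier G" and "i < d" "j < d" for i j x
  proof -
    have "continuous_map (topo G) (prod_topology (topo G) (topo G)) (\<lambda>y. (inv y, x))"
      using x inv_continuous by (simp add: continuous_map_pairwise o_def topspace_topo)
    from continuous_map_compose[OF continuous_map_compose[OF this mult_continuous] smooth_funs_continuous[OF \<phi>]]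
    have "continuous_map (topo G) euclidean (\<lambda>y. \<phi> (inv y \<otimes> x))" by (simp add: o_def)
    \<comment> \<open>Replacing y by x \<otimes> y removes x from the weight, and the homomorphism
      property then takes \<xi>(x) out of the integral.\<close>
    from haar_integral_translate[OF x continuous_map_mult[OF this rc[OF that(2,3)]]]
    have "F i j x = (LINT y|haar G. \<phi> (inv (x \<otimes> y) \<otimes> x) * r i j (x \<otimes> y))" by (simp add: F_def)
    also have "\<dots> = (LINT y|haar G. (\<Sum>l<d. r i l x * (complex_of_real (g y ^ k) * r l j y)))"
    proof (rule Bochner_Integration.integral_cong[OF refl])
      fix y assume "y \<in> space (haar G)"
      then have y: "y \<in> carrier G" by (simp add: space_haar)
      have "inv (x \<otimes> y) \<otimes> x = inv y" using x y by (simp add: inv_mult_group m_assoc)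
      then show "\<phi> (inv (x \<otimes> y) \<otimes> x) * r i j (x \<otimes> y) = (\<Sum>l<d. r i l x * (complex_of_real (g y ^ k) * r l j y))"
        using r_mult[OF x y that(2,3)] by (simp add: \<phi>_def g_def sum_distrib_left mult_ac)
    qed
    also have "\<dots> = (\<Sum>l<d. r i l x * A l j)"
      using continuous_integrable[OF grc] that(2,3)
      by (subst Bochner_Integration.integral_sum) (auto simp: A_def intro!: integrable_mult_right)
    finally show ?thesis .
  qed
  \<comment> \<open>In matrix form F(x) = \<xi>(x) A and (A / c) B = 1, so F(x) B / c recovers
    \<xi>(x) as a combination of smooth functions with constant coefficients.\<close>
  have "(\<lambda>x. \<Sum>m<d. F i m x * (B m j / c)) \<in> smooth_funs G"
    using ij by (intro smooth_funs_sum smooth_funs_mult F smooth_funs_const) auto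
  then show ?thesis
  proof (rule smooth_funs_cong)
    fix x assume x: "x \<in> carrier G"
    have "(\<Sum>m<d. F i m x * (B m j / c)) = (\<Sum>m<d. \<Sum>k<d. r i k x * (A k m / c * B m j))"
      using Feq[OF x ij(1)] by (simp add: sum_distrib_left sum_distrib_right mult_ac)
    also have "\<dots> = (\<Sum>k<d. r i k x * (\<Sum>m<d. A k m / c * B m j))"
      unfolding sum_distrib_left by (rule sum.swap)
    also have "\<dots> = (\<Sum>k<d. r i k x * (if k = j then 1 else 0))" using B[OF _ ij(2)] by simp
    also have "\<dots> = \<xi> x $$ (i, j)" using ij(2) by (simp add: if_distrib[of "\<lambda>a. _ * a"] r_def cong: if_cong)
    finally show "(\<Sum>m<d. F i m x * (B m j / c)) = \<xi> x $$ (i, j)" .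
  qed
qed

end

section \<open>Difference operators\<close>

lemma vector_space_complex_functions: "vector_space (\<lambda>(a::complex) f v. a * f v)"
  by unfold_locales (auto simp: fun_eq_iff algebra_simps)

lemma dist_mult_dist_mult: "dist_mult q (dist_mult r u) = dist_mult (\<lambda>x. q x * r x) u"
  by (simp add: dist_mult_def mult_ac)

context lie_group
begin

text \<open>A dimension count over the complex numbers: the differentials lie in the span of at most
  n coordinate forms and have rank n, so they contain n independent elements. A coordinate form
  outside their span would give n + 1 independent elements.\<close>

lemma real_coordinates_in_span_of_differentials:
  assumes n: "lie_dim G = n" and q: "\<And>j. j < n \<Longrightarrow> q j \<in> smooth_funs G"
    and rank: "complex_rank ((\<lambda>j. differential_unit G (q j)) ` {..<n}) = n"
    and b: "b \<in> orthobasis E"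
  obtains m where "\<And>v. v \<in> E \<Longrightarrow>
    (\<Sum>j<n. m j * dir_deriv E v (\<lambda>t. q j (chart_inv (unit_chart G) t)) unit_coord) = complex_of_real (v \<bullet> b)"
proof -
  let ?s = "\<lambda>(a::complex) f (v::'e). a * f v"
  interpret V: vector_space ?s by (rule vector_space_complex_functions)
  define dq where "dq j = differential_unit G (q j)" for j
  \<comment> \<open>Extended by zero outside E, as \<open>differential_unit\<close> is, so that
    identities on E become identities of functions.\<close>
  define \<Phi> where "\<Phi> b = (\<lambda>v. if v \<in> E then complex_of_real (v \<bullet> b) else 0)" for b
  note V = chart_img_open[OF unit_chart(1)]
  note B = orthobasis(1,2)[OF subspace_model]
  have dq: "dq j v = (if v \<in> E then dir_deriv E v (\<lambda>t. q j (chart_inv (unit_chart G) t)) unit_coord else 0)" for j v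
    by (simp add: dq_def differential_unit_def o_def)
  have sum_apply: "(\<Sum>i\<in>I. f i) v = (\<Sum>i\<in>I. f i v)" for I and f :: "'i \<Rightarrow> 'e \<Rightarrow> complex" and v
    by (induction I rule: infinite_finite_induct) auto
  have dq_span: "dq j \<in> V.span (\<Phi> ` orthobasis E)" if j: "j < n" for j
  proof -
    have "dq j = (\<Sum>c\<in>orthobasis E. ?s (dq j c) (\<Phi> c))"
    proof
      fix v
      show "dq j v = (\<Sum>c\<in>orthobasis E. ?s (dq j c) (\<Phi> c)) v"
      proof (cases "v \<in> E")
        case True
        have "dq j v = (\<Sum>c\<in>orthobasis E. (v \<bullet> c) *\<^sub>R dir_deriv E c (\<lambda>t. q j (chart_inv (unit_chart G) t)) unit_coord)"
          using dir_deriv_orthobasis[OF subspace_model V smooth_on_differentiable[OF smooth_funsD[OF q[OF j] unit_chart(1)]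
                unit_coord_mem] True] True by (simp add: dq)
        also have "\<dots> = (\<Sum>c\<in>orthobasis E. dq j c * \<Phi> c v)"
          using True B(1) by (intro sum.cong refl) (auto simp: dq \<Phi>_def scaleR_conv_of_real)
        finally show ?thesis by (simp add: sum_apply)
      next
        case False
        then show ?thesis by (simp add: sum_apply dq \<Phi>_def)
      qed
    qed
    moreover have "(\<Sum>c\<in>orthobasis E. ?s (dq j c) (\<Phi> c)) \<in> V.span (\<Phi> ` orthobasis E)"
    proof (rule V.span_sum)
      fix c assume "c \<in> orthobasis E"
      then have "\<Phi> c \<in> V.span (\<Phi> ` orthobasis E)" by (intro V.span_base) blast
      from V.span_scale[OF this, of "dq j c"] show "?s (dq j c) (\<Phi> c) \<in> V.span (\<Phi> ` orthobasis E)" .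
    qed
    ultimately show ?thesis by simp
  qed
  obtain S where S: "S \<subseteq> dq ` {..<n}" "V.independent S" "card S = V.dim (dq ` {..<n})"
    using V.basis_exists[of "dq ` {..<n}"] by metis
  have cS: "card S = n" using S(3) rank unfolding complex_rank_def dq_def by simp
  have finS: "finite S" using S(1) finite_subset by blast
  have cB: "card (\<Phi> ` orthobasis E) \<le> n"
    using card_image_le[OF B(2), of \<Phi>] orthobasis(3)[OF subspace_model] n by (simp add: lie_dim_def)
  have "\<Phi> b \<in> V.span S"
  proof (rule ccontr)
    assume nb: "\<Phi> b \<notin> V.span S"
    then have "V.independent (insert (\<Phi> b) S)" using V.independent_insert S(2) by auto
    moreover have "insert (\<Phi> b) S \<subseteq> V.span (\<Phi> ` orthobasis E)"
      using S(1) dq_span V.span_base[of "\<Phi> b"] b by auto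
    ultimately have "card (insert (\<Phi> b) S) \<le> card (\<Phi> ` orthobasis E)"
      using V.independent_span_bound[of "\<Phi> ` orthobasis E" "insert (\<Phi> b) S"] B(2) by simp
    moreover have "\<Phi> b \<notin> S" using nb V.span_base by blast
    ultimately show False using cS cB finS by simp
  qed
  then have "\<Phi> b \<in> V.span (dq ` {..<n})" using V.span_mono[OF S(1)] by blast
  then obtain u where u: "\<Phi> b = (\<Sum>f\<in>dq ` {..<n}. ?s (u f) f)"
    using V.span_finite[of "dq ` {..<n}"] by auto
  \<comment> \<open>Rank n forces the n differentials to be pairwise distinct, so coefficients
    attached to functions can be indexed by j.\<close>
  have "card (dq ` {..<n}) = card {..<n}"
    using card_mono[OF _ S(1)] cS card_image_le[of "{..<n}" dq] by simp
  then have "inj_on dq {..<n}" by (intro eq_card_imp_inj_on) auto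
  then have u: "\<Phi> b = (\<Sum>j<n. ?s (u (dq j)) (dq j))" unfolding u by (simp add: sum.reindex)
  show thesis
  proof (rule that[of "\<lambda>j. u (dq j)"])
    fix v assume v: "v \<in> E"
    have "\<Phi> b v = (\<Sum>j<n. u (dq j) * dq j v)" unfolding u sum_apply ..
    then show "(\<Sum>j<n. u (dq j) * dir_deriv E v (\<lambda>t. q j (chart_inv (unit_chart G) t)) unit_coord) = complex_of_real (v \<bullet> b)"
      using v by (simp add: dq \<Phi>_def)
  qed
qed

lemma vanishes_of_order_Taylor:
  assumes n: "lie_dim G = n" and q: "\<And>j. j < n \<Longrightarrow> q j \<in> smooth_funs G"
    and q1: "\<And>j. j < n \<Longrightarrow> vanishes_of_order G 1 (q j)"
    and rank: "complex_rank ((\<lambda>j. differential_unit G (q j)) ` {..<n}) = n"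
    and p: "p \<in> smooth_funs G" "vanishes_of_order G l p"
  obtains c where "vanishes_of_order G N (\<lambda>x. p x -
    (\<Sum>\<alpha> | \<alpha> \<in> multi_indices n \<and> l \<le> (\<Sum>j<n. \<alpha> j) \<and> (\<Sum>j<n. \<alpha> j) < N. c \<alpha> * monom_fun n q \<alpha> x))"
    "(\<lambda>x. p x - (\<Sum>\<alpha> | \<alpha> \<in> multi_indices n \<and> l \<le> (\<Sum>j<n. \<alpha> j) \<and> (\<Sum>j<n. \<alpha> j) < N. c \<alpha> * monom_fun n q \<alpha> x))
      \<in> smooth_funs G"
proof -
  let ?i = "chart_inv (unit_chart G)"
  have "\<forall>b\<in>orthobasis E. \<exists>m. \<forall>v\<in>E.
      (\<Sum>j<n. m j * dir_deriv E v (\<lambda>t. q j (?i t)) unit_coord) = complex_of_real (v \<bullet> b)"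
  proof
    fix b assume b: "b \<in> orthobasis E"
    obtain m where "\<And>v. v \<in> E \<Longrightarrow>
        (\<Sum>j<n. m j * dir_deriv E v (\<lambda>t. q j (?i t)) unit_coord) = complex_of_real (v \<bullet> b)"
      by (rule real_coordinates_in_span_of_differentials[OF n q rank b]) (assumption, rule that)
    then show "\<exists>m. \<forall>v\<in>E. (\<Sum>j<n. m j * dir_deriv E v (\<lambda>t. q j (?i t)) unit_coord) = complex_of_real (v \<bullet> b)"
      by (intro exI[of _ m] ballI)
  qed
  from bchoice[OF this] obtain m where m: "\<forall>b\<in>orthobasis E. \<forall>v\<in>E.
      (\<Sum>j<n. m b j * dir_deriv E v (\<lambda>t. q j (?i t)) unit_coord) = complex_of_real (v \<bullet> b)" by (elim exE)
  note m = bspec[OF bspec[OF m]]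
  have q0: "q j (?i unit_coord) = 0" if "j < n" for j
    using q1[OF that] vanishes_of_order_iff_flat[OF q[OF that], of 1] by (simp add: flat_at_Suc)
  have "flat_at E unit_coord l (\<lambda>t. p (?i t))" using p vanishes_of_order_iff_flat by blast
  from flat_at_Taylor[OF subspace_model chart_img_open[OF unit_chart(1)] unit_coord_mem
      smooth_funsD[OF q unit_chart(1)] q0 m smooth_funsD[OF p(1) unit_chart(1)] this, of N]
  obtain c where c: "flat_at E unit_coord N (\<lambda>t. p (?i t) -
    (\<Sum>\<alpha> | \<alpha> \<in> multi_indices n \<and> l \<le> (\<Sum>j<n. \<alpha> j) \<and> (\<Sum>j<n. \<alpha> j) < N. c \<alpha> * monom_fun n (\<lambda>j t. q j (?i t)) \<alpha> t))"
    by auto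
  define r where "r x = p x - (\<Sum>\<alpha> | \<alpha> \<in> multi_indices n \<and> l \<le> (\<Sum>j<n. \<alpha> j) \<and> (\<Sum>j<n. \<alpha> j) < N. c \<alpha> * monom_fun n q \<alpha> x)" for x
  have mon: "monom_fun n q \<alpha> \<in> smooth_funs G" for \<alpha>
    unfolding monom_fun_def[abs_def] by (intro smooth_funs_prod smooth_funs_power q) auto
  have "(\<lambda>x. p x + (- 1) * (\<Sum>\<alpha> | \<alpha> \<in> multi_indices n \<and> l \<le> (\<Sum>j<n. \<alpha> j) \<and> (\<Sum>j<n. \<alpha> j) < N. c \<alpha> * monom_fun n q \<alpha> x))
      \<in> smooth_funs G"
    by (intro smooth_funs_add p(1) smooth_funs_mult[OF smooth_funs_const] smooth_funs_sum mon)
  then have r: "r \<in> smooth_funs G" by (simp add: r_def[abs_def])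
  have "vanishes_of_order G N r"
    using c unfolding vanishes_of_order_iff_flat[OF r] by (simp add: r_def monom_fun_def)
  then show thesis using r unfolding r_def by (rule that)
qed

end

section \<open>Powers of difference operators as multiplications by monomials\<close>

context compact_lie_group
begin

text \<open>The action of D is known only on Fourier transforms of distributions, so iteration
  relies on multiplication by smooth functions preserving distributions.\<close>

lemma represents_power:
  assumes q: "q \<in> smooth_funs G" "represents G q D" and u: "u \<in> distributions G"
  shows "(D ^^ k) (fourier G u) = fourier G (dist_mult (\<lambda>x. q x ^ k) u)"
proof (induction k)
  case 0
  then show ?case by (simp add: dist_mult_def)
next
  case (Suc k)
  have "(D ^^ Suc k) (fourier G u) = D (fourier G (dist_mult (\<lambda>x. q x ^ k) u))" using Suc by simp
  also have "\<dots> = fourier G (dist_mult q (dist_mult (\<lambda>x. q x ^ k) u))"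
    using q(2) dist_mult_distributions[OF u smooth_funs_power[OF q(1)]] unfolding represents_def by blast
  finally show ?case by (simp add: dist_mult_dist_mult)
qed

lemma represents_diff_power:
  assumes q: "\<And>j. j < n \<Longrightarrow> q j \<in> smooth_funs G" "\<And>j. j < n \<Longrightarrow> represents G (q j) (\<Delta> j)"
    and u: "u \<in> distributions G"
  shows "diff_power n \<Delta> \<alpha> (fourier G u) = fourier G (dist_mult (monom_fun n q \<alpha>) u)"
proof -
  \<comment> \<open>Stated for arbitrary index lists so that the induction can follow
    \<open>foldr\<close>.\<close>
  have *: "foldr (\<lambda>j S. (\<Delta> j ^^ \<alpha> j) \<circ> S) js id (fourier G u)
      = fourier G (dist_mult (\<lambda>x. \<Prod>j\<leftarrow>js. q j x ^ \<alpha> j) u)"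
    if "set js \<subseteq> {..<n}" for js
    using that
  proof (induction js)
    case Nil
    then show ?case by (simp add: dist_mult_def)
  next
    case (Cons j js)
    have "(\<lambda>x. \<Prod>j\<leftarrow>js. q j x ^ \<alpha> j) \<in> smooth_funs G"
      using Cons.prems by (induction js) (auto intro!: smooth_funs_const smooth_funs_mult smooth_funs_power q)
    from represents_power[OF q(1) q(2) dist_mult_distributions[OF u this], of j "\<alpha> j"] Cons
    show ?case by (simp add: dist_mult_dist_mult)
  qed
  have "(\<Prod>j\<leftarrow>[0..<n]. f j) = (\<Prod>j<n. f j)" for f :: "nat \<Rightarrow> complex"
    by (simp add: prod.distinct_set_conv_list[symmetric] atLeast0LessThan)
  then have "(\<lambda>x. \<Prod>j\<leftarrow>[0..<n]. q j x ^ \<alpha> j) = monom_fun n q \<alpha>"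
    by (auto simp: monom_fun_def)
  then show ?thesis using *[of "[0..<n]"] by (simp add: diff_power_def atLeast0LessThan)
qed

end

theorem lemma3p1:
  fixes G :: "('g, 'e::euclidean_space) lie_group_data"
    and \<Delta> :: "nat \<Rightarrow> 'g dual_field \<Rightarrow> 'g dual_field"
    and Q :: "'g dual_field \<Rightarrow> 'g dual_field"
    and n l :: nat
  assumes "compact_lie_group G"
    and "lie_dim G = n"
    and "strongly_admissible G n \<Delta>"
    and "Q \<in> diff_ops G l"
  shows "\<forall>N::nat. \<exists>c :: (nat \<Rightarrow> nat) \<Rightarrow> complex. \<exists>Q\<^sub>N \<in> diff_ops G N.
           \<forall>\<sigma> \<in> fourier_fields G.
             Q \<sigma> = field_add G
                (field_lincomb G {\<alpha> \<in> multi_indices n. l \<le> (\<Sum>j<n. \<alpha> j) \<and> (\<Sum>j<n. \<alpha> j) < N}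
                   c (\<lambda>\<alpha>. diff_power n \<Delta> \<alpha> \<sigma>))
                (Q\<^sub>N \<sigma>)"
proof
  fix N :: nat
  interpret compact_lie_group G by (rule assms(1))
  obtain q where q: "\<And>j. j < n \<Longrightarrow> q j \<in> smooth_funs G" "\<And>j. j < n \<Longrightarrow> vanishes_of_order G 1 (q j)"
    "\<And>j. j < n \<Longrightarrow> represents G (q j) (\<Delta> j)"
    "complex_rank ((\<lambda>j. differential_unit G (q j)) ` {..<n}) = n"
    "{x \<in> carrier G. \<forall>j<n. q j x = 0} = {\<one>\<^bsub>G\<^esub>}"
    using assms(3) unfolding strongly_admissible_def by auto
  obtain p where p: "p \<in> smooth_funs G" "vanishes_of_order G l p" "represents G p Q"
    using assms(4) unfolding diff_ops_def by auto
  define A where "A = {\<alpha> \<in> multi_indices n. l \<le> (\<Sum>j<n. \<alpha> j) \<and> (\<Sum>j<n. \<alpha> j) < N}"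
  have finA: "finite A" by (rule finite_subset[OF _ finite_multi_indices[of n N]]) (auto simp: A_def)
  obtain c where c: "vanishes_of_order G N (\<lambda>x. p x - (\<Sum>\<alpha>\<in>A. c \<alpha> * monom_fun n q \<alpha> x))"
    "(\<lambda>x. p x - (\<Sum>\<alpha>\<in>A. c \<alpha> * monom_fun n q \<alpha> x)) \<in> smooth_funs G"
    by (rule vanishes_of_order_Taylor[OF assms(2) q(1,2,4) p(1,2), of N, folded A_def]) (assumption, assumption, rule that)
  have mon: "monom_fun n q \<alpha> \<in> smooth_funs G" for \<alpha>
    unfolding monom_fun_def[abs_def] by (intro smooth_funs_prod smooth_funs_power q(1)) auto
  define r where "r x = p x - (\<Sum>\<alpha>\<in>A. c \<alpha> * monom_fun n q \<alpha> x)" for x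
  \<comment> \<open>Defined through the operators themselves, so the decomposition holds entry by
    entry. What remains is that r represents this operator, which puts it into
    \<open>diff_ops G N\<close>.\<close>
  define Q\<^sub>N where "Q\<^sub>N \<sigma> = (\<lambda>\<xi>\<in>irreps G. Matrix.mat (rep_dim G \<xi>) (rep_dim G \<xi>)
    (\<lambda>ij. Q \<sigma> \<xi> $$ ij - (\<Sum>\<alpha>\<in>A. c \<alpha> * diff_power n \<Delta> \<alpha> \<sigma> \<xi> $$ ij)))" for \<sigma> :: "'g dual_field"
  have Qu: "Q (fourier G u) = fourier G (dist_mult p u)" if "u \<in> distributions G" for u
    using p(3) that unfolding represents_def by blast
  have Du: "diff_power n \<Delta> \<alpha> (fourier G u) = fourier G (dist_mult (monom_fun n q \<alpha>) u)"
    if "u \<in> distributions G" for u \<alpha>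
    by (rule represents_diff_power[OF q(1,3) that])
  have "represents G r Q\<^sub>N"
    unfolding represents_def
  proof (intro ballI ext)
    fix u \<xi> assume u: "u \<in> distributions G"
    show "Q\<^sub>N (fourier G u) \<xi> = fourier G (dist_mult r u) \<xi>"
    proof (cases "\<xi> \<in> irreps G")
      case True
      then obtain d where d: "unitary_rep G d \<xi>" by (auto simp: irreps_def)
      have xi: "\<xi> x \<in> carrier_mat d d" if "x \<in> carrier G" for x using d that unfolding unitary_rep_def by blast
      have dim: "rep_dim G \<xi> = d" using xi[OF one_closed] by (simp add: rep_dim_def)
      have entry: "u (\<lambda>x. p x * mat_adjoint (\<xi> x) $$ (i, j)) - (\<Sum>\<alpha>\<in>A. c \<alpha> * u (\<lambda>x. monom_fun n q \<alpha> x * mat_adjoint (\<xi> x) $$ (i, j)))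
          = u (\<lambda>x. r x * mat_adjoint (\<xi> x) $$ (i, j))" if ij: "i < d" "j < d" for i j
      proof -
        define e where "e x = mat_adjoint (\<xi> x) $$ (i, j)" for x
        \<comment> \<open>The (i, j) entry of the adjoint is the conjugate of the (j, i) matrix
          coefficient of \<xi>.\<close>
        have e: "e \<in> smooth_funs G"
          by (rule smooth_funs_cong[OF smooth_funs_cnj[OF matrix_coefficient_smooth[OF q(1,5) d ij(2,1)]]])
            (simp_all add: e_def mat_adjoint_complex(2)[OF xi ij])
        \<comment> \<open>The index None stands for p and Some \<beta> for the monomial of \<beta>,
          so that r times the entry is a single finite linear combination to which
          \<open>distribution_sum\<close> applies.\<close>
        define a where "a \<alpha> = (case \<alpha> of None \<Rightarrow> 1 | Some \<beta> \<Rightarrow> - c \<beta>)" for \<alpha>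
        define h where "h \<alpha> = (\<lambda>x. (case \<alpha> of None \<Rightarrow> p x | Some \<beta> \<Rightarrow> monom_fun n q \<beta> x) * e x)" for \<alpha>
        have sum_opt: "(\<Sum>\<alpha>\<in>insert None (Some ` A). F \<alpha>) = F None + (\<Sum>\<alpha>\<in>A. F (Some \<alpha>))" for F :: "_ \<Rightarrow> complex"
          using finA by (subst sum.insert) (auto simp: sum.reindex)
        have "u (\<lambda>x. \<Sum>\<alpha>\<in>insert None (Some ` A). a \<alpha> * h \<alpha> x) = (\<Sum>\<alpha>\<in>insert None (Some ` A). a \<alpha> * u (h \<alpha>))"
          using finA by (intro distribution_sum[OF u]) (auto simp: h_def intro!: smooth_funs_mult e p(1) mon)
        moreover have "(\<Sum>\<alpha>\<in>insert None (Some ` A). a \<alpha> * h \<alpha> x) = r x * e x" for x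
          unfolding sum_opt by (simp add: a_def h_def r_def left_diff_distrib sum_distrib_right sum_negf mult.assoc)
        ultimately show ?thesis
          unfolding sum_opt by (simp add: a_def h_def e_def sum_negf)
      qed
      show ?thesis
        unfolding Q\<^sub>N_def Qu[OF u] Du[OF u] using True entry
        by (intro eq_matI) (simp_all add: fourier_def dim dist_mult_def)
    next
      case False
      then show ?thesis by (simp add: Q\<^sub>N_def fourier_def)
    qed
  qed
  then have QN: "Q\<^sub>N \<in> diff_ops G N" unfolding diff_ops_def using c by (auto simp: r_def[abs_def])
  have "Q \<sigma> = field_add G (field_lincomb G A c (\<lambda>\<alpha>. diff_power n \<Delta> \<alpha> \<sigma>)) (Q\<^sub>N \<sigma>)" if field: "\<sigma> \<in> fourier_fields G" for \<sigma>
  proof -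
    obtain u where u: "u \<in> distributions G" and \<sigma>: "\<sigma> = fourier G u"
      using field unfolding fourier_fields_def by blast
    show ?thesis
    proof
      fix \<xi>
      show "Q \<sigma> \<xi> = field_add G (field_lincomb G A c (\<lambda>\<alpha>. diff_power n \<Delta> \<alpha> \<sigma>)) (Q\<^sub>N \<sigma>) \<xi>"
      proof (cases "\<xi> \<in> irreps G")
        case True
        \<comment> \<open>Both sides agree entrywise by construction; equality of matrices also
          requires that \<open>Q \<sigma> \<xi>\<close> has the dimensions of the
          representation.\<close>
        have "Q \<sigma> \<xi> \<in> carrier_mat (rep_dim G \<xi>) (rep_dim G \<xi>)"
          unfolding \<sigma> Qu[OF u] using True by (simp add: fourier_def)
        then show ?thesis
          using True by (intro eq_matI) (auto simp: field_add_def field_lincomb_def Q\<^sub>N_def)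
      next
        case False
        then show ?thesis unfolding \<sigma> Qu[OF u] by (simp add: fourier_def field_add_def)
      qed
    qed
  qed
  then show "\<exists>c. \<exists>Q\<^sub>N \<in> diff_ops G N. \<forall>\<sigma> \<in> fourier_fields G.
             Q \<sigma> = field_add G
                (field_lincomb G {\<alpha> \<in> multi_indices n. l \<le> (\<Sum>j<n. \<alpha> j) \<and> (\<Sum>j<n. \<alpha> j) < N}
                   c (\<lambda>\<alpha>. diff_power n \<Delta> \<alpha> \<sigma>))
                (Q\<^sub>N \<sigma>)"
    using QN unfolding A_def by blast
qed

end
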